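(* Let $n\ge1$ and let $B$ be a finitely generated commutative associative unital algebra over $\mathbb{C}$. Any uniformly bounded irreducible $W_n\otimes B$-module is a single point evaluation module.
   Context: $A_n=\mathbb{C}[t_1^{\pm1},\dots,t_n^{\pm1}]$, $d_i=t_i\frac{d}{dt_i}$, and $W_n=\mathrm{Der}(A_n)$ is the Witt algebra, with basis $t^{m}d_i$ ($m\in\mathbb{Z}^n$, $1\le i\le n$) and bracket $[t^md_i,t^kd_j]=k_it^{m+k}d_j-m_jt^{m+k}d_i$. $W_n\otimes B$ has bracket $[x\otimes b,y\otimes b']=[x,y]\otimes bb'$. Weights are taken with respect to $H=\bigoplus_i\mathbb{C}d_i$ (acting as $H\otimes1$). A module is uniformly bounded if it is a direct sum of its weight spaces and there is $N\in\mathbb{N}$ with $\dim V_\lambda<N$ for all weights $\lambda$. A $\mathfrak{g}\otimes B$-module $V$ is a single point evaluation module if there is an algebra homomorphism $\eta:B\to\mathbb{C}$ with $(x\otimes b)v=\eta(b)(x\otimes1)v$ for all $x\in\mathfrak{g}$, $b\in B$, $v\in V$. *)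

theory Defs
  imports "HOL-Analysis.Finite_Cartesian_Product" "HOL-Library.Poly_Mapping"
begin

section \<open>Complex vector spaces, algebras and Lie algebras\<close>

class complex_vector = ab_group_add +
  fixes scaleC :: "complex \<Rightarrow> 'a \<Rightarrow> 'a"  (infixr \<open>*\<^sub>C\<close> 75)
  assumes scaleC_add_right: "a *\<^sub>C (x + y) = a *\<^sub>C x + a *\<^sub>C y"
    and scaleC_add_left: "(a + b) *\<^sub>C x = a *\<^sub>C x + b *\<^sub>C x"
    and scaleC_scaleC [simp]: "a *\<^sub>C b *\<^sub>C x = (a * b) *\<^sub>C x"
    and scaleC_one [simp]: "1 *\<^sub>C x = x"

global_interpretation complex_vector: vector_space "scaleC :: complex \<Rightarrow> 'a \<Rightarrow> 'a::complex_vector"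
  by unfold_locales (simp_all add: scaleC_add_right scaleC_add_left)

abbreviation clinear :: "('a::complex_vector \<Rightarrow> 'b::complex_vector) \<Rightarrow> bool"
  where "clinear \<equiv> Vector_Spaces.linear scaleC scaleC"

definition cbilinear :: "('a::complex_vector \<Rightarrow> 'b::complex_vector \<Rightarrow> 'c::complex_vector) \<Rightarrow> bool"
  where "cbilinear f \<longleftrightarrow> (\<forall>x. clinear (f x)) \<and> (\<forall>y. clinear (\<lambda>x. f x y))"

lemma clinear_iff:
  "clinear f \<longleftrightarrow> (\<forall>x y. f (x + y) = f x + f y) \<and> (\<forall>c x. f (c *\<^sub>C x) = c *\<^sub>C f x)"
  by (simp add: Vector_Spaces.linear_def module_hom_def module_hom_axioms_def
      complex_vector.vector_space_axioms complex_vector.module_axioms)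

lemma clinear_0: "clinear f \<Longrightarrow> f 0 = 0"
  by (metis clinear_iff complex_vector.scale_zero_left)

lemma clinear_compose: "clinear f \<Longrightarrow> clinear g \<Longrightarrow> clinear (\<lambda>x. f (g x))"
  by (simp add: clinear_iff)

lemma clinear_minus: "clinear f \<Longrightarrow> f (- x) = - f x"
  by (metis add.right_inverse clinear_0 clinear_iff eq_neg_iff_add_eq_0 add.commute)

lemma clinear_diff: "clinear f \<Longrightarrow> f (x - y) = f x - f y"
  by (metis add_uminus_conv_diff clinear_iff clinear_minus)

text \<open>Unital commutative algebras; \<open>comm_ring_1\<close> includes \<open>0 \<noteq> 1\<close>, so the zero algebra is excluded
  (it admits no unital homomorphism to \<open>\<complex>\<close>).\<close>

class complex_comm_algebra = complex_vector + comm_ring_1 +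
  assumes scaleC_mult_left: "(c *\<^sub>C x) * y = c *\<^sub>C (x * y)"
begin

lemma scaleC_mult_right: "x * (c *\<^sub>C y) = c *\<^sub>C (x * y)"
  by (metis mult.commute scaleC_mult_left)

end

definition subalgebra :: "'a::complex_comm_algebra set \<Rightarrow> bool"
  where "subalgebra S \<longleftrightarrow> complex_vector.subspace S \<and> 1 \<in> S \<and> (\<forall>x\<in>S. \<forall>y\<in>S. x * y \<in> S)"

definition finitely_generated_algebra :: "'a::complex_comm_algebra itself \<Rightarrow> bool"
  where "finitely_generated_algebra _ \<longleftrightarrow>
    (\<exists>S :: 'a set. finite S \<and> subalgebra hull S = UNIV)"

definition algebra_hom :: "('a::complex_comm_algebra \<Rightarrow> 'b::complex_comm_algebra) \<Rightarrow> bool"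
  where "algebra_hom f \<longleftrightarrow> clinear f \<and> f 1 = 1 \<and> (\<forall>x y. f (x * y) = f x * f y)"

instantiation complex :: complex_comm_algebra
begin

definition scaleC_complex :: "complex \<Rightarrow> complex \<Rightarrow> complex"
  where [simp]: "scaleC_complex a b = a * b"

instance
  by standard (simp_all add: algebra_simps)

end

class complex_lie_algebra = complex_vector +
  fixes lie_bracket :: "'a \<Rightarrow> 'a \<Rightarrow> 'a"
  assumes lie_bracket_add_left: "lie_bracket (x + y) z = lie_bracket x z + lie_bracket y z"
    and lie_bracket_add_right: "lie_bracket z (x + y) = lie_bracket z x + lie_bracket z y"
    and lie_bracket_scaleC_left: "lie_bracket (c *\<^sub>C x) y = c *\<^sub>C lie_bracket x y"
    and lie_bracket_scaleC_right: "lie_bracket x (c *\<^sub>C y) = c *\<^sub>C lie_bracket x y"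
    and lie_bracket_self: "lie_bracket x x = 0"
    and lie_jacobi: "lie_bracket x (lie_bracket y z) + lie_bracket y (lie_bracket z x)
        + lie_bracket z (lie_bracket x y) = 0"

lemma cbilinear_lie_bracket: "cbilinear (lie_bracket :: 'a::complex_lie_algebra \<Rightarrow> _)"
  by (simp add: cbilinear_def clinear_iff lie_bracket_add_left lie_bracket_add_right
      lie_bracket_scaleC_left lie_bracket_scaleC_right)

lemma lie_bracket_swap: "lie_bracket x y = - lie_bracket y (x :: 'a::complex_lie_algebra)"
proof -
  have "lie_bracket x y + lie_bracket y x = lie_bracket (x + y) (x + y) - lie_bracket x x - lie_bracket y y"
    unfolding lie_bracket_add_left lie_bracket_add_right by simp
  then have "lie_bracket x y + lie_bracket y x = 0"
    unfolding lie_bracket_self by simp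
  then show ?thesis by (rule eq_neg_iff_add_eq_0[THEN iffD2])
qed

section \<open>Finitely supported functions\<close>

instantiation poly_mapping :: (type, complex_vector) complex_vector
begin

definition scaleC_poly_mapping :: "complex \<Rightarrow> ('a \<Rightarrow>\<^sub>0 'b) \<Rightarrow> ('a \<Rightarrow>\<^sub>0 'b)"
  where "scaleC_poly_mapping c p = Poly_Mapping.map (scaleC c) p"

lemma lookup_scaleC: "Poly_Mapping.lookup (c *\<^sub>C p) k = c *\<^sub>C Poly_Mapping.lookup p k"
  by (simp add: scaleC_poly_mapping_def Poly_Mapping.map.rep_eq "when_def")

instance
  by standard (auto intro!: poly_mapping_eqI
      simp: lookup_scaleC lookup_add scaleC_add_right scaleC_add_left)

end

lemma scaleC_single: "c *\<^sub>C Poly_Mapping.single k x = Poly_Mapping.single k (c *\<^sub>C x)"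
  by (rule poly_mapping_eqI) (simp add: lookup_scaleC lookup_single "when_def")

lemma poly_mapping_sum_single:
  "p = (\<Sum>k\<in>Poly_Mapping.keys p. Poly_Mapping.single k (Poly_Mapping.lookup p k))"
  by (rule poly_mapping_eqI)
    (simp add: lookup_sum lookup_single "when_def" in_keys_iff)

instance poly_mapping :: (comm_monoid_add, complex_comm_algebra) complex_comm_algebra
proof
  fix c :: complex and p q :: "'a \<Rightarrow>\<^sub>0 'b"
  have scale: "c *\<^sub>C r = Poly_Mapping.single 0 (c *\<^sub>C 1) * r" for r :: "'a \<Rightarrow>\<^sub>0 'b"
  proof -
    have "c *\<^sub>C r = Poly_Mapping.map ((*) (c *\<^sub>C 1)) r"
      by (rule poly_mapping_eqI)
        (simp add: lookup_scaleC Poly_Mapping.map.rep_eq "when_def" scaleC_mult_left)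
    then show ?thesis by (simp add: mult_map_scale_conv_mult)
  qed
  show "c *\<^sub>C p * q = c *\<^sub>C (p * q)"
    by (simp add: scale mult.assoc)
qed

section \<open>The Witt algebra\<close>

text \<open>
  The Laurent polynomial algebra in variables indexed by the finite type \<open>'n\<close> is the group
  algebra of \<open>\<int>\<^sup>n\<close>: the monomial \<open>t\<^sup>m\<close> is \<open>Poly_Mapping.single m 1\<close>, and multiplication is convolution.
\<close>

type_synonym 'n laurent = "(int ^ 'n) \<Rightarrow>\<^sub>0 complex"

definition derivation :: "('a::complex_comm_algebra \<Rightarrow> 'a) \<Rightarrow> bool"
  where "derivation D \<longleftrightarrow> clinear D \<and> (\<forall>f g. D (f * g) = D f * g + f * D g)"

typedef 'n witt = "{D :: 'n::finite laurent \<Rightarrow> 'n laurent. derivation D}"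
  morphisms der_apply Abs_witt
  by (rule exI[of _ "\<lambda>_. 0"]) (simp add: derivation_def clinear_iff)

setup_lifting type_definition_witt

lemma derivation_der_apply: "derivation (der_apply D)"
  using der_apply by blast

instantiation witt :: (finite) complex_lie_algebra
begin

lift_definition zero_witt :: "'a witt" is "\<lambda>_. 0"
  by (simp add: derivation_def clinear_iff)

lift_definition plus_witt :: "'a witt \<Rightarrow> 'a witt \<Rightarrow> 'a witt" is "\<lambda>D E f. D f + E f"
  by (simp add: derivation_def clinear_iff algebra_simps scaleC_add_right)

lift_definition uminus_witt :: "'a witt \<Rightarrow> 'a witt" is "\<lambda>D f. - D f"
  by (simp add: derivation_def clinear_iff algebra_simps)

lift_definition minus_witt :: "'a witt \<Rightarrow> 'a witt \<Rightarrow> 'a witt" is "\<lambda>D E f. D f - E f"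
  by (simp add: derivation_def clinear_iff algebra_simps complex_vector.scale_right_diff_distrib)

lift_definition scaleC_witt :: "complex \<Rightarrow> 'a witt \<Rightarrow> 'a witt" is "\<lambda>c D f. c *\<^sub>C D f"
  by (simp add: derivation_def clinear_iff scaleC_add_right scaleC_mult_left scaleC_mult_right
      mult.commute)

lift_definition lie_bracket_witt :: "'a witt \<Rightarrow> 'a witt \<Rightarrow> 'a witt"
  is "\<lambda>D E f. D (E f) - E (D f)"
  by (simp add: derivation_def clinear_iff algebra_simps complex_vector.scale_right_diff_distrib)

instance
proof
  fix x y z :: "'a witt" and a b c :: complex
  show "x + y + z = x + (y + z)" by transfer (simp add: add.assoc)
  show "x + y = y + x" by transfer (simp add: add.commute)
  show "0 + x = x" by transfer simp
  show "- x + x = 0" by transfer simp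
  show "x - y = x + - y" by transfer simp
  show "a *\<^sub>C (x + y) = a *\<^sub>C x + a *\<^sub>C y" by transfer (simp add: scaleC_add_right)
  show "(a + b) *\<^sub>C x = a *\<^sub>C x + b *\<^sub>C x" by transfer (simp add: scaleC_add_left)
  show "a *\<^sub>C b *\<^sub>C x = (a * b) *\<^sub>C x" by transfer simp
  show "1 *\<^sub>C x = x" by transfer simp
  show "lie_bracket (x + y) z = lie_bracket x z + lie_bracket y z"
    by transfer (auto simp: derivation_def clinear_iff algebra_simps)
  show "lie_bracket z (x + y) = lie_bracket z x + lie_bracket z y"
    by transfer (auto simp: derivation_def clinear_iff algebra_simps)
  show "lie_bracket (c *\<^sub>C x) y = c *\<^sub>C lie_bracket x y"
    by transfer (auto simp: derivation_def clinear_iff complex_vector.scale_right_diff_distrib)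
  show "lie_bracket x (c *\<^sub>C y) = c *\<^sub>C lie_bracket x y"
    by transfer (auto simp: derivation_def clinear_iff complex_vector.scale_right_diff_distrib)
  show "lie_bracket x x = 0" by transfer simp
  show "lie_bracket x (lie_bracket y z) + lie_bracket y (lie_bracket z x)
      + lie_bracket z (lie_bracket x y) = 0"
    by transfer (auto simp: derivation_def clinear_diff)
qed

end

text \<open>The derivation \<open>t\<^sup>m d\<^sub>i\<close>, with \<open>d\<^sub>i = t\<^sub>i d/dt\<^sub>i\<close>, that is, \<open>t\<^sup>k \<mapsto> k\<^sub>i t\<^sup>(\<^sup>m\<^sup>+\<^sup>k\<^sup>)\<close>.\<close>

definition euler :: "'n::finite \<Rightarrow> 'n laurent \<Rightarrow> 'n laurent"
  where "euler i f = Poly_Mapping.mapp (\<lambda>k c. of_int (k $ i) * c) f"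

lemma lookup_euler: "Poly_Mapping.lookup (euler i f) k = of_int (k $ i) * Poly_Mapping.lookup f k"
  by (simp add: euler_def Poly_Mapping.lookup_mapp "when_def" in_keys_iff)

lemma euler_single: "euler i (Poly_Mapping.single k c) = Poly_Mapping.single k (of_int (k $ i) * c)"
  by (rule poly_mapping_eqI) (simp add: lookup_euler lookup_single "when_def")

lemma clinear_euler: "clinear (euler i)"
  by (auto simp: clinear_iff lookup_euler lookup_add lookup_scaleC algebra_simps
      intro!: poly_mapping_eqI)

lemma derivation_euler: "derivation (euler i)"
  unfolding derivation_def
proof (intro conjI allI)
  show lin: "clinear (euler i)" by (rule clinear_euler)
  have add: "euler i (sum h A) = (\<Sum>a\<in>A. euler i (h a))" for h :: "_ \<Rightarrow> 'a laurent" and A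
    by (induction A rule: infinite_finite_induct) (use lin in \<open>auto simp: clinear_iff clinear_0\<close>)
  fix f g :: "'a laurent"
  have single: "euler i (Poly_Mapping.single k c * Poly_Mapping.single l d) =
      euler i (Poly_Mapping.single k c) * Poly_Mapping.single l d
      + Poly_Mapping.single k c * euler i (Poly_Mapping.single l d)" for k l c d
    by (simp add: mult_single euler_single single_add[symmetric] algebra_simps)
  let ?f = "\<Sum>k\<in>Poly_Mapping.keys f. Poly_Mapping.single k (Poly_Mapping.lookup f k)"
  let ?g = "\<Sum>l\<in>Poly_Mapping.keys g. Poly_Mapping.single l (Poly_Mapping.lookup g l)"
  have "euler i (?f * ?g) = euler i ?f * ?g + ?f * euler i ?g"
    by (simp add: sum_product add single sum.distrib)
  then   show "euler i (f * g) = euler i f * g + f * euler i g"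
    by (simp only: poly_mapping_sum_single[symmetric])
qed

lift_definition witt_basis :: "int ^ 'n \<Rightarrow> 'n::finite \<Rightarrow> 'n witt"
  is "\<lambda>m i f. Poly_Mapping.single m 1 * euler i f"
proof -
  fix m :: "int ^ 'n" and i :: 'n
  have "derivation (euler i)" by (rule derivation_euler)
  then show "derivation (\<lambda>f. Poly_Mapping.single m 1 * euler i f)"
    by (auto simp: derivation_def clinear_iff scaleC_mult_right distrib_left mult.assoc
        mult.left_commute)
qed

lemma clinear_poly_mapping_eqI:
  fixes f g :: "('a \<Rightarrow>\<^sub>0 complex) \<Rightarrow> 'b::complex_vector"
  assumes f: "clinear f" and g: "clinear g"
    and eq: "\<And>k. f (Poly_Mapping.single k 1) = g (Poly_Mapping.single k 1)"
  shows "f p = g p"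
proof -
  have sum: "h (sum u A) = (\<Sum>a\<in>A. h (u a))"
    if "clinear h" for h :: "('a \<Rightarrow>\<^sub>0 complex) \<Rightarrow> 'b" and u and A :: "'a set"
    by (induction A rule: infinite_finite_induct) (use that in \<open>auto simp: clinear_iff clinear_0\<close>)
  have "f (Poly_Mapping.single k c) = g (Poly_Mapping.single k c)" for k c
  proof -
    have "Poly_Mapping.single k c = c *\<^sub>C Poly_Mapping.single k 1"
      by (simp add: scaleC_single)
    then show ?thesis using f g eq by (simp add: clinear_iff)
  qed
  then have "f (\<Sum>k\<in>Poly_Mapping.keys p. Poly_Mapping.single k (Poly_Mapping.lookup p k)) =
      g (\<Sum>k\<in>Poly_Mapping.keys p. Poly_Mapping.single k (Poly_Mapping.lookup p k))"
    by (simp add: sum f g)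
  then show ?thesis by (simp only: poly_mapping_sum_single[symmetric])
qed

lemma witt_eqI:
  assumes "\<And>k. der_apply D (Poly_Mapping.single k 1) = der_apply E (Poly_Mapping.single k 1)"
  shows "D = E"
proof -
  have "der_apply D f = der_apply E f" for f
    by (rule clinear_poly_mapping_eqI)
      (use derivation_der_apply assms in \<open>auto simp: derivation_def\<close>)
  then show ?thesis by (simp add: der_apply_inject[symmetric] fun_eq_iff)
qed

lemma der_apply_witt_basis_single:
  "der_apply (witt_basis m i) (Poly_Mapping.single k c) =
    Poly_Mapping.single (m + k) (of_int (k $ i) * c)"
  by (simp add: witt_basis.rep_eq euler_single mult_single)

lemma lie_bracket_witt_basis:
  "lie_bracket (witt_basis m i) (witt_basis k j) =
    of_int (k $ i) *\<^sub>C witt_basis (m + k) j - of_int (m $ j) *\<^sub>C witt_basis (m + k) i"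
  by (rule witt_eqI)
    (simp add: lie_bracket_witt.rep_eq minus_witt.rep_eq scaleC_witt.rep_eq
      der_apply_witt_basis_single scaleC_single single_diff[symmetric] ac_simps
      algebra_simps)

section \<open>Tensor products over the complex numbers\<close>

text \<open>
  The tensor product is the free vector space on \<open>'a \<times> 'b\<close> modulo the span of the
  bilinearity relations.
\<close>

definition tensor_relations :: "('a::complex_vector \<times> 'b::complex_vector \<Rightarrow>\<^sub>0 complex) set"
  where "tensor_relations =
    {Poly_Mapping.single (x + x', y) 1 - Poly_Mapping.single (x, y) 1 - Poly_Mapping.single (x', y) 1
      | x x' y. True} \<union>
    {Poly_Mapping.single (x, y + y') 1 - Poly_Mapping.single (x, y) 1 - Poly_Mapping.single (x, y') 1
      | x y y'. True} \<union>
    {Poly_Mapping.single (c *\<^sub>C x, y) 1 - c *\<^sub>C Poly_Mapping.single (x, y) 1 | c x y. True} \<union>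
    {Poly_Mapping.single (x, c *\<^sub>C y) 1 - c *\<^sub>C Poly_Mapping.single (x, y) 1 | c x y. True}"

definition tensor_eq ::
    "('a::complex_vector \<times> 'b::complex_vector \<Rightarrow>\<^sub>0 complex) \<Rightarrow> ('a \<times> 'b \<Rightarrow>\<^sub>0 complex) \<Rightarrow> bool"
  where "tensor_eq p q \<longleftrightarrow> p - q \<in> complex_vector.span tensor_relations"

lemma equivp_tensor_eq:
  "equivp (tensor_eq :: ('a::complex_vector \<times> 'b::complex_vector \<Rightarrow>\<^sub>0 complex) \<Rightarrow> _)"
  (is "equivp ?R")
proof (rule equivpI)
  show "reflp ?R"
    by (simp add: reflp_def tensor_eq_def complex_vector.span_zero)
  show "symp ?R"
    by (metis (mono_tags, lifting) complex_vector.span_neg minus_diff_eq symp_def tensor_eq_def)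
  show "transp ?R"
  proof (rule transpI)
    fix p q r :: "'a \<times> 'b \<Rightarrow>\<^sub>0 complex"
    assume "tensor_eq p q" "tensor_eq q r"
    then have "(p - q) + (q - r) \<in> complex_vector.span tensor_relations"
      unfolding tensor_eq_def by (rule complex_vector.span_add)
    then show "tensor_eq p r" by (simp add: tensor_eq_def)
  qed
qed

quotient_type (overloaded) ('a, 'b) tensor =
    "'a::complex_vector \<times> 'b::complex_vector \<Rightarrow>\<^sub>0 complex" / tensor_eq
  by (rule equivp_tensor_eq)

instantiation tensor :: (complex_vector, complex_vector) complex_vector
begin

lift_definition zero_tensor :: "('a, 'b) tensor" is 0 .

lift_definition plus_tensor :: "('a, 'b) tensor \<Rightarrow> ('a, 'b) tensor \<Rightarrow> ('a, 'b) tensor" is "(+)"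
  unfolding tensor_eq_def by (simp only: add_diff_add complex_vector.span_add)

lift_definition uminus_tensor :: "('a, 'b) tensor \<Rightarrow> ('a, 'b) tensor" is uminus
  unfolding tensor_eq_def by (simp only: minus_diff_minus complex_vector.span_neg)

lift_definition minus_tensor :: "('a, 'b) tensor \<Rightarrow> ('a, 'b) tensor \<Rightarrow> ('a, 'b) tensor" is "(-)"
proof -
  fix p p' q q' :: "'a \<times> 'b \<Rightarrow>\<^sub>0 complex"
  assume "tensor_eq p p'" "tensor_eq q q'"
  then have "(p - p') - (q - q') \<in> complex_vector.span tensor_relations"
    unfolding tensor_eq_def by (rule complex_vector.span_diff)
  then show "tensor_eq (p - q) (p' - q')"
    by (simp add: tensor_eq_def algebra_simps)
qed

lift_definition scaleC_tensor :: "complex \<Rightarrow> ('a, 'b) tensor \<Rightarrow> ('a, 'b) tensor" is scaleC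
  unfolding tensor_eq_def
  by (simp only: complex_vector.scale_right_diff_distrib[symmetric] complex_vector.span_scale)

instance
proof
  fix x y z :: "('a, 'b) tensor" and a b :: complex
  note refl = equivp_reflp[OF equivp_tensor_eq]
  show "x + y + z = x + (y + z)" by transfer (simp add: add.assoc refl)
  show "x + y = y + x" by transfer (simp add: add.commute refl)
  show "0 + x = x" by transfer (simp add: refl)
  show "- x + x = 0" by transfer (simp add: refl)
  show "x - y = x + - y" by transfer (simp add: refl)
  show "a *\<^sub>C (x + y) = a *\<^sub>C x + a *\<^sub>C y" by transfer (simp add: scaleC_add_right refl)
  show "(a + b) *\<^sub>C x = a *\<^sub>C x + b *\<^sub>C x" by transfer (simp add: scaleC_add_left refl)
  show "a *\<^sub>C b *\<^sub>C x = (a * b) *\<^sub>C x" by transfer (simp add: refl)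
  show "1 *\<^sub>C x = x" by transfer (simp add: refl)
qed

end

lift_definition pure_tensor :: "'a::complex_vector \<Rightarrow> 'b::complex_vector \<Rightarrow> ('a, 'b) tensor"
    (infixr \<open>\<otimes>\<close> 70)
  is "\<lambda>x y. Poly_Mapping.single (x, y) 1" .

lemma cbilinear_pure_tensor: "cbilinear (\<otimes>)"
proof -
  have rel: "tensor_eq p q" if "p - q \<in> tensor_relations"
    for p q :: "'a \<times> 'b \<Rightarrow>\<^sub>0 complex"
    using that by (simp add: tensor_eq_def complex_vector.span_base)
  have "(x + x') \<otimes> y = x \<otimes> y + x' \<otimes> y" for x x' :: 'a and y :: 'b
    by transfer (rule rel, force simp: tensor_relations_def diff_diff_eq)
  moreover have "x \<otimes> (y + y') = x \<otimes> y + x \<otimes> y'" for x :: 'a and y y' :: 'b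
    by transfer (rule rel, force simp: tensor_relations_def diff_diff_eq)
  moreover have "(c *\<^sub>C x) \<otimes> y = c *\<^sub>C (x \<otimes> y)" for c and x :: 'a and y :: 'b
    by transfer (rule rel, force simp: tensor_relations_def)
  moreover have "x \<otimes> (c *\<^sub>C y) = c *\<^sub>C (x \<otimes> y)" for c and x :: 'a and y :: 'b
    by transfer (rule rel, force simp: tensor_relations_def)
  ultimately show ?thesis by (simp add: cbilinear_def clinear_iff)
qed

lemma abs_tensor_single: "abs_tensor (Poly_Mapping.single (x, y) 1) = x \<otimes> y"
  by (simp add: pure_tensor.abs_eq)

lemma clinear_abs_tensor: "clinear abs_tensor"
  by (simp add: clinear_iff plus_tensor.abs_eq scaleC_tensor.abs_eq)

lemma clinear_tensor_eqI:
  fixes f g :: "('a::complex_vector, 'b::complex_vector) tensor \<Rightarrow> 'c::complex_vector"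
  assumes f: "clinear f" and g: "clinear g" and eq: "\<And>x y. f (x \<otimes> y) = g (x \<otimes> y)"
  shows "f t = g t"
proof -
  obtain p where t: "t = abs_tensor p" by (metis Quotient3_tensor Quotient3_def)
  have "f (abs_tensor p) = g (abs_tensor p)"
  proof (rule clinear_poly_mapping_eqI[where f = "\<lambda>p. f (abs_tensor p)" and g = "\<lambda>p. g (abs_tensor p)"])
    show "f (abs_tensor (Poly_Mapping.single k 1)) = g (abs_tensor (Poly_Mapping.single k 1))" for k
      by (cases k) (simp add: abs_tensor_single eq)
  qed (use f g clinear_abs_tensor in \<open>auto intro: clinear_compose\<close>)
  then show ?thesis by (simp add: t)
qed

definition free_extension :: "('a \<Rightarrow> 'b::complex_vector) \<Rightarrow> ('a \<Rightarrow>\<^sub>0 complex) \<Rightarrow> 'b"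
  where "free_extension f p = (\<Sum>k\<in>Poly_Mapping.keys p. Poly_Mapping.lookup p k *\<^sub>C f k)"

lemma free_extension_superset:
  assumes "finite A" "Poly_Mapping.keys p \<subseteq> A"
  shows "free_extension f p = (\<Sum>k\<in>A. Poly_Mapping.lookup p k *\<^sub>C f k)"
  unfolding free_extension_def
  by (rule sum.mono_neutral_left) (use assms in \<open>auto simp: in_keys_iff\<close>)

lemma clinear_free_extension: "clinear (free_extension f)"
proof -
  have "free_extension f (p + q) = free_extension f p + free_extension f q" for p q
    using Poly_Mapping.keys_add[of p q]
    by (simp add: free_extension_superset[of "Poly_Mapping.keys p \<union> Poly_Mapping.keys q"]
        lookup_add scaleC_add_left sum.distrib)
  moreover have "free_extension f (c *\<^sub>C p) = c *\<^sub>C free_extension f p" for c p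
  proof -
    have "Poly_Mapping.keys (c *\<^sub>C p) \<subseteq> Poly_Mapping.keys p"
      by (auto simp: in_keys_iff lookup_scaleC)
    then show ?thesis
      by (simp add: free_extension_superset[of "Poly_Mapping.keys p"] lookup_scaleC
          complex_vector.scale_sum_right)
  qed
  ultimately show ?thesis by (simp add: clinear_iff)
qed

lemma free_extension_single: "free_extension f (Poly_Mapping.single k c) = c *\<^sub>C f k"
  by (simp add: free_extension_superset[of "{k}"])

text \<open>
  The linear map on the tensor product induced by \<open>f\<close>; it is independent of the chosen
  representative, and meaningful, only for bilinear \<open>f\<close>.
\<close>

definition tensor_lift ::
    "('a::complex_vector \<Rightarrow> 'b::complex_vector \<Rightarrow> 'c::complex_vector) \<Rightarrow> ('a, 'b) tensor \<Rightarrow> 'c"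
  where "tensor_lift f t = free_extension (case_prod f) (rep_tensor t)"

lemma tensor_lift_abs:
  assumes "cbilinear f"
  shows "tensor_lift f (abs_tensor p) = free_extension (case_prod f) p"
proof -
  let ?F = "free_extension (case_prod f)"
  note lin = clinear_free_extension[of "case_prod f"]
  have zero: "?F r = 0" if "r \<in> complex_vector.span tensor_relations" for r
    using that
  proof (induction rule: complex_vector.span_induct_alt)
    case base
    show ?case using lin by (rule clinear_0)
  next
    case (step c r s)
    have "?F r = 0" using step(1) assms lin
      by (auto simp: tensor_relations_def clinear_diff free_extension_single cbilinear_def clinear_iff)
    then show ?case using step lin by (simp add: clinear_iff)
  qed
  have "tensor_eq (rep_tensor (abs_tensor p)) p"
    by (metis Quotient3_tensor rep_abs_rsp_left equivp_reflp[OF equivp_tensor_eq])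
  then have "?F (rep_tensor (abs_tensor p) - p) = 0"
    by (simp add: tensor_eq_def zero)
  then show ?thesis using lin by (simp add: clinear_diff tensor_lift_def)
qed

lemma tensor_lift_pure: "cbilinear f \<Longrightarrow> tensor_lift f (x \<otimes> y) = f x y"
  by (simp add: tensor_lift_abs free_extension_single flip: abs_tensor_single)

lemma clinear_tensor_lift:
  assumes "cbilinear f"
  shows "clinear (tensor_lift f)"
proof -
  have "\<exists>p. t = abs_tensor p" for t :: "('a, 'b) tensor" by (metis Quotient3_tensor Quotient3_def)
  note lin = clinear_free_extension[of "case_prod f"] and surj = this
  have "tensor_lift f (s + t) = tensor_lift f s + tensor_lift f t" for s t
    using surj[of s] surj[of t] lin
    by (auto simp: tensor_lift_abs[OF assms] clinear_iff plus_tensor.abs_eq)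
  moreover have "tensor_lift f (c *\<^sub>C s) = c *\<^sub>C tensor_lift f s" for c s
    using surj[of s] lin
    by (auto simp: tensor_lift_abs[OF assms] clinear_iff scaleC_tensor.abs_eq)
  ultimately show ?thesis by (simp add: clinear_iff)
qed

section \<open>The Lie algebra \<open>\<gg> \<otimes> B\<close>\<close>

definition tensor_bracket ::
    "('g::complex_lie_algebra, 'b::complex_comm_algebra) tensor \<Rightarrow> ('g, 'b) tensor \<Rightarrow> ('g, 'b) tensor"
  where "tensor_bracket s t =
    tensor_lift (\<lambda>x b. tensor_lift (\<lambda>y b'. lie_bracket x y \<otimes> (b * b')) t) s"

lemma cbilinear_tensor_bracket_inner:
  fixes x :: "'g::complex_lie_algebra" and b :: "'b::complex_comm_algebra"
  shows "cbilinear (\<lambda>y b'. lie_bracket x y \<otimes> (b * b'))"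
  using cbilinear_pure_tensor[where 'a = 'g and 'b = 'b]
  by (simp add: cbilinear_def clinear_iff lie_bracket_add_right lie_bracket_scaleC_right
      distrib_left scaleC_mult_right)

lemma cbilinear_tensor_bracket_outer:
  fixes t :: "('g::complex_lie_algebra, 'b::complex_comm_algebra) tensor"
  shows "cbilinear (\<lambda>x b. tensor_lift (\<lambda>y b'. lie_bracket x y \<otimes> (b * b')) t)"
proof -
  note bil = cbilinear_pure_tensor[where 'a = 'g and 'b = 'b]
  let ?T = "\<lambda>x b t. tensor_lift (\<lambda>y b'. lie_bracket (x :: 'g) y \<otimes> (b * b' :: 'b)) t"
  note lin = clinear_tensor_lift[OF cbilinear_tensor_bracket_inner]
  note pure = tensor_lift_pure[OF cbilinear_tensor_bracket_inner]
  have lin_add: "clinear (\<lambda>t. ?T x b t + ?T x' b' t)" for x x' b b'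
    using lin[of x b] lin[of x' b'] by (simp add: clinear_iff scaleC_add_right)
  have lin_scale: "clinear (\<lambda>t. c *\<^sub>C ?T x b t)" for c x b
    using lin[of x b] by (simp add: clinear_iff scaleC_add_right mult.commute)
  have "?T (x + x') b t = ?T x b t + ?T x' b t" for x x' b
    by (rule clinear_tensor_eqI[OF lin lin_add])
      (simp only: pure, use bil in \<open>simp add: lie_bracket_add_left cbilinear_def clinear_iff\<close>)
  moreover have "?T x (b + b') t = ?T x b t + ?T x b' t" for x b b'
    by (rule clinear_tensor_eqI[OF lin lin_add])
      (simp only: pure, use bil in \<open>simp add: distrib_right cbilinear_def clinear_iff\<close>)
  moreover have "?T (c *\<^sub>C x) b t = c *\<^sub>C ?T x b t" for c x b
    by (rule clinear_tensor_eqI[OF lin lin_scale])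
      (simp only: pure, use bil in \<open>simp add: lie_bracket_scaleC_left cbilinear_def clinear_iff\<close>)
  moreover have "?T x (c *\<^sub>C b) t = c *\<^sub>C ?T x b t" for c x b
    by (rule clinear_tensor_eqI[OF lin lin_scale])
      (simp only: pure, use bil in \<open>simp add: scaleC_mult_left cbilinear_def clinear_iff\<close>)
  ultimately show ?thesis by (simp add: cbilinear_def clinear_iff)
qed

lemma tensor_bracket_pure:
  "tensor_bracket (x \<otimes> b) (y \<otimes> b') = lie_bracket x y \<otimes> (b * b')"
  unfolding tensor_bracket_def
  by (subst tensor_lift_pure[OF cbilinear_tensor_bracket_outer])
    (rule tensor_lift_pure[OF cbilinear_tensor_bracket_inner])

lemma cbilinear_tensor_bracket: "cbilinear tensor_bracket"
  unfolding cbilinear_def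
proof (intro conjI allI)
  fix t :: "('a, 'b) tensor"
  show "clinear (\<lambda>s. tensor_bracket s t)"
    unfolding tensor_bracket_def by (rule clinear_tensor_lift[OF cbilinear_tensor_bracket_outer])
next
  fix s :: "('a, 'b) tensor"
  have left: "clinear (\<lambda>s. tensor_bracket s t)" for t :: "('a, 'b) tensor"
    unfolding tensor_bracket_def by (rule clinear_tensor_lift[OF cbilinear_tensor_bracket_outer])
  have pure: "tensor_bracket (x \<otimes> b) t = tensor_lift (\<lambda>y b'. lie_bracket x y \<otimes> (b * b')) t"
    for x b and t :: "('a, 'b) tensor"
    by (simp add: tensor_bracket_def tensor_lift_pure cbilinear_tensor_bracket_outer)
  have inner: "clinear (tensor_lift (\<lambda>y b'. lie_bracket x y \<otimes> (b * b')))" for x :: 'a and b :: 'b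
    by (rule clinear_tensor_lift[OF cbilinear_tensor_bracket_inner])
  have "tensor_bracket s (t + u) = tensor_bracket s t + tensor_bracket s u" for t u
  proof (rule clinear_tensor_eqI[where f = "\<lambda>s. tensor_bracket s (t + u)"
        and g = "\<lambda>s. tensor_bracket s t + tensor_bracket s u"])
    show "clinear (\<lambda>s. tensor_bracket s t + tensor_bracket s u)"
      using left[of t] left[of u] by (simp add: clinear_iff scaleC_add_right)
  qed (use left inner in \<open>simp_all add: pure clinear_iff\<close>)
  moreover have "tensor_bracket s (c *\<^sub>C t) = c *\<^sub>C tensor_bracket s t" for c t
  proof (rule clinear_tensor_eqI[where f = "\<lambda>s. tensor_bracket s (c *\<^sub>C t)"
        and g = "\<lambda>s. c *\<^sub>C tensor_bracket s t"])
    show "clinear (\<lambda>s. c *\<^sub>C tensor_bracket s t)"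
      using left[of t] by (simp add: clinear_iff scaleC_add_right mult.commute)
  qed (use left inner in \<open>simp_all add: pure clinear_iff\<close>)
  ultimately show "clinear (tensor_bracket s)" by (simp add: clinear_iff)
qed

instantiation tensor :: (complex_lie_algebra, complex_comm_algebra) complex_lie_algebra
begin

definition lie_bracket_tensor :: "('a, 'b) tensor \<Rightarrow> ('a, 'b) tensor \<Rightarrow> ('a, 'b) tensor"
  where "lie_bracket_tensor = tensor_bracket"

instance
proof
  note bil = cbilinear_tensor_bracket[where 'a = 'a and 'b = 'b]
  fix x y z :: "('a, 'b) tensor" and c :: complex
  show "lie_bracket (x + y) z = lie_bracket x z + lie_bracket y z"
    and "lie_bracket z (x + y) = lie_bracket z x + lie_bracket z y"
    and "lie_bracket (c *\<^sub>C x) y = c *\<^sub>C lie_bracket x y"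
    and "lie_bracket x (c *\<^sub>C y) = c *\<^sub>C lie_bracket x y"
    using bil by (simp_all add: lie_bracket_tensor_def cbilinear_def clinear_iff)
  let ?B = "tensor_bracket :: ('a, 'b) tensor \<Rightarrow> _"
  have l: "clinear (\<lambda>s. ?B s t)" and r: "clinear (?B t)" for t
    using bil by (simp_all add: cbilinear_def)
  note pure0 = cbilinear_pure_tensor[where 'a = 'a and 'b = 'b]
  have pure_left: "clinear (\<lambda>u :: 'a. u \<otimes> b)" for b :: 'b
    using pure0 by (simp add: cbilinear_def)
  have pure_minus: "(- u) \<otimes> b = - (u \<otimes> b)" for u :: 'a and b :: 'b
    by (rule clinear_minus[OF pure_left])
  have swap_pure: "?B (u \<otimes> b) t = - ?B t (u \<otimes> b)" for u b t
  proof (rule clinear_tensor_eqI[OF r, where g = "\<lambda>t. - ?B t (u \<otimes> b)"])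
    show "clinear (\<lambda>t. - ?B t (u \<otimes> b))"
      using l[of "u \<otimes> b"] by (simp add: clinear_iff)
    show "?B (u \<otimes> b) (u' \<otimes> b') = - ?B (u' \<otimes> b') (u \<otimes> b)" for u' b'
      by (subst (1 2) tensor_bracket_pure)
        (simp add: lie_bracket_swap[of u u'] pure_minus mult.commute)
  qed
  have swap: "?B s t = - ?B t s" for s t
  proof (rule clinear_tensor_eqI[OF l, where g = "\<lambda>s. - ?B t s"])
    show "clinear (\<lambda>s. - ?B t s)" using r[of t] by (simp add: clinear_iff)
  qed (rule swap_pure)
  have "?B x x = - ?B x x" by (rule swap)
  then have "(2 :: complex) *\<^sub>C ?B x x = 0"
    by (metis add.right_inverse one_add_one scaleC_add_left scaleC_one)
  then show "lie_bracket x x = 0" by (simp add: lie_bracket_tensor_def)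
  define J where "J s t u = ?B s (?B t u) + ?B t (?B u s) + ?B u (?B s t)" for s t u
  have add3: "clinear (\<lambda>s. f s + g s + h s)" if "clinear f" "clinear g" "clinear h"
    for f g h :: "('a, 'b) tensor \<Rightarrow> ('a, 'b) tensor"
    using that by (simp add: clinear_iff scaleC_add_right)
  have J1: "clinear (\<lambda>s. J s t u)" and J2: "clinear (\<lambda>s. J t s u)" and J3: "clinear (J t u)" for t u
    unfolding J_def by (rule add3; use l r in \<open>simp add: clinear_iff\<close>)+
  have zero: "clinear (\<lambda>s :: ('a, 'b) tensor. 0 :: ('a, 'b) tensor)" by (simp add: clinear_iff)
  have ppp: "J (u \<otimes> a) (v \<otimes> b) (w \<otimes> d) = 0" for u v w a b d
  proof -
    have "J (u \<otimes> a) (v \<otimes> b) (w \<otimes> d) =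
        (lie_bracket u (lie_bracket v w) + lie_bracket v (lie_bracket w u)
          + lie_bracket w (lie_bracket u v)) \<otimes> (a * (b * d))"
      using pure0 by (simp add: J_def tensor_bracket_pure ac_simps cbilinear_def clinear_iff)
    also have "\<dots> = 0"
      using clinear_0[OF pure_left] by (simp add: lie_jacobi)
    finally show ?thesis .
  qed
  have ppt: "J (u \<otimes> a) (v \<otimes> b) t = 0" for u a v b t
    by (rule clinear_tensor_eqI[OF J3 zero]) (rule ppp)
  have ptt: "J (u \<otimes> a) s t = 0" for u a s t
    by (rule clinear_tensor_eqI[OF J2 zero]) (rule ppt)
  have "J x y z = 0"
    by (rule clinear_tensor_eqI[OF J1 zero]) (rule ptt)
  then show "lie_bracket x (lie_bracket y z) + lie_bracket y (lie_bracket z x)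
      + lie_bracket z (lie_bracket x y) = 0"
    by (simp add: J_def lie_bracket_tensor_def)
qed

end

lemma lie_bracket_pure_tensor:
  "lie_bracket (x \<otimes> b) (y \<otimes> b') = lie_bracket x y \<otimes> (b * b')"
  by (simp add: lie_bracket_tensor_def tensor_bracket_pure)

section \<open>Modules\<close>

definition lie_module :: "('g::complex_lie_algebra \<Rightarrow> 'v::complex_vector \<Rightarrow> 'v) \<Rightarrow> bool"
  where "lie_module act \<longleftrightarrow> cbilinear act \<and>
    (\<forall>x y v. act (lie_bracket x y) v = act x (act y v) - act y (act x v))"

definition submodule :: "('g::complex_lie_algebra \<Rightarrow> 'v::complex_vector \<Rightarrow> 'v) \<Rightarrow> 'v set \<Rightarrow> bool"
  where "submodule act U \<longleftrightarrow> complex_vector.subspace U \<and> (\<forall>x. \<forall>u\<in>U. act x u \<in> U)"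

definition irreducible_module :: "('g::complex_lie_algebra \<Rightarrow> 'v::complex_vector \<Rightarrow> 'v) \<Rightarrow> bool"
  where "irreducible_module act \<longleftrightarrow> (UNIV :: 'v set) \<noteq> {0} \<and>
    (\<forall>U. submodule act U \<longrightarrow> U = {0} \<or> U = UNIV)"

text \<open>
  Since \<open>d\<^sub>1, \<dots>, d\<^sub>n\<close> is a basis of \<open>H\<close>, a functional on \<open>H\<close> is identified with the vector
  of its values \<open>\<mu> $ i = \<mu>(d\<^sub>i)\<close>, where \<open>d\<^sub>i = witt_basis 0 i\<close>.
\<close>

definition weight_space ::
    "(('n::finite witt, 'b::complex_comm_algebra) tensor \<Rightarrow> 'v::complex_vector \<Rightarrow> 'v)
      \<Rightarrow> complex ^ 'n \<Rightarrow> 'v set"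
  where "weight_space act \<mu> = {v. \<forall>i. act (witt_basis 0 i \<otimes> 1) v = (\<mu> $ i) *\<^sub>C v}"

text \<open>Directness of the sum is the uniqueness of the family \<open>f\<close> of components.\<close>

definition weight_module ::
    "(('n::finite witt, 'b::complex_comm_algebra) tensor \<Rightarrow> 'v::complex_vector \<Rightarrow> 'v) \<Rightarrow> bool"
  where "weight_module act \<longleftrightarrow>
    (\<forall>v. \<exists>!f :: complex ^ 'n \<Rightarrow>\<^sub>0 'v.
      (\<forall>\<mu>. Poly_Mapping.lookup f \<mu> \<in> weight_space act \<mu>) \<and>
      v = (\<Sum>\<mu>\<in>Poly_Mapping.keys f. Poly_Mapping.lookup f \<mu>))"

text \<open>
  The dimension bound is stated through a finite basis because \<open>complex_vector.dim\<close> is \<open>0\<close>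
  on infinite-dimensional spaces.
\<close>

definition uniformly_bounded ::
    "(('n::finite witt, 'b::complex_comm_algebra) tensor \<Rightarrow> 'v::complex_vector \<Rightarrow> 'v) \<Rightarrow> bool"
  where "uniformly_bounded act \<longleftrightarrow> weight_module act \<and>
    (\<exists>N::nat. \<forall>\<mu>. weight_space act \<mu> \<noteq> {0} \<longrightarrow>
      (\<exists>X. finite X \<and> complex_vector.independent X \<and>
        complex_vector.span X = weight_space act \<mu> \<and> card X < N))"

definition single_point_evaluation ::
    "(('g::complex_lie_algebra, 'b::complex_comm_algebra) tensor \<Rightarrow> 'v::complex_vector \<Rightarrow> 'v) \<Rightarrow> bool"
  where "single_point_evaluation act \<longleftrightarrow>
    (\<exists>\<eta> :: 'b \<Rightarrow> complex. algebra_hom \<eta> \<and>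
      (\<forall>x b v. act (x \<otimes> b) v = \<eta> b *\<^sub>C act (x \<otimes> 1) v))"

end

theory Submission
  imports Defs "HOL-Computational_Algebra.Fundamental_Theorem_Algebra"
    "HOL-Analysis.Continuum_Not_Denumerable"
begin

text \<open>
  Let \<open>V\<close> be the module and let \<open>I\<close> be the set of all \<open>b \<in> B\<close> for which \<open>W \<otimes> b\<close> acts as zero. It is an
  ideal of \<open>B\<close>. Irreducibility enters as follows: if \<open>W \<otimes> bB\<close> kills one nonzero vector, then \<open>b \<in> I\<close>,
  because the vectors that it kills form a submodule (\<open>annihilatorI\<close>). The theorem says that \<open>B/I\<close> is \<open>\<complex>\<close> or \<open>0\<close>. If it is \<open>0\<close>, the
  module is trivial and any point of \<open>B\<close> will do; that a finitely generated algebra has a point is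
  the weak Nullstellensatz (\<open>finitely_generated_algebra_has_point\<close>). Assume \<open>B/I \<noteq> 0\<close>.

  Some \<open>b \<notin> I\<close> is a common eigenvector of \<open>B\<close> modulo \<open>I\<close>. To find it, fix a weight space \<open>V\<^sub>\<mu> \<noteq> 0\<close>. For \<open>m \<noteq> 0\<close> the coefficients \<open>b\<close> for which
  \<open>t\<^sup>m d\<^sub>i \<otimes> b\<close> kills \<open>V\<^sub>\<mu>\<close> form an ideal, since commuting with \<open>d\<^sub>j \<otimes> c\<close> multiplies the coefficient
  by \<open>c\<close>; its codimension is at most the square of the multiplicity bound \<open>N\<close>, uniformly in \<open>m\<close>. Let
  \<open>Q\<close> be the intersection of these ideals over the finitely many \<open>m \<noteq> 0\<close> with entries at most \<open>2\<close> in
  absolute value. The corresponding \<open>t\<^sup>m d\<^sub>i\<close> generate \<open>W\<close>, so for each \<open>m\<close> some power of \<open>Q\<close> lies in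
  the ideal of \<open>m\<close>; the uniform bound on the codimension then yields one power that works for all
  \<open>m \<noteq> 0\<close>. Its square also works for the \<open>d\<^sub>i\<close>, as brackets of opposite \<open>t\<^sup>m d\<^sub>i\<close>, and so lies in \<open>I\<close>. Hence \<open>Q\<close> is nilpotent modulo \<open>I\<close>, there is \<open>w \<notin> I\<close> with \<open>Qw \<subseteq> I\<close>, and
  \<open>Bw\<close> is finite-dimensional modulo \<open>I\<close>. A common eigenvector of \<open>B\<close> in it is an element \<open>b \<notin> I\<close> with
  \<open>xb \<equiv> \<eta>(x)b\<close> modulo \<open>I\<close> for an algebra homomorphism \<open>\<eta>\<close> (\<open>annihilator_socle\<close>).

  The case \<open>b\<^sup>2 \<in> I\<close> is impossible (\<open>socle_eigenvalue_nonzero\<close>). Here \<open>W \<otimes> b\<close> acts as an abelian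
  ideal. An element of \<open>H \<otimes> b\<close> has only one eigenvalue on \<open>V\<close>, so after subtracting it one gets an
  operator whose \<open>N\<close>-th power vanishes; commutators of a nilpotent operator inside the abelian ideal are
  again nilpotent. This makes all \<open>d\<^sub>j \<otimes> b\<close> nilpotent, and the image of the last nonvanishing power of a
  generic element of \<open>H \<otimes> b\<close> is killed by all \<open>t\<^sup>m d\<^sub>i \<otimes> b\<close> with \<open>m \<noteq> 0\<close>. So \<open>W \<otimes> b\<close> kills a nonzero
  vector and \<open>b \<in> I\<close>, a contradiction.

  Therefore \<open>b\<close> can be rescaled to an idempotent \<open>e\<close> modulo \<open>I\<close>. If \<open>f = 1 - e\<close> were not in \<open>I\<close>, then
  \<open>W \<otimes> e\<close> and \<open>W \<otimes> f\<close> would be two commuting copies of \<open>W\<close> that both act nontrivially. Each weight of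
  \<open>V\<close> splits into a weight \<open>\<alpha>\<close> for the first copy and \<open>\<beta>\<close> for the second. The subalgebra of type \<open>sl\<^sub>2\<close>
  spanned by \<open>t\<^sup>m d\<^sub>p\<close>, \<open>t\<^sup>-\<^sup>m d\<^sub>p\<close> and \<open>d\<^sub>p\<close>, where \<open>m = (k, \<dots>, k)\<close>, moves a vector with
  \<open>\<alpha>\<^sub>p \<noteq> 0\<close> by \<open>m\<close> or by \<open>-m\<close>. Doing this in both copies for all step lengths up to \<open>M\<close> gives \<open>M\<^sup>2\<close>
  pairs \<open>(\<alpha>', \<beta>')\<close> that share at most \<open>4M + 1\<close> total weights, so some weight space has dimension
  of order \<open>M\<close> (\<open>no_idempotent_pair\<close>). Hence \<open>f \<in> I\<close>, and \<open>x \<equiv> \<eta>(x)\<close> modulo \<open>I\<close> for all \<open>x \<in> B\<close>.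
\<close>

section \<open>Relative dimension and eigenvectors modulo a subspace\<close>

text \<open>
  The dimension of \<open>U\<close> modulo \<open>K\<close> is at most \<open>d\<close>. Stating this through linear dependence avoids quotient
  spaces, covers both finite-dimensional spaces (\<open>K = {0}\<close>) and subspaces of finite codimension
  (\<open>U = UNIV\<close>), and makes inductions on \<open>d\<close> short.
\<close>

definition rel_dim_le :: "nat \<Rightarrow> 'a::complex_vector set \<Rightarrow> 'a set \<Rightarrow> bool"
  where "rel_dim_le d K U \<longleftrightarrow> (\<forall>p :: nat \<Rightarrow> 'a. (\<forall>s\<le>d. p s \<in> U) \<longrightarrow>
    (\<exists>c :: nat \<Rightarrow> complex. (\<exists>s\<le>d. c s \<noteq> 0) \<and> (\<Sum>s\<le>d. c s *\<^sub>C p s) \<in> K))"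

lemma rel_dim_le_superset:
  assumes "rel_dim_le d K U" "K \<subseteq> K'"
  shows "rel_dim_le d K' U"
  using assms unfolding rel_dim_le_def by blast

lemma rel_dim_le_0:
  assumes "rel_dim_le 0 K U" "complex_vector.subspace K"
  shows "U \<subseteq> K"
proof
  fix u assume "u \<in> U"
  with assms(1) obtain c :: complex where "c \<noteq> 0" "c *\<^sub>C u \<in> K"
    unfolding rel_dim_le_def by (force dest: spec[of _ "\<lambda>_. u"])
  then have "inverse c *\<^sub>C c *\<^sub>C u \<in> K"
    using assms(2) complex_vector.subspace_scale by blast
  with \<open>c \<noteq> 0\<close> show "u \<in> K" by simp
qed

text \<open>
  The next two lemmas are the induction steps: the relative dimension drops when \<open>K\<close> gains a vector of \<open>U\<close>
  and when \<open>U\<close> loses one.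
\<close>

lemma rel_dim_le_enlarge:
  assumes rd: "rel_dim_le (Suc d) K U" and K: "complex_vector.subspace K"
    and K': "complex_vector.subspace K'" and "K \<subseteq> K'"
    and w: "w \<in> U" "w \<in> K'" "w \<notin> K"
  shows "rel_dim_le d K' U"
  unfolding rel_dim_le_def
proof (intro allI impI)
  fix p :: "nat \<Rightarrow> 'a"
  assume p: "\<forall>s\<le>d. p s \<in> U"
  define p' where "p' = (\<lambda>s. if s \<le> d then p s else w)"
  have "\<forall>s\<le>Suc d. p' s \<in> U" using p w by (simp add: p'_def)
  then obtain c where c: "\<exists>s\<le>Suc d. c s \<noteq> 0" "(\<Sum>s\<le>Suc d. c s *\<^sub>C p' s) \<in> K"
    using rd unfolding rel_dim_le_def by blast
  have eq: "(\<Sum>s\<le>Suc d. c s *\<^sub>C p' s) = (\<Sum>s\<le>d. c s *\<^sub>C p s) + c (Suc d) *\<^sub>C w"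
    by (simp add: p'_def)
  have "(\<Sum>s\<le>d. c s *\<^sub>C p s) \<in> K'"
  proof -
    have "(\<Sum>s\<le>d. c s *\<^sub>C p s) + c (Suc d) *\<^sub>C w \<in> K'"
      using c(2) eq \<open>K \<subseteq> K'\<close> by auto
    moreover have "c (Suc d) *\<^sub>C w \<in> K'" using K' w complex_vector.subspace_scale by blast
    ultimately show ?thesis using K' complex_vector.subspace_diff by fastforce
  qed
  moreover have "\<exists>s\<le>d. c s \<noteq> 0"
  proof (rule ccontr)
    assume "\<not> ?thesis"
    then have z: "\<forall>s\<le>d. c s = 0" by simp
    then have "c (Suc d) \<noteq> 0" using c(1) le_Suc_eq by auto
    moreover have "c (Suc d) *\<^sub>C w \<in> K" using c(2) unfolding eq by (simp add: z)
    then have "inverse (c (Suc d)) *\<^sub>C c (Suc d) *\<^sub>C w \<in> K"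
      using K complex_vector.subspace_scale by blast
    ultimately show False using w by simp
  qed
  ultimately show "\<exists>c. (\<exists>s\<le>d. c s \<noteq> 0) \<and> (\<Sum>s\<le>d. c s *\<^sub>C p s) \<in> K'" by blast
qed

lemma rel_dim_le_shrink:
  assumes rd: "rel_dim_le (Suc d) K U" 
    and U': "complex_vector.subspace U'" and "K \<subseteq> U'" "U' \<subseteq> U"
    and w: "w \<in> U" "w \<notin> U'"
  shows "rel_dim_le d K U'"
  unfolding rel_dim_le_def
proof (intro allI impI)
  fix p :: "nat \<Rightarrow> 'a"
  assume p: "\<forall>s\<le>d. p s \<in> U'"
  define p' where "p' = (\<lambda>s. if s \<le> d then p s else w)"
  have "\<forall>s\<le>Suc d. p' s \<in> U" using p w \<open>U' \<subseteq> U\<close> by (auto simp add: p'_def)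
  then obtain c where c: "\<exists>s\<le>Suc d. c s \<noteq> 0" "(\<Sum>s\<le>Suc d. c s *\<^sub>C p' s) \<in> K"
    using rd unfolding rel_dim_le_def by blast
  have eq: "(\<Sum>s\<le>Suc d. c s *\<^sub>C p' s) = (\<Sum>s\<le>d. c s *\<^sub>C p s) + c (Suc d) *\<^sub>C w"
    by (simp add: p'_def)
  have "(\<Sum>s\<le>d. c s *\<^sub>C p s) \<in> U'"
    using U' p by (intro complex_vector.subspace_sum complex_vector.subspace_scale) auto
  then have "c (Suc d) *\<^sub>C w \<in> U'"
    using c(2) eq \<open>K \<subseteq> U'\<close> complex_vector.subspace_diff[OF U', of "(\<Sum>s\<le>d. c s *\<^sub>C p s) + c (Suc d) *\<^sub>C w"] 
    by fastforce
  then have "inverse (c (Suc d)) *\<^sub>C c (Suc d) *\<^sub>C w \<in> U'"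
    using U' complex_vector.subspace_scale by blast
  then have 0: "c (Suc d) = 0" using w by (cases "c (Suc d) = 0") auto
  then have "\<exists>s\<le>d. c s \<noteq> 0" using c(1) le_Suc_eq by auto
  with c(2) show "\<exists>c. (\<exists>s\<le>d. c s \<noteq> 0) \<and> (\<Sum>s\<le>d. c s *\<^sub>C p s) \<in> K"
    unfolding eq by (auto simp: 0)
qed

lemma clinear_sum: "clinear f \<Longrightarrow> f (sum h A) = (\<Sum>x\<in>A. f (h x))"
  by (induction A rule: infinite_finite_induct) (auto simp: clinear_iff clinear_0)

text \<open>
  Gaussian elimination: an equation with a nonzero coefficient at \<open>r\<close> eliminates the unknown \<open>r\<close> from the
  others.
\<close>

lemma homogeneous_system_nontrivial_solution:
  fixes g :: "'e \<Rightarrow> 's \<Rightarrow> complex"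
  assumes "finite E" "finite S" "card E < card S"
  shows "\<exists>c. (\<exists>s\<in>S. c s \<noteq> 0) \<and> (\<forall>e\<in>E. (\<Sum>s\<in>S. c s * g e s) = 0)"
  using assms
proof (induction E arbitrary: S g rule: finite_induct)
  case empty
  then have "S \<noteq> {}" by auto
  then show ?case by (intro exI[of _ "\<lambda>_. 1"]) auto
next
  case (insert e E)
  show ?case
  proof (cases "\<forall>s\<in>S. g e s = 0")
    case True
    have "card E < card S" using insert by simp
    from insert.IH[OF insert.prems(1) this, of g]
    obtain c where "\<exists>s\<in>S. c s \<noteq> 0" "\<forall>e\<in>E. (\<Sum>s\<in>S. c s * g e s) = 0" by blast
    with True show ?thesis by (intro exI[of _ c]) auto
  next
    case False
    then obtain r where r: "r \<in> S" "g e r \<noteq> 0" by auto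
    define S' where "S' = S - {r}"
    define g' where "g' = (\<lambda>e' s. g e' s - g e s / g e r * g e' r)"
    have S': "finite S'" "card E < card S'"
      using insert.prems insert.hyps r by (auto simp: S'_def)
    from insert.IH[OF this, of g'] obtain c
      where c: "\<exists>s\<in>S'. c s \<noteq> 0" "\<And>e'. e'\<in>E \<Longrightarrow> (\<Sum>s\<in>S'. c s * g' e' s) = 0" by auto
    define c' where "c' = c(r := - (\<Sum>s\<in>S'. c s * g e s) / g e r)"
    have sum: "(\<Sum>s\<in>S. c' s * g e' s) = (\<Sum>s\<in>S'. c s * g' e' s)" for e'
    proof -
      have "(\<Sum>s\<in>S. c' s * g e' s) = c' r * g e' r + (\<Sum>s\<in>S'. c' s * g e' s)"
        unfolding S'_def using insert.prems(1) r(1) by (rule sum.remove)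
      also have "(\<Sum>s\<in>S'. c' s * g e' s) = (\<Sum>s\<in>S'. c s * g e' s)"
        by (rule sum.cong) (auto simp: c'_def S'_def)
      also have "c' r * g e' r = - (\<Sum>s\<in>S'. c s * (g e s / g e r * g e' r))"
        by (simp add: c'_def sum_distrib_right sum_divide_distrib mult.assoc)
      finally show ?thesis by (simp add: g'_def right_diff_distrib sum_subtractf)
    qed
    have "(\<Sum>s\<in>S. c' s * g e s) = 0" unfolding sum using r by (simp add: g'_def)
    moreover have "\<exists>s\<in>S. c' s \<noteq> 0" using c(1) by (auto simp: c'_def S'_def)
    ultimately show ?thesis using c(2) sum by (intro exI[of _ c']) auto
  qed
qed

text \<open>
  In coordinates with respect to the bases \<open>Y e\<close>, lying in the common kernel is a system of at most
  \<open>card E * N\<close> linear equations.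
\<close>

lemma rel_dim_le_common_kernel:
  fixes T :: "'e \<Rightarrow> 'a::complex_vector \<Rightarrow> 'b::complex_vector"
  assumes E: "finite E" and lin: "\<And>e. e \<in> E \<Longrightarrow> clinear (T e)"
    and Y: "\<And>e. e \<in> E \<Longrightarrow> finite (Y e) \<and> complex_vector.independent (Y e) \<and> card (Y e) \<le> N"
    and span: "\<And>e x. e \<in> E \<Longrightarrow> T e x \<in> complex_vector.span (Y e)"
  shows "rel_dim_le (card E * N) {x. \<forall>e\<in>E. T e x = 0} UNIV"
  unfolding rel_dim_le_def
proof (intro allI impI)
  fix p :: "nat \<Rightarrow> 'a"
  let ?I = "Sigma E Y" and ?S = "{..card E * N}"
  let ?g = "\<lambda>(e, y) s. complex_vector.representation (Y e) (T e (p s)) y"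
  have "card ?I = (\<Sum>e\<in>E. card (Y e))" using E Y by (intro card_SigmaI) auto
  also have "\<dots> \<le> card E * N" using sum_bounded_above[of E "\<lambda>e. card (Y e)" N] Y by simp
  finally have card: "card ?I < card ?S" by simp
  have "finite ?I" using E Y by auto
  from homogeneous_system_nontrivial_solution[OF this _ card, of ?g] obtain c
    where c: "\<exists>s\<in>?S. c s \<noteq> 0" "\<forall>i\<in>?I. (\<Sum>s\<in>?S. c s * ?g i s) = 0" by auto
  have "T e (\<Sum>s\<in>?S. c s *\<^sub>C p s) = 0" if e: "e \<in> E" for e
  proof -
    note ind = Y[OF e, THEN conjunct2, THEN conjunct1]
    let ?v = "\<Sum>s\<in>?S. c s *\<^sub>C T e (p s)"
    have in_span: "c s *\<^sub>C T e (p s) \<in> complex_vector.span (Y e)" for s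
      by (intro complex_vector.span_scale span e)
    have "complex_vector.representation (Y e) ?v y = 0" if "y \<in> Y e" for y
    proof -
      have "complex_vector.representation (Y e) ?v
          = (\<lambda>y. \<Sum>s\<in>?S. complex_vector.representation (Y e) (c s *\<^sub>C T e (p s)) y)"
        by (rule complex_vector.representation_sum[OF ind in_span])
      also have "\<dots> = (\<lambda>y. \<Sum>s\<in>?S. c s * complex_vector.representation (Y e) (T e (p s)) y)"
        by (simp add: complex_vector.representation_scale[OF ind span[OF e]])
      finally show ?thesis using c(2) that e by auto
    qed
    moreover have "?v \<in> complex_vector.span (Y e)" by (intro complex_vector.span_sum in_span)
    then have "(\<Sum>y\<in>Y e. complex_vector.representation (Y e) ?v y *\<^sub>C y) = ?v"
      using complex_vector.sum_representation_eq[OF ind] Y[OF e] by blast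
    ultimately have "?v = 0" by simp
    then show ?thesis using clinear_sum[OF lin[OF e], of "\<lambda>s. c s *\<^sub>C p s" ?S] lin[OF e]
      by (simp add: clinear_iff)
  qed
  with c(1) show "\<exists>c. (\<exists>s\<le>card E * N. c s \<noteq> 0) \<and>
      (\<Sum>s\<le>card E * N. c s *\<^sub>C p s) \<in> {x. \<forall>e\<in>E. T e x = 0}" by auto
qed

lemma rel_dim_le_span:
  fixes Y :: "'a::complex_vector set"
  assumes "finite Y" "complex_vector.independent Y" "card Y \<le> N"
  shows "rel_dim_le N {0} (complex_vector.span Y)"
  unfolding rel_dim_le_def
proof (intro allI impI)
  fix p :: "nat \<Rightarrow> 'a"
  assume p: "\<forall>s\<le>N. p s \<in> complex_vector.span Y"
  have "card Y < card {..N}" using assms by simp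
  from homogeneous_system_nontrivial_solution[OF assms(1) _ this,
      of "\<lambda>y s. complex_vector.representation Y (p s) y"]
  obtain c where c: "\<exists>s\<in>{..N}. c s \<noteq> 0"
    "\<forall>y\<in>Y. (\<Sum>s\<in>{..N}. c s * complex_vector.representation Y (p s) y) = 0" by auto
  let ?v = "\<Sum>s\<in>{..N}. c s *\<^sub>C p s"
  have "complex_vector.representation Y ?v
      = (\<lambda>y. \<Sum>s\<in>{..N}. complex_vector.representation Y (c s *\<^sub>C p s) y)"
    using p by (intro complex_vector.representation_sum assms complex_vector.span_scale) auto
  also have "\<dots> = (\<lambda>y. \<Sum>s\<in>{..N}. c s * complex_vector.representation Y (p s) y)"
    using p by (simp add: complex_vector.representation_scale[OF assms(2)])
  finally have "complex_vector.representation Y ?v y = 0" if "y \<in> Y" for y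
    using c(2) that by auto
  moreover have "?v \<in> complex_vector.span Y" using p
    by (intro complex_vector.span_sum complex_vector.span_scale) auto
  then have "(\<Sum>y\<in>Y. complex_vector.representation Y ?v y *\<^sub>C y) = ?v"
    using complex_vector.sum_representation_eq[OF assms(2)] assms by blast
  ultimately have "?v = 0" by simp
  with c(1) show "\<exists>c. (\<exists>s\<le>N. c s \<noteq> 0) \<and> (\<Sum>s\<le>N. c s *\<^sub>C p s) \<in> {0}" by auto
qed

lemma last_word_outside:
  assumes "\<And>ws. set ws \<subseteq> A \<Longrightarrow> length ws = k \<Longrightarrow> foldr T ws u \<in> K" "u \<notin> K"
  shows "\<exists>ws. set ws \<subseteq> A \<and> foldr T ws u \<notin> K \<and> (\<forall>q\<in>A. T q (foldr T ws u) \<in> K)"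
  using assms
proof (induction k)
  case (Suc k)
  show ?case
  proof (cases "\<forall>ws. set ws \<subseteq> A \<longrightarrow> length ws = k \<longrightarrow> foldr T ws u \<in> K")
    case True
    with Suc show ?thesis by blast
  next
    case False
    then obtain ws where ws: "set ws \<subseteq> A" "length ws = k" "foldr T ws u \<notin> K" by blast
    have "T q (foldr T ws u) \<in> K" if "q \<in> A" for q
      using Suc.prems(1)[of "q # ws"] ws that by auto
    with ws show ?thesis by blast
  qed
qed auto

text \<open>
  As long as \<open>U\<close> is not contained in \<open>K\<close>, local nilpotency provides a vector of \<open>U\<close> outside \<open>K\<close> that all
  \<open>T q\<close> map into \<open>K\<close>. So \<open>{x. \<forall>q\<in>A. T q x \<in> K}\<close> is strictly larger than \<open>K\<close> within \<open>U\<close>, and each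
  application of an operator uses up one dimension. Words in a family of operators, instead of powers of
  one operator, are needed for powers of an ideal of coefficients.
\<close>

lemma locally_nilpotent_uniform:
  fixes T :: "'q \<Rightarrow> 'a::complex_vector \<Rightarrow> 'a"
  assumes "rel_dim_le d K U" and "complex_vector.subspace K"
    and lin: "\<And>q. q \<in> A \<Longrightarrow> clinear (T q)"
    and U: "\<And>q u. q \<in> A \<Longrightarrow> u \<in> U \<Longrightarrow> T q u \<in> U"
    and K: "\<And>q u. q \<in> A \<Longrightarrow> u \<in> K \<Longrightarrow> T q u \<in> K"
    and nil: "\<And>u. u \<in> U \<Longrightarrow> \<exists>k. \<forall>ws. set ws \<subseteq> A \<longrightarrow> length ws = k \<longrightarrow> foldr T ws u \<in> K"
    and "u \<in> U" "set ws \<subseteq> A" "length ws = d"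
  shows "foldr T ws u \<in> K"
  using assms(1,2) K nil assms(7-)
proof (induction d arbitrary: K u ws)
  case 0
  then show ?case using rel_dim_le_0[OF 0(1,2)] by auto
next
  case (Suc d)
  show ?case
  proof (cases "U \<subseteq> K")
    case True
    have "u \<in> K \<Longrightarrow> set vs \<subseteq> A \<Longrightarrow> foldr T vs u \<in> K" for vs
      by (induction vs) (use Suc.prems(3) in auto)
    with True Suc.prems show ?thesis by auto
  next
    case False
    then obtain u0 where u0: "u0 \<in> U" "u0 \<notin> K" by auto
    obtain k where k: "\<forall>ws. set ws \<subseteq> A \<longrightarrow> length ws = k \<longrightarrow> foldr T ws u0 \<in> K"
      using Suc.prems(4) u0 by blast
    then obtain vs where vs: "set vs \<subseteq> A" "foldr T vs u0 \<notin> K" "\<forall>q\<in>A. T q (foldr T vs u0) \<in> K"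
      using last_word_outside[of A k T u0 K] u0 by blast
    define K' where "K' = {x. \<forall>q\<in>A. T q x \<in> K}"
    have "set xs \<subseteq> A \<Longrightarrow> foldr T xs u0 \<in> U" for xs
      by (induction xs) (use U u0 in auto)
    then have mem: "foldr T vs u0 \<in> U" using vs by blast
    have sub: "complex_vector.subspace K'"
      unfolding K'_def complex_vector.subspace_def
      using lin Suc.prems(2)
      by (auto simp: clinear_iff clinear_0 complex_vector.subspace_def)
    have KK': "K \<subseteq> K'" using Suc.prems(3) by (auto simp: K'_def)
    have rd: "rel_dim_le d K' U"
      using rel_dim_le_enlarge[OF Suc.prems(1) Suc.prems(2) sub KK' mem] vs by (auto simp: K'_def)
    obtain q ws' where ws: "ws = q # ws'" using Suc.prems by (cases ws) auto
    have "foldr T ws' u \<in> K'"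
    proof (rule Suc.IH[OF rd sub _ _ \<open>u \<in> U\<close>])
      show "T q x \<in> K'" if "q \<in> A" "x \<in> K'" for q x
        using that KK' by (auto simp: K'_def)
      show "\<exists>k. \<forall>ws. set ws \<subseteq> A \<longrightarrow> length ws = k \<longrightarrow> foldr T ws x \<in> K'" if "x \<in> U" for x
        using Suc.prems(4)[OF that] KK' by blast
    qed (use Suc.prems ws in auto)
    then show ?thesis using ws Suc.prems by (auto simp: K'_def)
  qed
qed

lemma nilpotent_on_finite_dim:
  fixes P :: "'a::complex_vector \<Rightarrow> 'a"
  assumes "rel_dim_le d {0} U" "clinear P" "\<And>u. u \<in> U \<Longrightarrow> P u \<in> U"
    and "\<And>u. u \<in> U \<Longrightarrow> \<exists>k. (P ^^ k) u = 0" and "u \<in> U"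
  shows "(P ^^ d) u = 0"
proof -
  have pow: "foldr (\<lambda>_. P) ws v = (P ^^ length ws) v" for ws :: "unit list" and v
    by (induction ws) auto
  have "foldr (\<lambda>_. P) (replicate d ()) u \<in> {0}"
    by (rule locally_nilpotent_uniform[where A = UNIV and U = U])
      (use assms in \<open>auto simp: pow complex_vector.subspace_0 clinear_0\<close>)
  then show ?thesis by (simp add: pow)
qed

text \<open>
  Split linear factors off \<open>p\<close>: when \<open>p(T)u\<close> lies in \<open>K\<close> for the first time, the vector just before is an
  eigenvector modulo \<open>K\<close>.
\<close>

lemma poly_annihilating_eigenvector:
  fixes T :: "'a::complex_vector \<Rightarrow> 'a" and p :: "complex poly"
  assumes "clinear T" and K: "complex_vector.subspace K" and "p \<noteq> 0"
    and inv: "\<And>x. x \<in> U \<Longrightarrow> T x \<in> U" and U: "complex_vector.subspace U"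
    and "u \<in> U" "u \<notin> K"
    and "(\<Sum>i\<le>degree p. coeff p i *\<^sub>C (T ^^ i) u) \<in> K"
  shows "\<exists>w c. w \<in> U \<and> w \<notin> K \<and> T w - c *\<^sub>C w \<in> K"
  using assms(3,8)
proof (induction "degree p" arbitrary: p)
  case 0
  then obtain c where p: "p = [:c:]" "c \<noteq> 0" by (metis degree_eq_zeroE pCons_0_0)
  with 0 have "c *\<^sub>C u \<in> K" by simp
  then have "inverse c *\<^sub>C c *\<^sub>C u \<in> K" using K complex_vector.subspace_scale by blast
  with p assms show ?case by simp
next
  case (Suc d)
  define ev where "ev = (\<lambda>q::complex poly. \<Sum>i\<le>degree q. coeff q i *\<^sub>C (T ^^ i) u)"
  have "\<not> constant (poly p)" using Suc(2) by (simp add: constant_degree)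
  then obtain c where "poly p c = 0" using fundamental_theorem_of_algebra by blast
  then obtain r where r: "p = [:-c, 1:] * r" by (metis dvdE poly_eq_0_iff_dvd)
  with Suc have r0: "r \<noteq> 0" by auto
  have dr: "degree r = d" using Suc(2) r r0 degree_mult_eq[of "[:-c,1:]" r] by auto
  have pow_U: "(T ^^ i) u \<in> U" for i by (induction i) (use inv assms in auto)
  have "ev p = T (ev r) - c *\<^sub>C ev r"
  proof -
    have p_eq: "p = pCons 0 r - smult c r" by (simp add: r)
    have "ev p = (\<Sum>i\<le>Suc d. coeff p i *\<^sub>C (T ^^ i) u)" by (simp add: ev_def Suc(2))
    also have "\<dots> = (\<Sum>i\<le>Suc d. coeff (pCons 0 r) i *\<^sub>C (T ^^ i) u) - (\<Sum>i\<le>Suc d. (c * coeff r i) *\<^sub>C (T ^^ i) u)"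
      by (simp add: p_eq complex_vector.scale_left_diff_distrib sum_subtractf del: sum.atMost_Suc)
    also have "(\<Sum>i\<le>Suc d. coeff (pCons 0 r) i *\<^sub>C (T ^^ i) u) = (\<Sum>i\<le>d. coeff r i *\<^sub>C T ((T ^^ i) u))"
      by (subst sum.atMost_Suc_shift) simp
    also have "\<dots> = T (ev r)"
      using \<open>clinear T\<close> by (simp add: ev_def dr clinear_sum) (simp add: clinear_iff)
    also have "(\<Sum>i\<le>Suc d. (c * coeff r i) *\<^sub>C (T ^^ i) u) = c *\<^sub>C ev r"
      using dr by (simp add: ev_def complex_vector.scale_sum_right coeff_eq_0)
    finally show ?thesis .
  qed
  moreover have "ev p \<in> K" using Suc by (simp add: ev_def)
  moreover have "ev r \<in> U" unfolding ev_def
    by (intro complex_vector.subspace_sum[OF U] complex_vector.subspace_scale[OF U] pow_U)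
  ultimately show ?case
    using Suc(1)[OF dr[symmetric] r0] by (auto simp: ev_def)
qed

lemma eigenvector_mod_subspace:
  fixes T :: "'a::complex_vector \<Rightarrow> 'a"
  assumes "clinear T" and K: "complex_vector.subspace K" and rd: "rel_dim_le d K U"
    and inv: "\<And>x. x \<in> U \<Longrightarrow> T x \<in> U" and U: "complex_vector.subspace U"
    and "u \<in> U" "u \<notin> K"
  shows "\<exists>w c. w \<in> U \<and> w \<notin> K \<and> T w - c *\<^sub>C w \<in> K"
proof -
  have pow_U: "(T ^^ i) u \<in> U" for i by (induction i) (use inv assms in auto)
  then obtain c s where c: "s \<le> d" "c s \<noteq> 0" "(\<Sum>s\<le>d. c s *\<^sub>C (T ^^ s) u) \<in> K"
    using rd[unfolded rel_dim_le_def, rule_format, of "\<lambda>i. (T ^^ i) u"] by auto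
  define p where "p = (\<Sum>i\<le>d. monom (c i) i)"
  have coeff: "coeff p i = (if i \<le> d then c i else 0)" for i
    by (simp add: p_def coeff_sum)
  have "p \<noteq> 0" using c coeff by (metis coeff_0)
  have "degree p \<le> d" by (rule degree_le) (simp add: coeff)
  then have "(\<Sum>i\<le>degree p. coeff p i *\<^sub>C (T ^^ i) u) = (\<Sum>i\<le>d. coeff p i *\<^sub>C (T ^^ i) u)"
    by (intro sum.mono_neutral_left) (auto simp: coeff_eq_0)
  then have "(\<Sum>i\<le>degree p. coeff p i *\<^sub>C (T ^^ i) u) \<in> K"
    using c(3) by (simp add: coeff)
  then show ?thesis
    using poly_annihilating_eigenvector[OF assms(1) K \<open>p \<noteq> 0\<close> inv U] assms by blast
qed

text \<open>
  If some \<open>T q\<close> is not scalar on \<open>U\<close> modulo \<open>K\<close>, then one of its eigenspaces is a smaller subspace that is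
  invariant under all the operators, since they commute.
\<close>

lemma common_eigenvector:
  fixes T :: "'q \<Rightarrow> 'a::complex_vector \<Rightarrow> 'a"
  assumes "rel_dim_le d K U" and K: "complex_vector.subspace K" and "complex_vector.subspace U" "K \<subseteq> U"
    and lin: "\<And>q. q \<in> A \<Longrightarrow> clinear (T q)"
    and KT: "\<And>q x. q \<in> A \<Longrightarrow> x \<in> K \<Longrightarrow> T q x \<in> K"
    and "\<And>q x. q \<in> A \<Longrightarrow> x \<in> U \<Longrightarrow> T q x \<in> U"
    and comm: "\<And>q r x. q \<in> A \<Longrightarrow> r \<in> A \<Longrightarrow> T q (T r x) = T r (T q x)"
    and "\<not> U \<subseteq> K"
  shows "\<exists>u\<in>U. u \<notin> K \<and> (\<forall>q\<in>A. \<exists>c. T q u - c *\<^sub>C u \<in> K)"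
  using assms(1,3,4,7,9)
proof (induction d arbitrary: U)
  case 0
  then show ?case using rel_dim_le_0 K by blast
next
  case (Suc d)
  obtain u where u: "u \<in> U" "u \<notin> K" using Suc by blast
  show ?case
  proof (cases "\<forall>q\<in>A. \<exists>c. T q u - c *\<^sub>C u \<in> K")
    case True
    with u show ?thesis by blast
  next
    case False
    then obtain q where q: "q \<in> A" "\<And>c. T q u - c *\<^sub>C u \<notin> K" by blast
    obtain w c where w: "w \<in> U" "w \<notin> K" "T q w - c *\<^sub>C w \<in> K"
      using eigenvector_mod_subspace[OF lin[OF q(1)] K Suc.prems(1) _ Suc.prems(2) u] Suc.prems(4) q(1)
      by blast
    define U' where "U' = {x\<in>U. T q x - c *\<^sub>C x \<in> K}"
    have lin_diff: "clinear (\<lambda>x. T q x - c *\<^sub>C x)"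
      using lin[OF q(1)] by (auto simp: clinear_iff algebra_simps scaleC_add_right
          complex_vector.scale_right_diff_distrib)
    have sub: "complex_vector.subspace U'"
      unfolding U'_def complex_vector.subspace_def using Suc.prems(2) K lin_diff clinear_0[OF lin_diff]
      by (auto simp: complex_vector.subspace_def clinear_iff)
    have KU': "K \<subseteq> U'" using Suc.prems(3) KT[OF q(1)] K
      by (auto simp: U'_def intro!: complex_vector.subspace_diff complex_vector.subspace_scale)
    have inv: "T r x \<in> U'" if "r \<in> A" "x \<in> U'" for r x
    proof -
      have "T q (T r x) - c *\<^sub>C T r x = T r (T q x - c *\<^sub>C x)"
        using lin[OF that(1)] comm[OF q(1) that(1)] by (simp add: clinear_diff clinear_iff)
      then show ?thesis using that KT Suc.prems(4) by (auto simp: U'_def)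
    qed
    have "rel_dim_le d K U'"
      by (rule rel_dim_le_shrink[OF Suc.prems(1) sub KU', of u]) (use u q in \<open>auto simp: U'_def\<close>)
    from Suc.IH[OF this sub KU' inv] w have "\<exists>u\<in>U'. u \<notin> K \<and> (\<forall>q\<in>A. \<exists>c. T q u - c *\<^sub>C u \<in> K)"
      by (auto simp: U'_def)
    then show ?thesis by (auto simp: U'_def)
  qed
qed

lemma eigenvectors_sum_zero:
  fixes X :: "'a::complex_vector \<Rightarrow> 'a"
  assumes "finite A" "clinear X" "inj_on c A" "\<And>s. s \<in> A \<Longrightarrow> X (w s) = c s *\<^sub>C w s"
    and "(\<Sum>s\<in>A. w s) = 0" "s \<in> A"
  shows "w s = 0"
  using assms(1,3-)
proof (induction A arbitrary: w s rule: finite_induct)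
  case (insert a A)
  have "0 = X (\<Sum>s\<in>insert a A. w s) - c a *\<^sub>C (\<Sum>s\<in>insert a A. w s)"
    unfolding insert.prems(3) using assms(2) by (simp add: clinear_0)
  also have "\<dots> = (\<Sum>s\<in>insert a A. (c s - c a) *\<^sub>C w s)"
    unfolding clinear_sum[OF assms(2)] complex_vector.scale_sum_right sum_subtractf[symmetric]
    by (rule sum.cong) (simp_all add: insert.prems(2) complex_vector.scale_left_diff_distrib)
  also have "\<dots> = (\<Sum>s\<in>A. (c s - c a) *\<^sub>C w s)" using insert by simp
  finally have sum: "(\<Sum>s\<in>A. (c s - c a) *\<^sub>C w s) = 0" by simp
  have "w s = 0" if s: "s \<in> A" for s
  proof -
    have "(c s - c a) *\<^sub>C w s = 0"
      by (rule insert.IH[OF _ _ sum s])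
        (use insert.prems assms(2) in \<open>auto simp: clinear_iff mult.commute\<close>)
    moreover have "c s \<noteq> c a" using insert s by (auto simp: inj_on_def)
    ultimately show ?thesis by simp
  qed
  then show ?case using insert by auto
qed auto

text \<open>
  Eigenvectors for distinct eigenvalues are independent, so their number is bounded by the dimension.
\<close>

lemma card_eigenvalues_le:
  fixes X :: "'a::complex_vector \<Rightarrow> 'a"
  assumes "rel_dim_le d {0} U" "clinear X" "finite C"
    and "\<And>c. c \<in> C \<Longrightarrow> \<exists>u\<in>U. u \<noteq> 0 \<and> X u = c *\<^sub>C u"
  shows "card C \<le> d"
proof (rule ccontr)
  assume "\<not> ?thesis"
  then obtain C' where C': "C' \<subseteq> C" "card C' = Suc d" by (metis not_less_eq_eq obtain_subset_with_card_n)
  then have "finite C'" using assms(3) finite_subset by blast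
  with C' obtain g where "bij_betw g {0..<Suc d} C'" using ex_bij_betw_nat_finite by metis
  then have g: "inj_on g {..d}" "\<And>s. s \<le> d \<Longrightarrow> g s \<in> C"
    using C' by (auto simp: bij_betw_def atLeast0LessThan lessThan_Suc_atMost)
  obtain u where u: "\<And>c. c \<in> C \<Longrightarrow> u c \<in> U \<and> u c \<noteq> 0 \<and> X (u c) = c *\<^sub>C u c"
    using assms(4) by metis
  have "\<forall>s\<le>d. u (g s) \<in> U" using u g by blast
  with assms(1)[unfolded rel_dim_le_def, rule_format, of "\<lambda>s. u (g s)"] obtain k s
    where k: "s \<le> d" "k s \<noteq> 0" "(\<Sum>s\<le>d. k s *\<^sub>C u (g s)) = 0" by auto
  have "k s *\<^sub>C u (g s) = 0"
    by (rule eigenvectors_sum_zero[OF _ assms(2) g(1) _ k(3)])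
      (use u g k assms(2) in \<open>auto simp: clinear_iff mult.commute\<close>)
  then show False using k u g by auto
qed

section \<open>Points of a finitely generated algebra\<close>

definition algebra_ideal :: "'b::complex_comm_algebra set \<Rightarrow> bool"
  where "algebra_ideal J \<longleftrightarrow> complex_vector.subspace J \<and> (\<forall>x. \<forall>y\<in>J. x * y \<in> J)"

lemma algebra_ideal_add: "algebra_ideal J \<Longrightarrow> x \<in> J \<Longrightarrow> y \<in> J \<Longrightarrow> x + y \<in> J"
  and algebra_ideal_diff: "algebra_ideal J \<Longrightarrow> x \<in> J \<Longrightarrow> y \<in> J \<Longrightarrow> x - y \<in> J"
  and algebra_ideal_scale: "algebra_ideal J \<Longrightarrow> x \<in> J \<Longrightarrow> c *\<^sub>C x \<in> J"
  and algebra_ideal_mult: "algebra_ideal J \<Longrightarrow> y \<in> J \<Longrightarrow> x * y \<in> J"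
  and algebra_ideal_0: "algebra_ideal J \<Longrightarrow> 0 \<in> J"
  by (auto simp: algebra_ideal_def complex_vector.subspace_add complex_vector.subspace_diff
      complex_vector.subspace_scale complex_vector.subspace_0)

lemma algebra_idealI:
  assumes "0 \<in> J" "\<And>x y. x \<in> J \<Longrightarrow> y \<in> J \<Longrightarrow> x + y \<in> J" "\<And>c x. x \<in> J \<Longrightarrow> c *\<^sub>C x \<in> J"
    and "\<And>x y. y \<in> J \<Longrightarrow> x * y \<in> J"
  shows "algebra_ideal J"
  using assms by (auto simp: algebra_ideal_def complex_vector.subspace_def)

lemma algebra_hom_of_codim_one_ideal:
  fixes \<eta> :: "'b::complex_comm_algebra \<Rightarrow> complex"
  assumes J: "algebra_ideal J" "1 \<notin> J" and \<eta>: "\<And>x. x - \<eta> x *\<^sub>C 1 \<in> J"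
  shows "algebra_hom \<eta>"
proof -
  have uniq: "\<eta> x = c" if "x - c *\<^sub>C 1 \<in> J" for x c
  proof (rule ccontr)
    assume "\<eta> x \<noteq> c"
    have "(x - c *\<^sub>C 1) - (x - \<eta> x *\<^sub>C 1) \<in> J" using J that \<eta> by (blast intro: algebra_ideal_diff)
    then have "(\<eta> x - c) *\<^sub>C (1::'b) \<in> J" by (simp add: complex_vector.scale_left_diff_distrib)
    then have "inverse (\<eta> x - c) *\<^sub>C (\<eta> x - c) *\<^sub>C (1::'b) \<in> J" using J algebra_ideal_scale by blast
    with \<open>\<eta> x \<noteq> c\<close> J show False by simp
  qed
  have "\<eta> (x + y) = \<eta> x + \<eta> y" for x y
  proof (rule uniq)
    have "(x + y) - (\<eta> x + \<eta> y) *\<^sub>C 1 = (x - \<eta> x *\<^sub>C 1) + (y - \<eta> y *\<^sub>C 1)"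
      by (simp add: scaleC_add_left)
    then show "(x + y) - (\<eta> x + \<eta> y) *\<^sub>C 1 \<in> J" using J \<eta> algebra_ideal_add by metis
  qed
  moreover have "\<eta> (c *\<^sub>C x) = c * \<eta> x" for c x
  proof (rule uniq)
    have "c *\<^sub>C x - (c * \<eta> x) *\<^sub>C 1 = c *\<^sub>C (x - \<eta> x *\<^sub>C 1)"
      by (simp add: complex_vector.scale_right_diff_distrib)
    then show "c *\<^sub>C x - (c * \<eta> x) *\<^sub>C 1 \<in> J" using J \<eta> algebra_ideal_scale by metis
  qed
  moreover have "\<eta> 1 = 1" by (rule uniq) (simp add: algebra_ideal_0 J)
  moreover have "\<eta> (x * y) = \<eta> x * \<eta> y" for x y
  proof (rule uniq)
    have "x * y - (\<eta> x * \<eta> y) *\<^sub>C 1 = x * (y - \<eta> y *\<^sub>C 1) + \<eta> y *\<^sub>C (x - \<eta> x *\<^sub>C 1)"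
      by (simp add: algebra_simps complex_vector.scale_right_diff_distrib scaleC_mult_right)
    then show "x * y - (\<eta> x * \<eta> y) *\<^sub>C 1 \<in> J"
      using J \<eta> algebra_ideal_scale algebra_ideal_add algebra_ideal_mult by metis
  qed
  ultimately show ?thesis by (simp add: algebra_hom_def clinear_iff)
qed

text \<open>
  Substitution of \<open>x\<close> for the indeterminate. The coefficients are first embedded into the algebra.
\<close>

definition poly_at :: "'b::complex_comm_algebra \<Rightarrow> complex poly \<Rightarrow> 'b"
  where "poly_at x p = poly (map_poly (\<lambda>c. c *\<^sub>C 1) p) x"

lemma poly_at_pCons: "poly_at x (pCons a p) = a *\<^sub>C 1 + x * poly_at x p"
  by (simp add: poly_at_def map_poly_pCons)

lemma poly_at_0 [simp]: "poly_at x 0 = 0"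
  by (simp add: poly_at_def)

lemma poly_at_add: "poly_at x (p + q) = poly_at x p + poly_at x q"
  by (induction p q rule: poly_induct2) (simp_all add: poly_at_pCons scaleC_add_left algebra_simps)

lemma poly_at_smult: "poly_at x (smult c p) = c *\<^sub>C poly_at x p"
  by (induction p) (simp_all add: poly_at_pCons scaleC_add_right scaleC_mult_right)

lemma poly_at_sum: "poly_at x (sum f A) = (\<Sum>a\<in>A. poly_at x (f a))"
  by (induction A rule: infinite_finite_induct) (simp_all add: poly_at_add)

lemma poly_at_linear_mult: "poly_at x ([:-c, 1:] * p) = (x - c *\<^sub>C 1) * poly_at x p"
proof -
  have "[:-c, 1:] * p = smult (-c) p + pCons 0 p" by simp
  then have "poly_at x ([:-c, 1:] * p) = (-c) *\<^sub>C poly_at x p + x * poly_at x p"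
    by (simp only: poly_at_add poly_at_smult poly_at_pCons) simp
  then show ?thesis by (simp add: left_diff_distrib scaleC_mult_left)
qed

lemma poly_at_prod_linear:
  "finite C \<Longrightarrow> poly_at x (\<Prod>c\<in>C. [:-c, 1:]) = (\<Prod>c\<in>C. x - c *\<^sub>C 1)"
proof (induction C rule: finite_induct)
  case empty
  show ?case by (simp add: one_pCons poly_at_pCons)
next
  case (insert c C)
  then show ?case by (simp only: prod.insert poly_at_linear_mult not_False_eq_True)
qed

text \<open>
  A zero of a nonzero polynomial modulo \<open>J\<close>: one of the linear factors \<open>x - c\<close> of \<open>p(x)\<close> is a zero divisor
  modulo \<open>J\<close>.
\<close>

lemma poly_at_in_ideal_imp_root:
  assumes J: "algebra_ideal J" "1 \<notin> J" and "p \<noteq> 0" "poly_at x p \<in> J"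
  shows "\<exists>c w. w \<notin> J \<and> (x - c *\<^sub>C 1) * w \<in> J"
  using assms(3,4)
proof (induction "degree p" arbitrary: p)
  case 0
  then obtain c where p: "p = [:c:]" "c \<noteq> 0" by (metis degree_eq_zeroE pCons_0_0)
  with 0 have "c *\<^sub>C 1 \<in> J" by (simp add: poly_at_pCons)
  then have "inverse c *\<^sub>C c *\<^sub>C 1 \<in> J" using J algebra_ideal_scale by blast
  with p J show ?case by simp
next
  case (Suc d)
  have "\<not> constant (poly p)" using Suc(2) by (simp add: constant_degree)
  then obtain c where "poly p c = 0" using fundamental_theorem_of_algebra by blast
  then obtain r where r: "p = [:-c, 1:] * r" by (metis dvdE poly_eq_0_iff_dvd)
  with Suc have r0: "r \<noteq> 0" by auto
  have dr: "degree r = d" using Suc(2) r r0 degree_mult_eq[of "[:-c,1:]" r] by auto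
  show ?case
  proof (cases "poly_at x r \<in> J")
    case True
    with Suc(1)[OF dr[symmetric] r0] show ?thesis by blast
  next
    case False
    with Suc.prems show ?thesis unfolding r poly_at_linear_mult by blast
  qed
qed

lemma finitely_generated_algebra_countable_span:
  assumes "finite S" "subalgebra hull S = (UNIV :: 'b::complex_comm_algebra set)"
  shows "\<exists>g :: nat \<Rightarrow> 'b. complex_vector.span (range g) = UNIV"
proof -
  let ?M = "prod_list ` lists S"
  let ?A = "complex_vector.span ?M"
  have "x * y \<in> ?A" if x: "x \<in> ?A" and y: "y \<in> ?A" for x y
    using x
  proof (induction rule: complex_vector.span_induct_alt)
    case base
    show ?case by (simp add: complex_vector.span_zero)
  next
    case (step c u z)
    have "u * y \<in> ?A"
      using y
    proof (induction rule: complex_vector.span_induct_alt)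
      case base
      show ?case by (simp add: complex_vector.span_zero)
    next
      case (step d v z')
      from \<open>u \<in> ?M\<close> step obtain us vs where "us \<in> lists S" "vs \<in> lists S" "u = prod_list us" "v = prod_list vs"
        by auto
      then have "u * v \<in> ?M" by (intro image_eqI[of _ _ "us @ vs"]) auto
      then have "d *\<^sub>C (u * v) + u * z' \<in> ?A"
        by (intro complex_vector.span_add complex_vector.span_scale step complex_vector.span_base)
      then show ?case by (simp add: distrib_left scaleC_mult_right)
    qed
    then have "c *\<^sub>C (u * y) + z * y \<in> ?A"
      by (intro complex_vector.span_add complex_vector.span_scale step)
    then show ?case by (simp add: distrib_right scaleC_mult_left)
  qed
  moreover have "1 \<in> ?A" by (rule complex_vector.span_base, rule image_eqI[of _ _ "[]"]) auto
  ultimately have "subalgebra ?A" by (simp add: subalgebra_def)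
  moreover have "S \<subseteq> ?A"
  proof
    fix s assume "s \<in> S"
    then show "s \<in> ?A" by (intro complex_vector.span_base image_eqI[of _ _ "[s]"]) auto
  qed
  ultimately have "?A = UNIV" using assms(2) hull_minimal[of S ?A subalgebra] by auto
  moreover have "countable ?M" using assms(1) by (intro countable_image countable_lists countable_finite)
  moreover have "?M \<noteq> {}" by auto
  ultimately show ?thesis by (metis range_from_nat_into)
qed

text \<open>
  The step of the weak Nullstellensatz over an uncountable field. If \<open>x - c\<close> were invertible modulo \<open>J\<close>
  for every \<open>c\<close>, with inverses \<open>y c\<close>, then uncountably many \<open>y c\<close> would lie in a space of countable
  dimension. Some finite linear relation between them, multiplied by the denominators \<open>x - c\<close>, says that
  a nonzero polynomial in \<open>x\<close> vanishes modulo \<open>J\<close>, so some \<open>x - c\<close> is not invertible after all.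
\<close>

lemma ideal_proper_extension:
  fixes x :: "'b::complex_comm_algebra" and g :: "nat \<Rightarrow> 'b"
  assumes J: "algebra_ideal J" "1 \<notin> J" and g: "complex_vector.span (range g) = UNIV"
  shows "\<exists>J' c. algebra_ideal J' \<and> 1 \<notin> J' \<and> J \<subseteq> J' \<and> x - c *\<^sub>C 1 \<in> J'"
proof (rule ccontr)
  assume contra: "\<not> ?thesis"
  have "\<exists>y. 1 - (x - c *\<^sub>C 1) * y \<in> J" for c
  proof -
    let ?J' = "{z. \<exists>y. z - (x - c *\<^sub>C 1) * y \<in> J}"
    have "algebra_ideal ?J'"
    proof (rule algebra_idealI)
      show "0 \<in> ?J'" using algebra_ideal_0[OF J(1)] by (auto intro!: exI[of _ 0])
    next
      fix u v assume "u \<in> ?J'" "v \<in> ?J'"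
      then obtain y z where "u - (x - c *\<^sub>C 1) * y \<in> J" "v - (x - c *\<^sub>C 1) * z \<in> J" by blast
      from algebra_ideal_add[OF J(1) this] have "u + v - (x - c *\<^sub>C 1) * (y + z) \<in> J"
        by (simp add: algebra_simps)
      then show "u + v \<in> ?J'" by blast
    next
      fix d u assume "u \<in> ?J'"
      then obtain y where "u - (x - c *\<^sub>C 1) * y \<in> J" by blast
      from algebra_ideal_scale[OF J(1) this, of d] have "d *\<^sub>C u - (x - c *\<^sub>C 1) * (d *\<^sub>C y) \<in> J"
        by (simp add: complex_vector.scale_right_diff_distrib scaleC_mult_right)
      then show "d *\<^sub>C u \<in> ?J'" by blast
    next
      fix z u assume "u \<in> ?J'"
      then obtain y where "u - (x - c *\<^sub>C 1) * y \<in> J" by blast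
      from algebra_ideal_mult[OF J(1) this, of z] have "z * u - (x - c *\<^sub>C 1) * (z * y) \<in> J"
        by (simp add: right_diff_distrib mult.left_commute)
      then show "z * u \<in> ?J'" by blast
    qed
    moreover have "J \<subseteq> ?J'" by (auto intro!: exI[of _ 0])
    moreover have "x - c *\<^sub>C 1 \<in> ?J'" by (auto intro!: exI[of _ 1] simp: algebra_ideal_0 J)
    ultimately have "1 \<in> ?J'" using contra by blast
    then show ?thesis by simp
  qed
  then obtain y where y: "\<And>c. 1 - (x - c *\<^sub>C 1) * y c \<in> J" by metis
  let ?C = "\<lambda>n. {c. y c \<in> complex_vector.span (g ` {..<n})}"
  have "c \<in> (\<Union>n. ?C n)" for c
  proof -
    have "y c \<in> complex_vector.span (range g)" using g by simp
    then obtain t r where t: "finite t" "t \<subseteq> range g" "y c = (\<Sum>a\<in>t. r a *\<^sub>C a)"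
      unfolding complex_vector.span_explicit by blast
    from t obtain X where X: "finite X" "t = g ` X" by (metis finite_subset_image)
    obtain n where "X \<subseteq> {..<n}" using X(1) finite_nat_iff_bounded by blast
    then have "y c \<in> complex_vector.span (g ` {..<n})"
      unfolding t X(2) by (intro complex_vector.span_sum complex_vector.span_scale complex_vector.span_base) auto
    then show ?thesis by blast
  qed
  then have "(\<Union>n. ?C n) = UNIV" by blast
  have "\<exists>n. infinite (?C n)"
  proof (rule ccontr)
    assume "\<not> ?thesis"
    then have "countable (?C n)" for n by (intro countable_finite) blast
    then have "countable (\<Union>n. ?C n)" by (intro countable_UN) auto
    with \<open>(\<Union>n. ?C n) = UNIV\<close> uncountable_UNIV_complex show False by simp
  qed
  then obtain n where n: "infinite (?C n)" by blast
  obtain Y where Y: "Y \<subseteq> g ` {..<n}" "complex_vector.independent Y" "g ` {..<n} \<subseteq> complex_vector.span Y"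
    using complex_vector.maximal_independent_subset[of "g ` {..<n}"] by blast
  have fY: "finite Y" using Y(1) finite_subset by blast
  have rd: "rel_dim_le (card Y) {0} (complex_vector.span Y)"
    using rel_dim_le_span[OF fY Y(2)] by simp
  obtain C where C: "C \<subseteq> ?C n" "finite C" "card C = Suc (card Y)" using n infinite_arbitrarily_large by metis
  then obtain \<gamma> where "bij_betw \<gamma> {0..<Suc (card Y)} C" using ex_bij_betw_nat_finite by metis
  then have \<gamma>: "bij_betw \<gamma> {..card Y} C" by (simp add: atLeast0LessThan lessThan_Suc_atMost)
  have "\<forall>s\<le>card Y. y (\<gamma> s) \<in> complex_vector.span Y"
  proof (intro allI impI)
    fix s assume "s \<le> card Y"
    then have "\<gamma> s \<in> ?C n" using \<gamma> C bij_betwE by blast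
    then show "y (\<gamma> s) \<in> complex_vector.span Y"
      using complex_vector.span_mono[OF Y(3)] by (auto simp: complex_vector.span_span)
  qed
  with rd[unfolded rel_dim_le_def, rule_format, of "\<lambda>s. y (\<gamma> s)"] obtain k' s0
    where k': "s0 \<le> card Y" "k' s0 \<noteq> 0" "(\<Sum>s\<le>card Y. k' s *\<^sub>C y (\<gamma> s)) = 0" by auto
  define k where "k c = k' (inv_into {..card Y} \<gamma> c)" for c
  have kg: "k (\<gamma> s) = k' s" if "s \<le> card Y" for s
    using \<gamma> that by (simp add: k_def bij_betw_inv_into_left)
  have sum0: "(\<Sum>c\<in>C. k c *\<^sub>C y c) = 0"
    using sum.reindex_bij_betw[OF \<gamma>, of "\<lambda>c. k c *\<^sub>C y c"] k'(3) kg by simp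
  define c0 where "c0 = \<gamma> s0"
  have c0: "c0 \<in> C" "k c0 \<noteq> 0" using k'(1,2) kg \<gamma> by (auto simp: c0_def bij_betw_def)
  (* The numerator of the sum of the k c / (X - c); only the summand of c0 is nonzero at c0. *)
  define p where "p = (\<Sum>c\<in>C. smult (k c) (\<Prod>c'\<in>C - {c}. [:-c', 1:]))"
  have "poly p c0 = (\<Sum>c\<in>C. k c * (\<Prod>c'\<in>C - {c}. c0 - c'))"
    by (simp add: p_def poly_sum poly_prod)
  also have "\<dots> = k c0 * (\<Prod>c'\<in>C - {c0}. c0 - c') + (\<Sum>c\<in>C - {c0}. k c * (\<Prod>c'\<in>C - {c}. c0 - c'))"
    using C(2) c0(1) by (rule sum.remove)
  also have "(\<Sum>c\<in>C - {c0}. k c * (\<Prod>c'\<in>C - {c}. c0 - c')) = 0"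
    by (rule sum.neutral) (use C c0 in \<open>auto intro!: prod_zero\<close>)
  finally have "poly p c0 \<noteq> 0" using c0 C by auto
  then have "p \<noteq> 0" by auto
  have "(\<Prod>c'\<in>C. x - c' *\<^sub>C 1) * (\<Sum>c\<in>C. k c *\<^sub>C y c)
      = (\<Sum>c\<in>C. k c *\<^sub>C ((\<Prod>c'\<in>C - {c}. x - c' *\<^sub>C 1) * ((x - c *\<^sub>C 1) * y c)))"
    unfolding sum_distrib_left
  proof (rule sum.cong)
    fix c assume "c \<in> C"
    then show "(\<Prod>c'\<in>C. x - c' *\<^sub>C 1) * k c *\<^sub>C y c
      = k c *\<^sub>C ((\<Prod>c'\<in>C - {c}. x - c' *\<^sub>C 1) * ((x - c *\<^sub>C 1) * y c))"
      using C(2) by (subst prod.remove[of C c]) (auto simp: scaleC_mult_right mult.assoc mult.left_commute)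
  qed simp
  then have 1: "(\<Sum>c\<in>C. k c *\<^sub>C ((\<Prod>c'\<in>C - {c}. x - c' *\<^sub>C 1) * ((x - c *\<^sub>C 1) * y c))) = 0"
    by (simp add: sum0)
  have "poly_at x p = (\<Sum>c\<in>C. k c *\<^sub>C (\<Prod>c'\<in>C - {c}. x - c' *\<^sub>C 1))"
    using C(2) by (simp add: p_def poly_at_sum poly_at_smult poly_at_prod_linear)
  also have "\<dots> = \<dots> - (\<Sum>c\<in>C. k c *\<^sub>C ((\<Prod>c'\<in>C - {c}. x - c' *\<^sub>C 1) * ((x - c *\<^sub>C 1) * y c)))"
    by (simp add: 1)
  also have "\<dots> = (\<Sum>c\<in>C. k c *\<^sub>C ((\<Prod>c'\<in>C - {c}. x - c' *\<^sub>C 1) * (1 - (x - c *\<^sub>C 1) * y c)))"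
    by (simp add: sum_subtractf[symmetric] complex_vector.scale_right_diff_distrib right_diff_distrib)
  also have "\<dots> \<in> J"
    using J(1) by (intro complex_vector.subspace_sum algebra_ideal_scale algebra_ideal_mult y)
      (auto simp: algebra_ideal_def)
  finally obtain c w where w: "w \<notin> J" "(x - c *\<^sub>C 1) * w \<in> J"
    using poly_at_in_ideal_imp_root[OF J \<open>p \<noteq> 0\<close>] by blast
  have "y c * ((x - c *\<^sub>C 1) * w) + w * (1 - (x - c *\<^sub>C 1) * y c) \<in> J"
    by (intro algebra_ideal_add algebra_ideal_mult J y w)
  also have "y c * ((x - c *\<^sub>C 1) * w) + w * (1 - (x - c *\<^sub>C 1) * y c) = w"
    by (simp add: algebra_simps)
  finally show False using w by simp
qed

text \<open>
  Adjoin to the zero ideal an element \<open>s - c\<close> for each generator \<open>s\<close> in turn, keeping the ideal proper. The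
  elements that are scalar modulo the final ideal form a subalgebra containing the generators.
\<close>

lemma finitely_generated_algebra_has_point:
  assumes "finitely_generated_algebra TYPE('b::complex_comm_algebra)"
  shows "\<exists>\<eta> :: 'b \<Rightarrow> complex. algebra_hom \<eta>"
proof -
  obtain S :: "'b set" where S: "finite S" "subalgebra hull S = UNIV"
    using assms by (auto simp: finitely_generated_algebra_def)
  obtain g :: "nat \<Rightarrow> 'b" where g: "complex_vector.span (range g) = UNIV"
    using finitely_generated_algebra_countable_span[OF S] by blast
  have "\<exists>J :: 'b set. algebra_ideal J \<and> 1 \<notin> J \<and> (\<forall>s\<in>S. \<exists>c. s - c *\<^sub>C 1 \<in> J)"
    using S(1)
  proof (induction S rule: finite_induct)
    case empty
    show ?case by (rule exI[of _ "{0}"]) (auto simp: algebra_ideal_def complex_vector.subspace_0)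
  next
    case (insert s S)
    then obtain J :: "'b set" where "algebra_ideal J" "1 \<notin> J" "\<forall>s\<in>S. \<exists>c. s - c *\<^sub>C 1 \<in> J" by blast
    with ideal_proper_extension[OF _ _ g, of J s] show ?case by blast
  qed
  then obtain J :: "'b set" where J: "algebra_ideal J" "1 \<notin> J" and JS: "\<forall>s\<in>S. \<exists>c. s - c *\<^sub>C 1 \<in> J"
    by blast
  let ?A = "{x. \<exists>c. x - c *\<^sub>C 1 \<in> J}"
  have "subalgebra ?A"
    unfolding subalgebra_def complex_vector.subspace_def
  proof (intro conjI allI ballI)
    show "0 \<in> ?A" by (auto intro!: exI[of _ 0] simp: algebra_ideal_0 J)
    show "1 \<in> ?A" by (auto intro!: exI[of _ 1] simp: algebra_ideal_0 J)
  next
    fix e x assume "x \<in> ?A"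
    then obtain c where "x - c *\<^sub>C 1 \<in> J" by blast
    from algebra_ideal_scale[OF J(1) this, of e] have "e *\<^sub>C x - (e * c) *\<^sub>C 1 \<in> J"
      by (simp add: complex_vector.scale_right_diff_distrib)
    then show "e *\<^sub>C x \<in> ?A" by blast
  next
    fix x y assume "x \<in> ?A" "y \<in> ?A"
    then obtain c d where x: "x - c *\<^sub>C 1 \<in> J" and y: "y - d *\<^sub>C 1 \<in> J" by blast
    have "x + y - (c + d) *\<^sub>C 1 \<in> J"
      using algebra_ideal_add[OF J(1) x y] by (simp add: scaleC_add_left algebra_simps)
    then show "x + y \<in> ?A" by blast
    have "x * (y - d *\<^sub>C 1) + d *\<^sub>C (x - c *\<^sub>C 1) \<in> J"
      by (intro algebra_ideal_add algebra_ideal_mult algebra_ideal_scale J x y)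
    also have "x * (y - d *\<^sub>C 1) + d *\<^sub>C (x - c *\<^sub>C 1) = x * y - (c * d) *\<^sub>C 1"
      by (simp add: algebra_simps complex_vector.scale_right_diff_distrib scaleC_mult_right)
    finally show "x * y \<in> ?A" by blast
  qed
  with JS S(2) have "?A = UNIV" using hull_minimal[of S ?A subalgebra] by auto
  then have "\<forall>x. \<exists>c. x - c *\<^sub>C 1 \<in> J" by blast
  then obtain \<eta> where "\<And>x. x - \<eta> x *\<^sub>C 1 \<in> J" by metis
  then show ?thesis using algebra_hom_of_codim_one_ideal[OF J] by blast
qed

section \<open>Spanning sets and generic functionals\<close>

lemma additive_int:
  fixes h :: "int \<Rightarrow> 'a::complex_vector"
  assumes "\<And>a b. h (a + b) = h a + h b"
  shows "h z = of_int z *\<^sub>C h 1"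
proof -
  have h0: "h 0 = 0" using assms[of 0 0] by simp
  show ?thesis
  proof (induction z rule: int_induct[where k = 0])
    case base
    show ?case by (simp add: h0)
  next
    case (step1 i)
    then show ?case by (simp add: assms scaleC_add_left)
  next
    case (step2 i)
    have "h i = h (i - 1) + h 1" using assms[of "i - 1" 1] by simp
    then have "h (i - 1) = h i - h 1" by simp
    with step2 show ?case by (simp add: complex_vector.scale_left_diff_distrib)
  qed
qed

lemma additive_int_vec:
  fixes L :: "int ^ 'n::finite \<Rightarrow> 'a::complex_vector"
  assumes add: "\<And>k l. L (k + l) = L k + L l"
  shows "L k = (\<Sum>i\<in>UNIV. of_int (k $ i) *\<^sub>C L (axis i 1))"
proof -
  have L0: "L 0 = 0" using add[of 0 0] by simp
  have Lsum: "L (sum f A) = (\<Sum>a\<in>A. L (f a))" for f :: "'n \<Rightarrow> _" and A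
    by (induction A rule: infinite_finite_induct) (simp_all add: L0 add)
  have "k = (\<Sum>i\<in>UNIV. axis i (k $ i))" by (simp add: vec_eq_iff axis_def)
  then have "L k = L (\<Sum>i\<in>UNIV. axis i (k $ i))" by (rule arg_cong[where f = L])
  also have "\<dots> = (\<Sum>i\<in>UNIV. L (axis i (k $ i)))" by (rule Lsum)
  finally have "L k = (\<Sum>i\<in>UNIV. L (axis i (k $ i)))" .
  moreover have "L (axis i (k $ i)) = of_int (k $ i) *\<^sub>C L (axis i 1)" for i
  proof (rule additive_int)
    have "axis i (a + b) = axis i a + (axis i b :: int ^ 'n)" for a b
      by (simp add: axis_def vec_eq_iff)
    then show "L (axis i (a + b)) = L (axis i a) + L (axis i b)" for a b by (simp add: add)
  qed
  ultimately show ?thesis by (simp only:)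
qed

lemma der_apply_sum: "der_apply (sum f A) x = (\<Sum>a\<in>A. der_apply (f a) x)"
  by (induction A rule: infinite_finite_induct) (simp_all add: zero_witt.rep_eq plus_witt.rep_eq)

text \<open>
  For a derivation \<open>D\<close>, the Leibniz rule makes \<open>L(k) = t\<^sup>-\<^sup>k D(t\<^sup>k)\<close> additive in \<open>k\<close>. So \<open>L\<close> is determined by
  its values \<open>g i\<close> on unit vectors, and \<open>D = \<Sum> g\<^sub>i d\<^sub>i\<close>.
\<close>

lemma witt_in_span_basis:
  fixes D :: "'n::finite witt"
  shows "D \<in> complex_vector.span (range (\<lambda>(m, i). witt_basis m i))"
proof -
  define L where "L k = Poly_Mapping.single (- k) 1 * der_apply D (Poly_Mapping.single k 1)" for k
  have der: "der_apply D (f * g) = der_apply D f * g + f * der_apply D g" for f g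
    using derivation_der_apply[of D] by (simp add: derivation_def)
  have one: "Poly_Mapping.single k 1 * Poly_Mapping.single (- k) 1 = (1 :: 'n laurent)" for k :: "int ^ 'n"
    by (simp add: mult_single)
  have add: "L (k + l) = L k + L l" for k l
  proof -
    let ?s = "\<lambda>k :: int ^ 'n. Poly_Mapping.single k (1 :: complex)"
    have "?s (k + l) = ?s k * ?s l" "?s (- (k + l)) = ?s (- k) * ?s (- l)"
      by (simp_all add: mult_single)
    then have "L (k + l) = ?s (- k) * ?s (- l) * (der_apply D (?s k) * ?s l + ?s k * der_apply D (?s l))"
      by (simp only: L_def der)
    also have "\<dots> = (?s l * ?s (- l)) * (?s (- k) * der_apply D (?s k))
        + (?s k * ?s (- k)) * (?s (- l) * der_apply D (?s l))"
      by (simp only: distrib_left ac_simps)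
    also have "\<dots> = L k + L l" by (simp only: one mult_1 L_def)
    finally show ?thesis .
  qed
  have mem: "witt_basis m i \<in> complex_vector.span (range (\<lambda>(m, i). witt_basis m i))" for m and i :: 'n
    by (rule complex_vector.span_base, rule range_eqI[of _ _ "(m, i)"]) simp
  define g where "g i = L (axis i 1)" for i
  have L: "L k = (\<Sum>i\<in>UNIV. of_int (k $ i) *\<^sub>C g i)" for k
    unfolding g_def by (rule additive_int_vec) (rule add)
  have "D = (\<Sum>i\<in>UNIV. \<Sum>m\<in>Poly_Mapping.keys (g i). Poly_Mapping.lookup (g i) m *\<^sub>C witt_basis m i)"
  proof (rule witt_eqI)
    fix k
    have "der_apply D (Poly_Mapping.single k 1)
        = Poly_Mapping.single k 1 * Poly_Mapping.single (- k) 1 * der_apply D (Poly_Mapping.single k 1)"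
      by (simp only: one mult_1)
    also have "\<dots> = L k * Poly_Mapping.single k 1" by (simp only: L_def ac_simps)
    also have "\<dots> = (\<Sum>i\<in>UNIV. (of_int (k $ i) *\<^sub>C g i) * Poly_Mapping.single k 1)"
      by (simp only: L sum_distrib_right)
    also have "\<dots> = (\<Sum>i\<in>UNIV. \<Sum>m\<in>Poly_Mapping.keys (g i).
        Poly_Mapping.lookup (g i) m *\<^sub>C Poly_Mapping.single (m + k) (of_int (k $ i)))"
    proof (rule sum.cong[OF refl])
      fix i
      have "(of_int (k $ i) *\<^sub>C g i) * Poly_Mapping.single k 1
          = (of_int (k $ i) *\<^sub>C (\<Sum>m\<in>Poly_Mapping.keys (g i).
              Poly_Mapping.single m (Poly_Mapping.lookup (g i) m))) * Poly_Mapping.single k 1"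
        by (simp only: poly_mapping_sum_single[symmetric])
      also have "\<dots> = (\<Sum>m\<in>Poly_Mapping.keys (g i).
        Poly_Mapping.lookup (g i) m *\<^sub>C Poly_Mapping.single (m + k) (of_int (k $ i)))"
        by (simp add: complex_vector.scale_sum_right sum_distrib_right scaleC_single mult_single)
          (simp add: mult.commute)
      finally show "(of_int (k $ i) *\<^sub>C g i) * Poly_Mapping.single k 1 = (\<Sum>m\<in>Poly_Mapping.keys (g i).
        Poly_Mapping.lookup (g i) m *\<^sub>C Poly_Mapping.single (m + k) (of_int (k $ i)))" .
    qed
    also have "\<dots> = der_apply (\<Sum>i\<in>UNIV. \<Sum>m\<in>Poly_Mapping.keys (g i).
        Poly_Mapping.lookup (g i) m *\<^sub>C witt_basis m i) (Poly_Mapping.single k 1)"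
      by (simp add: der_apply_sum scaleC_witt.rep_eq der_apply_witt_basis_single)
    finally show "der_apply D (Poly_Mapping.single k 1) = der_apply (\<Sum>i\<in>UNIV. \<Sum>m\<in>Poly_Mapping.keys (g i).
        Poly_Mapping.lookup (g i) m *\<^sub>C witt_basis m i) (Poly_Mapping.single k 1)" .
  qed
  also have "\<dots> \<in> complex_vector.span (range (\<lambda>(m, i). witt_basis m i))"
    by (intro complex_vector.span_sum complex_vector.span_scale mem)
  finally show ?thesis .
qed

lemma pure_tensor_in_subspace:
  assumes W: "complex_vector.subspace W" and "\<And>x b. x \<otimes> b \<in> W"
  shows "t \<in> W"
proof -
  obtain p where t: "t = abs_tensor p" by (metis Quotient3_tensor Quotient3_def)
  have "abs_tensor (Poly_Mapping.single k c) \<in> W" for k and c :: complex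
  proof -
    obtain x b where k: "k = (x, b)" by (cases k)
    have "Poly_Mapping.single k c = c *\<^sub>C Poly_Mapping.single k 1" by (simp add: scaleC_single)
    moreover have "abs_tensor (c *\<^sub>C Poly_Mapping.single k 1) = c *\<^sub>C abs_tensor (Poly_Mapping.single k 1)"
      using clinear_abs_tensor unfolding clinear_iff by blast
    ultimately have "abs_tensor (Poly_Mapping.single k c) = c *\<^sub>C (x \<otimes> b)"
      by (simp only: k abs_tensor_single)
    then show ?thesis by (simp only: complex_vector.subspace_scale[OF W assms(2)])
  qed
  then have "(\<Sum>k\<in>Poly_Mapping.keys p. abs_tensor (Poly_Mapping.single k (Poly_Mapping.lookup p k))) \<in> W"
    by (intro complex_vector.subspace_sum W)
  also have "(\<Sum>k\<in>Poly_Mapping.keys p. abs_tensor (Poly_Mapping.single k (Poly_Mapping.lookup p k)))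
      = abs_tensor (\<Sum>k\<in>Poly_Mapping.keys p. Poly_Mapping.single k (Poly_Mapping.lookup p k))"
    by (rule clinear_sum[OF clinear_abs_tensor, symmetric])
  also have "\<dots> = t" by (simp only: t poly_mapping_sum_single[symmetric])
  finally show ?thesis .
qed

lemma witt_tensor_in_subspace:
  fixes t :: "('n::finite witt, 'b::complex_comm_algebra) tensor"
  assumes W: "complex_vector.subspace W" and base: "\<And>m i b. witt_basis m i \<otimes> b \<in> W"
  shows "t \<in> W"
proof (rule pure_tensor_in_subspace[OF W])
  fix x :: "'n witt" and b :: 'b
  have lin: "clinear (\<lambda>x :: 'n witt. x \<otimes> b)" using cbilinear_pure_tensor by (auto simp: cbilinear_def)
  show "x \<otimes> b \<in> W"
    using witt_in_span_basis[of x]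
  proof (induction rule: complex_vector.span_induct_alt)
    case base
    show ?case using clinear_0[OF lin] complex_vector.subspace_0[OF W] by simp
  next
    case (step c u v)
    then show ?case using lin assms
      by (auto simp: clinear_iff intro!: complex_vector.subspace_add complex_vector.subspace_scale)
  qed
qed

text \<open>
  Take the powers of a number \<open>x\<close> that avoids the countably many roots of the nonzero polynomials with
  coefficient vectors \<open>m\<close>. A generic combination \<open>\<Sum> \<gamma>\<^sub>j d\<^sub>j\<close> of the Cartan elements then detects every
  nonzero \<open>m\<close> at once.
\<close>

lemma generic_vector_exists:
  "\<exists>\<gamma> :: 'n::finite \<Rightarrow> complex. \<forall>m :: int ^ 'n. m \<noteq> 0 \<longrightarrow> (\<Sum>j\<in>UNIV. \<gamma> j * of_int (m $ j)) \<noteq> 0"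
proof -
  obtain idx :: "'n \<Rightarrow> nat" where idx: "inj idx"
    using finite_imp_inj_to_nat_seg[of "UNIV :: 'n set"] by auto
  define p where "p m = (\<Sum>j\<in>UNIV. monom (of_int (m $ j) :: complex) (idx j))" for m :: "int ^ 'n"
  have coeff: "coeff (p m) (idx j) = of_int (m $ j)" for m j
  proof -
    have "coeff (p m) (idx j) = (\<Sum>l\<in>UNIV. if l = j then of_int (m $ l) else 0)"
      unfolding p_def coeff_sum by (rule sum.cong) (use idx in \<open>auto simp: inj_eq\<close>)
    then show ?thesis by simp
  qed
  have p0: "p m \<noteq> 0" if "m \<noteq> 0" for m using that coeff[of m] by (auto simp: vec_eq_iff)
  have "countable (\<Union>m\<in>- {0}. {x. poly (p m) x = 0})"
    by (intro countable_UN countable_finite poly_roots_finite countableI_type) (auto simp: p0)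
  then have "(\<Union>m\<in>- {0}. {x. poly (p m) x = 0}) \<noteq> UNIV" using uncountable_UNIV_complex by auto
  then obtain x where x: "\<And>m. m \<noteq> 0 \<Longrightarrow> poly (p m) x \<noteq> 0" by blast
  have "poly (p m) x = (\<Sum>j\<in>UNIV. x ^ idx j * of_int (m $ j))" for m
    by (simp add: p_def poly_sum poly_monom mult.commute)
  with x show ?thesis by (intro exI[of _ "\<lambda>j. x ^ idx j"]) metis
qed

section \<open>Nilpotency of commutators\<close>

lemma eq_neg_self_imp_zero:
  fixes x :: "'v::complex_vector"
  assumes "x = - x"
  shows "x = 0"
proof -
  have "(2 :: complex) *\<^sub>C x = x + x" by (metis one_add_one scaleC_add_left scaleC_one)
  also have "\<dots> = 0" using assms by (metis add.right_inverse)
  finally show ?thesis by simp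
qed

lemma clinear_funpow:
  fixes P :: "'v::complex_vector \<Rightarrow> 'v"
  shows "clinear P \<Longrightarrow> clinear (P ^^ k)"
  by (induction k) (auto simp: clinear_iff)

lemma funpow_zero_mono:
  fixes P :: "'v::complex_vector \<Rightarrow> 'v"
  assumes "clinear P" "(P ^^ k) v = 0" "k \<le> l"
  shows "(P ^^ l) v = 0"
proof -
  have "(P ^^ l) v = (P ^^ (l - k)) ((P ^^ k) v)"
    using assms(3) by (metis comp_apply funpow_add le_add_diff_inverse2)
  then show ?thesis using assms clinear_0[OF clinear_funpow] by metis
qed

lemma funpow_scaleC:
  fixes T :: "'v::complex_vector \<Rightarrow> 'v"
  assumes "clinear T"
  shows "((\<lambda>v. c *\<^sub>C T v) ^^ k) v = c ^ k *\<^sub>C (T ^^ k) v"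
proof (induction k)
  case (Suc k)
  then show ?case using assms by (simp add: clinear_iff)
qed simp

lemma funpow_commutes: "(\<And>v. P (Z v) = Z (P v)) \<Longrightarrow> (P ^^ k) (Z v) = Z ((P ^^ k) v)"
  by (induction k arbitrary: v) (simp_all add: funpow_swap1)

text \<open>
  This is \<open>[P\<^sup>k\<^sup>+\<^sup>1, Y] = (k + 1) Z P\<^sup>k\<close> for \<open>Z = [P, Y]\<close> commuting with \<open>P\<close>.
\<close>

lemma funpow_commutator:
  fixes P Y Z :: "'v::complex_vector \<Rightarrow> 'v"
  assumes P: "clinear P" and Z: "clinear Z"
    and PY: "\<And>v. P (Y v) = Y (P v) + Z v" and PZ: "\<And>v. P (Z v) = Z (P v)"
  shows "(P ^^ Suc k) (Y v) = Y ((P ^^ Suc k) v) + of_nat (Suc k) *\<^sub>C Z ((P ^^ k) v)"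
proof (induction k)
  case 0
  show ?case by (simp add: PY)
next
  case (Suc k)
  have "(P ^^ Suc (Suc k)) (Y v) = P ((P ^^ Suc k) (Y v))" by simp
  also have "\<dots> = P (Y ((P ^^ Suc k) v)) + of_nat (Suc k) *\<^sub>C P (Z ((P ^^ k) v))"
    unfolding Suc using P by (simp add: clinear_iff)
  also have "\<dots> = Y ((P ^^ Suc (Suc k)) v) + (Z ((P ^^ Suc k) v) + of_nat (Suc k) *\<^sub>C Z ((P ^^ Suc k) v))"
    by (simp add: PY PZ)
  also have "Z ((P ^^ Suc k) v) + of_nat (Suc k) *\<^sub>C Z ((P ^^ Suc k) v)
      = of_nat (Suc (Suc k)) *\<^sub>C Z ((P ^^ Suc k) v)"
    by (simp only: of_nat_Suc[of "Suc k"] scaleC_add_left scaleC_one)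
  finally show ?case .
qed

text \<open>
  Commuting \<open>P\<^sup>k\<^sup>+\<^sup>1 Z\<^sup>s = 0\<close> with \<open>Y\<close> gives \<open>(k + 1) P\<^sup>k Z\<^sup>s\<^sup>+\<^sup>1 + s P\<^sup>k\<^sup>+\<^sup>1 Z\<^sup>s\<^sup>-\<^sup>1 Z' = 0\<close>. After one more factor \<open>Z\<close>
  the second term contains \<open>P\<^sup>k\<^sup>+\<^sup>1 Z\<^sup>s\<close> and vanishes.
\<close>

lemma nilpotent_commutator_step:
  fixes P Y Z Z' :: "'v::complex_vector \<Rightarrow> 'v"
  assumes P: "clinear P" and Z: "clinear Z" and Y: "clinear Y" and Z': "clinear Z'"
    and PY: "\<And>v. P (Y v) = Y (P v) + Z v" and ZY: "\<And>v. Z (Y v) = Y (Z v) + Z' v"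
    and PZ: "\<And>v. P (Z v) = Z (P v)" and PZ': "\<And>v. P (Z' v) = Z' (P v)" and ZZ': "\<And>v. Z (Z' v) = Z' (Z v)"
    and nil: "\<And>v. (P ^^ Suc k) ((Z ^^ s) v) = 0"
  shows "(P ^^ k) ((Z ^^ (s + 2)) v) = 0"
proof -
  have shift: "(Z ^^ s) (Z u) = Z ((Z ^^ s) u)" for u by (simp add: funpow_swap1)
  have cor: "(P ^^ Suc k) ((Z ^^ s) (Y (Z v))) = (P ^^ Suc k) (Y ((Z ^^ s) (Z v)))"
  proof (cases s)
    case (Suc t)
    have "(Z ^^ s) (Y (Z v)) = Y ((Z ^^ s) (Z v)) + of_nat s *\<^sub>C Z' ((Z ^^ t) (Z v))"
      unfolding Suc by (rule funpow_commutator) (use assms in auto)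
    also have "(Z ^^ t) (Z v) = (Z ^^ s) v" by (simp add: Suc funpow_swap1)
    finally have "(P ^^ Suc k) ((Z ^^ s) (Y (Z v)))
        = (P ^^ Suc k) (Y ((Z ^^ s) (Z v))) + of_nat s *\<^sub>C (P ^^ Suc k) (Z' ((Z ^^ s) v))"
      using clinear_funpow[OF P, of "Suc k"] unfolding clinear_iff by metis
    also have "(P ^^ Suc k) (Z' ((Z ^^ s) v)) = Z' ((P ^^ Suc k) ((Z ^^ s) v))"
      by (rule funpow_commutes) (rule PZ')
    also have "\<dots> = 0" unfolding nil by (rule clinear_0[OF Z'])
    finally show ?thesis by simp
  qed simp
  have "0 = (P ^^ Suc k) ((Z ^^ s) (Y (Z v)))" by (simp only: nil)
  also have "\<dots> = Y ((P ^^ Suc k) ((Z ^^ s) (Z v))) + of_nat (Suc k) *\<^sub>C Z ((P ^^ k) ((Z ^^ s) (Z v)))"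
    unfolding cor by (rule funpow_commutator) (use assms in auto)
  also have "\<dots> = of_nat (Suc k) *\<^sub>C Z ((P ^^ k) ((Z ^^ s) (Z v)))"
    by (simp only: nil clinear_0[OF Y] add_0)
  finally have "Z ((P ^^ k) ((Z ^^ s) (Z v))) = 0" using of_nat_neq_0[of k, where 'a = complex]
    by (metis complex_vector.scale_eq_0_iff)
  then have "(P ^^ k) (Z ((Z ^^ s) (Z v))) = 0" by (simp only: funpow_commutes[of P Z, OF PZ])
  then show ?thesis by (simp add: shift)
qed

lemma nilpotent_commutator:
  fixes P Y Z Z' :: "'v::complex_vector \<Rightarrow> 'v"
  assumes "clinear P" "clinear Z" "clinear Y" "clinear Z'"
    and "\<And>v. P (Y v) = Y (P v) + Z v" and "\<And>v. Z (Y v) = Y (Z v) + Z' v"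
    and "\<And>v. P (Z v) = Z (P v)" and "\<And>v. P (Z' v) = Z' (P v)" and "\<And>v. Z (Z' v) = Z' (Z v)"
    and "\<And>v. (P ^^ k) v = 0"
  shows "(Z ^^ (2 * k)) v = 0"
proof -
  have "(\<And>v. (P ^^ k) ((Z ^^ s) v) = 0) \<Longrightarrow> (Z ^^ (s + 2 * k)) v = 0" for s
  proof (induction k arbitrary: s)
    case (Suc k)
    have "(Z ^^ (s + 2 + 2 * k)) v = 0"
      by (rule Suc.IH) (rule nilpotent_commutator_step[OF assms(1-9) Suc.prems])
    then show ?case by (simp add: algebra_simps)
  qed simp
  from this[of 0] show ?thesis using assms(10) by simp
qed

section \<open>Bounded irreducible modules and their annihilator\<close>

text \<open>
  From here on a module is given by the operators \<open>a m i b\<close> by which the elements \<open>t\<^sup>m d\<^sub>i \<otimes> b\<close> act.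
\<close>

definition weight_vectors ::
    "(int ^ 'n \<Rightarrow> 'n::finite \<Rightarrow> 'b::complex_comm_algebra \<Rightarrow> 'v::complex_vector \<Rightarrow> 'v) \<Rightarrow> complex ^ 'n \<Rightarrow> 'v set"
  where "weight_vectors a \<mu> = {v. \<forall>i. a 0 i 1 v = (\<mu> $ i) *\<^sub>C v}"

text \<open>
  Irreducibility and generation by weight vectors are stated as induction rules, since the proofs apply them
  to sets of vectors cut out by linear conditions.
\<close>

locale bounded_irreducible_current_module =
  fixes a :: "int ^ 'n \<Rightarrow> 'n::finite \<Rightarrow> 'b::complex_comm_algebra \<Rightarrow> 'v::complex_vector \<Rightarrow> 'v"
    and N :: nat
  assumes lin: "clinear (a m i b)"
    and lin_coeff: "clinear (\<lambda>b. a m i b v)"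
    and comm: "a m i b (a k j c v) = a k j c (a m i b v)
      + (of_int (k $ i) *\<^sub>C a (m + k) j (b * c) v - of_int (m $ j) *\<^sub>C a (m + k) i (b * c) v)"
    and irreducible: "complex_vector.subspace U \<Longrightarrow> (\<And>m i b u. u \<in> U \<Longrightarrow> a m i b u \<in> U) \<Longrightarrow>
      u \<in> U \<Longrightarrow> u \<noteq> 0 \<Longrightarrow> v \<in> U"
    and nonzero: "\<exists>v :: 'v. v \<noteq> 0"
    and weights_span: "complex_vector.subspace U \<Longrightarrow> (\<And>\<mu>. weight_vectors a \<mu> \<subseteq> U) \<Longrightarrow> v \<in> U"
    and bounded: "\<exists>X. finite X \<and> complex_vector.independent X \<and>
      complex_vector.span X = weight_vectors a \<mu> \<and> card X \<le> N"
begin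

lemma a_0 [simp]: "a m i b 0 = 0"
  by (rule clinear_0[OF lin])

lemma a_scale: "a m i b (c *\<^sub>C v) = c *\<^sub>C a m i b v"
  using lin[of m i b] by (simp add: clinear_iff)

lemma a_coeff_scale: "a m i (c *\<^sub>C b) v = c *\<^sub>C a m i b v"
  using lin_coeff[of m i v] by (simp add: clinear_iff)

lemma a_coeff_add: "a m i (b + c) v = a m i b v + a m i c v"
  using lin_coeff[of m i v] by (simp add: clinear_iff)

lemma a_coeff_diff: "a m i (b - c) v = a m i b v - a m i c v"
  by (rule clinear_diff[OF lin_coeff])

lemma comm_cartan: "a m i b (a 0 j c v) = a 0 j c (a m i b v) - of_int (m $ j) *\<^sub>C a m i (b * c) v"
  using comm[of m i b 0 j c v] by simp

text \<open>
  The relation of \<open>sl\<^sub>2\<close> type for \<open>t\<^sup>m d\<^sub>j\<close> and \<open>t\<^sup>-\<^sup>m d\<^sub>j\<close>. It carries statements about \<open>m \<noteq> 0\<close> over to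
  the Cartan elements.
\<close>

lemma comm_opposite:
  "a m j b (a (- m) j c v) = a (- m) j c (a m j b v) - of_int (2 * m $ j) *\<^sub>C a 0 j (b * c) v"
proof -
  have "of_int (- m $ j) *\<^sub>C x - of_int (m $ j) *\<^sub>C x = - (of_int (2 * m $ j) *\<^sub>C x)" for x :: 'v
    by (simp add: complex_vector.scale_left_diff_distrib[symmetric] flip: complex_vector.scale_minus_left)
  then show ?thesis using comm[of m j b "- m" j c v] by simp
qed

definition annihilator :: "'b set"
  where "annihilator = {b. \<forall>m i v. a m i b v = 0}"

lemma annihilator_ideal: "algebra_ideal annihilator"
proof (rule algebra_idealI)
  show "0 \<in> annihilator" by (simp add: annihilator_def clinear_0[OF lin_coeff])
  show "x + y \<in> annihilator" if "x \<in> annihilator" "y \<in> annihilator" for x y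
    using that by (simp add: annihilator_def a_coeff_add)
  show "c *\<^sub>C x \<in> annihilator" if "x \<in> annihilator" for c x
    using that by (simp add: annihilator_def a_coeff_scale)
  fix x b assume b: "b \<in> annihilator"
  have "a m i (x * b) v = 0" for m i v
  proof (cases "m = 0")
    case False
    then obtain j where "m $ j \<noteq> 0" by (auto simp: vec_eq_iff)
    then show ?thesis using comm_cartan[of m i b j x v] b
      by (simp add: annihilator_def mult.commute)
  next
    case True
    then show ?thesis using comm_opposite[of "axis i 1" i b x v] b
      by (simp add: annihilator_def mult.commute axis_def)
  qed
  then show "x * b \<in> annihilator" by (simp add: annihilator_def)
qed

lemma annihilator_cong: "b - c \<in> annihilator \<Longrightarrow> a m i b v = a m i c v"
  using a_coeff_diff[of m i b c v] by (simp add: annihilator_def)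

text \<open>
  The vectors killed by \<open>W \<otimes> bB\<close> form a submodule, because \<open>W \<otimes> bB\<close> is an ideal of \<open>W \<otimes> B\<close>. By
  irreducibility one nonzero vector is enough.
\<close>

lemma annihilatorI:
  assumes "v \<noteq> 0" and v: "\<And>m i c. a m i (b * c) v = 0"
  shows "b \<in> annihilator"
proof -
  let ?U = "{v. \<forall>m i c. a m i (b * c) v = 0}"
  have "u \<in> ?U" for u
  proof (rule irreducible[of ?U v])
    show "complex_vector.subspace ?U"
      using lin by (auto simp: complex_vector.subspace_def clinear_iff)
    show "a k j d u \<in> ?U" if "u \<in> ?U" for k j d u
      using that comm[of _ _ _ k j d u] by (simp add: mult.assoc)
  qed (use assms in auto)
  then have "a m i (b * 1) u = 0" for m i u by blast
  then show ?thesis by (simp add: annihilator_def)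
qed

lemma weight_vectors_subspace: "complex_vector.subspace (weight_vectors a \<mu>)"
  using lin by (auto simp: weight_vectors_def complex_vector.subspace_def clinear_iff scaleC_add_right
      mult.commute)

lemma weight_vectors_shift:
  assumes "v \<in> weight_vectors a \<mu>"
  shows "a m i b v \<in> weight_vectors a (\<chi> j. \<mu> $ j + of_int (m $ j))"
proof -
  have "a 0 j 1 (a m i b v) = a m i b (a 0 j 1 v) + of_int (m $ j) *\<^sub>C a m i b v" for j
    using comm_cartan[of m i b j 1 v] by simp
  then show ?thesis using assms by (simp add: weight_vectors_def a_scale scaleC_add_left)
qed

lemma weight_vectors_cartan: "v \<in> weight_vectors a \<mu> \<Longrightarrow> a 0 i b v \<in> weight_vectors a \<mu>"
  using weight_vectors_shift[of v \<mu> 0 i b] by (simp add: vec_lambda_eta)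

lemma rel_dim_le_weight_vectors: "rel_dim_le N {0} (weight_vectors a \<mu>)"
  using bounded[of \<mu>] rel_dim_le_span by metis

lemma weight_exists: "\<exists>\<mu>. \<exists>v\<in>weight_vectors a \<mu>. v \<noteq> 0"
proof (rule ccontr)
  assume "\<not> ?thesis"
  then have "weight_vectors a \<mu> \<subseteq> {0}" for \<mu> by blast
  then have "v \<in> {0}" for v :: 'v by (intro weights_span complex_vector.subspace_single_0)
  with nonzero show False by blast
qed

section \<open>A socle element of the coefficient algebra modulo the annihilator\<close>

lemma finite_box: "finite {m :: int ^ 'n. \<forall>i. \<bar>m $ i\<bar> \<le> 2}"
proof -
  have "{m :: int ^ 'n. \<forall>i. \<bar>m $ i\<bar> \<le> 2} \<subseteq> vec_lambda ` (UNIV \<rightarrow>\<^sub>E {-2..2})"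
  proof
    fix m :: "int ^ 'n" assume m: "m \<in> {m. \<forall>i. \<bar>m $ i\<bar> \<le> 2}"
    have "- 2 \<le> m $ i \<and> m $ i \<le> 2" for i
    proof -
      have "\<bar>m $ i\<bar> \<le> 2" using m by simp
      then show ?thesis by linarith
    qed
    then have "vec_nth m \<in> UNIV \<rightarrow>\<^sub>E {-2..2}" by (simp add: PiE_iff)
    then show "m \<in> vec_lambda ` (UNIV \<rightarrow>\<^sub>E {-2..2})" by (metis image_eqI vec_lambda_eta)
  qed
  then show ?thesis by (rule finite_subset) (intro finite_imageI finite_PiE; simp)
qed

definition weight_annihilator :: "complex ^ 'n \<Rightarrow> int ^ 'n \<Rightarrow> 'n \<Rightarrow> 'b set"
  where "weight_annihilator \<mu> m i = {b. \<forall>v\<in>weight_vectors a \<mu>. a m i b v = 0}"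

lemma weight_annihilator_subspace: "complex_vector.subspace (weight_annihilator \<mu> m i)"
  by (auto simp: weight_annihilator_def complex_vector.subspace_def a_coeff_add a_coeff_scale
      clinear_0[OF lin_coeff])

text \<open>
  Commuting \<open>t\<^sup>m d\<^sub>i \<otimes> b\<close> with \<open>d\<^sub>j \<otimes> x\<close>, which preserves weight spaces, gives \<open>- m\<^sub>j t\<^sup>m d\<^sub>i \<otimes> bx\<close>; some
  \<open>m\<^sub>j\<close> is nonzero.
\<close>

lemma weight_annihilator_ideal:
  assumes "m \<noteq> 0"
  shows "algebra_ideal (weight_annihilator \<mu> m i)"
  unfolding algebra_ideal_def
proof (intro conjI allI ballI)
  show "complex_vector.subspace (weight_annihilator \<mu> m i)" by (rule weight_annihilator_subspace)
  fix x b assume b: "b \<in> weight_annihilator \<mu> m i"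
  obtain j where j: "m $ j \<noteq> 0" using assms by (auto simp: vec_eq_iff)
  show "x * b \<in> weight_annihilator \<mu> m i"
    unfolding weight_annihilator_def
  proof (rule CollectI, rule ballI)
    fix v assume v: "v \<in> weight_vectors a \<mu>"
    with b have "a m i b v = 0" "a m i b (a 0 j x v) = 0"
      using weight_vectors_cartan by (auto simp: weight_annihilator_def)
    then show "a m i (x * b) v = 0" using comm_cartan[of m i b j x v] j by (simp add: mult.commute)
  qed
qed

text \<open>
  The operators \<open>t\<^sup>m d\<^sub>i \<otimes> b\<close> map one space of dimension at most \<open>N\<close> to another, so the codimension \<open>r\<close> can
  be chosen independently of \<open>m\<close> and \<open>i\<close>.
\<close>

lemma weight_annihilator_rel_dim:
  assumes "finite F"
  shows "\<exists>d. rel_dim_le d (\<Inter>(m, i)\<in>F. weight_annihilator \<mu> m i) UNIV"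
    and "\<exists>r. \<forall>m i. rel_dim_le r (weight_annihilator \<mu> m i) UNIV"
proof -
  obtain X where X: "finite X" "complex_vector.span X = weight_vectors a \<mu>" using bounded by metis
  obtain Y where Y: "\<And>\<nu>. finite (Y \<nu>) \<and> complex_vector.independent (Y \<nu>) \<and> card (Y \<nu>) \<le> N"
    "\<And>\<nu>. complex_vector.span (Y \<nu>) = weight_vectors a \<nu>" using bounded by metis
  have eq: "weight_annihilator \<mu> m i = {b. \<forall>x\<in>X. a m i b x = 0}" for m i
  proof -
    have "a m i b v = 0" if "\<forall>x\<in>X. a m i b x = 0" "v \<in> weight_vectors a \<mu>" for b v
    proof -
      have "v \<in> complex_vector.span X" using that X by simp
      then show ?thesis
      proof (induction rule: complex_vector.span_induct_alt)
        case (step c x y)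
        then show ?case using that(1) lin[of m i b] by (simp add: clinear_iff)
      qed simp
    qed
    moreover have "X \<subseteq> weight_vectors a \<mu>" using X complex_vector.span_superset by metis
    ultimately show ?thesis by (auto simp: weight_annihilator_def)
  qed
  define T where "T = (\<lambda>e b. a (fst (fst e)) (snd (fst e)) b (snd e))"
  define Y' where "Y' = (\<lambda>e :: ((int ^ 'n) \<times> 'n) \<times> 'v. Y (\<chi> j. \<mu> $ j + of_int (fst (fst e) $ j)))"
  have rd: "rel_dim_le (card (F' \<times> X) * N) {b. \<forall>e\<in>F' \<times> X. T e b = 0} UNIV" if "finite F'" for F'
  proof (rule rel_dim_le_common_kernel[where Y = Y'])
    fix e b assume "e \<in> F' \<times> X"
    then have "snd e \<in> weight_vectors a \<mu>" using X complex_vector.span_superset by fastforce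
    then show "T e b \<in> complex_vector.span (Y' e)"
      using weight_vectors_shift by (simp add: T_def Y'_def Y)
  next
    show "clinear (T e)" for e unfolding T_def by (rule lin_coeff)
    show "finite (Y' e) \<and> complex_vector.independent (Y' e) \<and> card (Y' e) \<le> N" for e
      unfolding Y'_def by (rule Y(1))
  qed (use that X in simp)
  have "(\<Inter>(m, i)\<in>F. weight_annihilator \<mu> m i) = {b. \<forall>e\<in>F \<times> X. T e b = 0}"
    by (force simp: eq T_def)
  with rd[OF assms] show "\<exists>d. rel_dim_le d (\<Inter>(m, i)\<in>F. weight_annihilator \<mu> m i) UNIV" by metis
  have "weight_annihilator \<mu> m i = {b. \<forall>e\<in>{(m, i)} \<times> X. T e b = 0}" for m i
    by (auto simp: eq T_def)
  then have "rel_dim_le (card X * N) (weight_annihilator \<mu> m i) UNIV" for m i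
    using rd[of "{(m, i)}"] by (simp add: card_cartesian_product_singleton)
  then show "\<exists>r. \<forall>m i. rel_dim_le r (weight_annihilator \<mu> m i) UNIV" by blast
qed

lemma weight_annihilator_bracket:
  assumes "b \<in> weight_annihilator \<mu> m i" "c \<in> weight_annihilator \<mu> k j" "v \<in> weight_vectors a \<mu>"
  shows "of_int (k $ i) *\<^sub>C a (m + k) j (b * c) v = of_int (m $ j) *\<^sub>C a (m + k) i (b * c) v"
  using assms comm[of m i b k j c v] by (simp add: weight_annihilator_def)

lemma foldr_mult_append: "foldr (*) (qs @ rs) c = foldr (*) qs 1 * foldr (*) rs (c :: 'b)"
  by (induction qs) (simp_all add: mult.assoc)

lemma foldr_mult_right: "foldr (*) qs c * d = foldr (*) qs (c * d :: 'b)"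
  by (induction qs) (simp_all add: mult.assoc)

text \<open>
  Induction on the size of \<open>p\<close>. The bracket of \<open>t\<^sup>s\<^sup>u d\<^sub>i\<close>, where \<open>u\<close> is the \<open>i\<close>-th unit vector and \<open>s\<close> is a
  sign, with \<open>t\<^sup>p\<^sup>' d\<^sub>j\<close> is a multiple of \<open>t\<^sup>s\<^sup>u\<^sup>+\<^sup>p\<^sup>' d\<^sub>j\<close> with coefficient \<open>p'\<^sub>i\<close> if \<open>j \<noteq> i\<close> and
  \<open>p'\<^sub>i - s\<close> if \<open>j = i\<close>. This coefficient is nonzero when \<open>p'\<^sub>i\<close> is at least \<open>2\<close> in absolute value, which is
  why entries up to \<open>2\<close> suffice for the generators. Each bracket costs one more factor from \<open>Q\<close>.
\<close>

lemma words_annihilate: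
  assumes Q: "Q = (\<Inter>(m, i)\<in>{m. m \<noteq> 0 \<and> (\<forall>i. \<bar>m $ i\<bar> \<le> 2)} \<times> UNIV. weight_annihilator \<mu> m i)"
  shows "\<exists>k. \<forall>qs c. set qs \<subseteq> Q \<longrightarrow> length qs = k \<longrightarrow> foldr (*) qs c \<in> weight_annihilator \<mu> p j"
proof (induction "nat (\<Sum>i\<in>UNIV. \<bar>p $ i\<bar>)" arbitrary: p j rule: less_induct)
  case less
  let ?W = "\<lambda>k p j. \<forall>qs c. set qs \<subseteq> Q \<longrightarrow> length qs = k \<longrightarrow> foldr (*) qs c \<in> weight_annihilator \<mu> p j"
  have small: "?W 1 m i" if "m \<noteq> 0" "\<forall>i. \<bar>m $ i\<bar> \<le> 2" for m i
  proof (intro allI impI)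
    fix qs c assume qs: "set qs \<subseteq> Q" "length qs = 1"
    then obtain q where q: "qs = [q]" by (auto simp: length_Suc_conv)
    with qs that have "q \<in> weight_annihilator \<mu> m i" by (auto simp: Q)
    then have "c * q \<in> weight_annihilator \<mu> m i"
      using weight_annihilator_ideal[OF that(1)] algebra_ideal_mult by blast
    then show "foldr (*) qs c \<in> weight_annihilator \<mu> m i" by (simp add: q mult.commute)
  qed
  have step: "?W (1 + k) (axis i s + p') j"
    if s: "\<bar>s\<bar> = 1" and k: "?W k p' j" and nz: "p' $ i - (if j = i then s else 0) \<noteq> 0" for i s p' k
  proof (intro allI impI)
    fix qs c assume qs: "set qs \<subseteq> Q" "length qs = 1 + k"
    then obtain q rs where q: "qs = [q] @ rs" "set rs \<subseteq> Q" "length rs = k" by (cases qs) auto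
    have "axis i s \<noteq> 0" using s by (auto simp: axis_eq_0_iff)
    moreover have "\<forall>l. \<bar>axis i s $ l\<bar> \<le> 2" using s by (simp add: axis_def)
    ultimately have "foldr (*) [q] 1 \<in> weight_annihilator \<mu> (axis i s) i"
      using small[of "axis i s" i] qs q by (simp del: foldr.simps)
    moreover have "foldr (*) rs c \<in> weight_annihilator \<mu> p' j" using k q by blast
    ultimately have "of_int (p' $ i) *\<^sub>C a (axis i s + p') j (foldr (*) qs c) v
        = of_int (axis i s $ j) *\<^sub>C a (axis i s + p') i (foldr (*) qs c) v" if "v \<in> weight_vectors a \<mu>" for v
      using weight_annihilator_bracket[OF _ _ that] unfolding q(1) foldr_mult_append by blast
    then have "(of_int (p' $ i - (if j = i then s else 0)) :: complex) *\<^sub>C a (axis i s + p') j (foldr (*) qs c) v = 0"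
      if "v \<in> weight_vectors a \<mu>" for v
      using that by (cases "j = i") (auto simp: axis_def complex_vector.scale_left_diff_distrib)
    then show "foldr (*) qs c \<in> weight_annihilator \<mu> (axis i s + p') j"
      using nz by (auto simp: weight_annihilator_def simp del: of_int_diff)
  qed
  show ?case
  proof (cases "\<forall>i. \<bar>p $ i\<bar> \<le> 2")
    case True
    show ?thesis
    proof (cases "p = 0")
      case False
      with True small show ?thesis by blast
    next
      case p: True
      have "?W 1 (axis j (- 1)) j" by (rule small) (simp add: axis_eq_0_iff, simp add: axis_def)
      then have "?W (1 + 1) (axis j 1 + axis j (- 1)) j" by (rule step[rotated]) (auto simp: axis_def)
      moreover have "axis j 1 + axis j (- 1) = p" by (simp add: p axis_def vec_eq_iff)
      ultimately show ?thesis by metis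
    qed
  next
    case False
    then obtain i where i: "\<bar>p $ i\<bar> > 2" by (auto simp: not_le)
    define s where "s = sgn (p $ i)"
    define p' where "p' = p - axis i s"
    have s: "\<bar>s\<bar> = 1" and pi: "\<bar>p $ i - s\<bar> = \<bar>p $ i\<bar> - 1" using i by (auto simp: s_def sgn_if)
    have "(\<Sum>l\<in>UNIV. \<bar>p' $ l\<bar>) < (\<Sum>l\<in>UNIV. \<bar>p $ l\<bar>)"
    proof (rule sum_strict_mono_ex1)
      show "\<forall>l\<in>UNIV. \<bar>p' $ l\<bar> \<le> \<bar>p $ l\<bar>" using pi by (auto simp: p'_def axis_def)
      show "\<exists>l\<in>UNIV. \<bar>p' $ l\<bar> < \<bar>p $ l\<bar>" using pi by (intro bexI[of _ i]) (auto simp: p'_def axis_def)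
    qed simp
    then have "nat (\<Sum>l\<in>UNIV. \<bar>p' $ l\<bar>) < nat (\<Sum>l\<in>UNIV. \<bar>p $ l\<bar>)"
      by (subst nat_less_eq_zless) (rule sum_nonneg, simp)
    from less[OF this, of j] obtain k where k: "?W k p' j" by blast
    have "?W (1 + k) (axis i s + p') j"
      by (rule step[OF s k]) (use i in \<open>auto simp: p'_def axis_def s_def sgn_if\<close>)
    then show ?thesis by (auto simp: p'_def)
  qed
qed

text \<open>
  The length of the words in \<open>Q\<close> that kill \<open>t\<^sup>m d\<^sub>i\<close> on the chosen weight space grows with \<open>m\<close> at first, but
  \<open>locally_nilpotent_uniform\<close> replaces it by the uniform codimension \<open>r\<close>.
\<close>

lemma annihilator_socle:
  assumes "1 \<notin> annihilator"
  shows "\<exists>b \<eta>. b \<notin> annihilator \<and> algebra_hom \<eta> \<and> (\<forall>x. x * b - \<eta> x *\<^sub>C b \<in> annihilator)"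
proof -
  obtain \<mu> v0 where v0: "v0 \<in> weight_vectors a \<mu>" "v0 \<noteq> 0" using weight_exists by blast
  define F where "F = {m :: int ^ 'n. m \<noteq> 0 \<and> (\<forall>i. \<bar>m $ i\<bar> \<le> 2)} \<times> (UNIV :: 'n set)"
  define Q where "Q = (\<Inter>(m, i)\<in>F. weight_annihilator \<mu> m i)"
  have "finite F" unfolding F_def
    by (intro finite_cartesian_product finite_subset[OF _ finite_box]) auto
  then obtain d r where d: "rel_dim_le d Q UNIV" and r: "\<And>m i. rel_dim_le r (weight_annihilator \<mu> m i) UNIV"
    unfolding Q_def using weight_annihilator_rel_dim[of F \<mu>] by metis
  have nil: "\<exists>k. \<forall>qs c. set qs \<subseteq> Q \<longrightarrow> length qs = k \<longrightarrow> foldr (*) qs c \<in> weight_annihilator \<mu> m i" for m i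
    by (rule words_annihilate) (simp add: Q_def F_def)
  have mult: "clinear ((*) x)" for x :: 'b by (simp add: clinear_iff distrib_left scaleC_mult_right)
  have words: "foldr (*) qs c \<in> weight_annihilator \<mu> m i" if "set qs \<subseteq> Q" "length qs = r" "m \<noteq> 0" for qs c m i
  proof (rule locally_nilpotent_uniform[OF r weight_annihilator_subspace mult])
    show "\<exists>k. \<forall>ws. set ws \<subseteq> Q \<longrightarrow> length ws = k \<longrightarrow> foldr (*) ws u \<in> weight_annihilator \<mu> m i" for u
      using nil[of m i] by blast
    show "q * u \<in> weight_annihilator \<mu> m i" if "u \<in> weight_annihilator \<mu> m i" for q u
      using weight_annihilator_ideal[OF \<open>m \<noteq> 0\<close>] that algebra_ideal_mult by blast
  qed (use that in auto)
  have words2: "foldr (*) qs c \<in> weight_annihilator \<mu> m i" if qs: "set qs \<subseteq> Q" "length qs = r + r" for qs c m i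
  proof -
    define q1 q2 where "q1 = take r qs" and "q2 = drop r qs"
    have q: "qs = q1 @ q2" "length q1 = r" "length q2 = r" using qs by (auto simp: q1_def q2_def)
    then have sub: "set q1 \<subseteq> Q" "set q2 \<subseteq> Q" using qs by auto
    show ?thesis
    proof (cases "m = 0")
      case False
      have "foldr (*) q1 (foldr (*) q2 c) \<in> weight_annihilator \<mu> m i" by (rule words) (use q sub False in auto)
      then show ?thesis by (simp add: q)
    next
      case True
      have "foldr (*) q1 1 \<in> weight_annihilator \<mu> (axis i 1) i"
        "foldr (*) q2 c \<in> weight_annihilator \<mu> (axis i (- 1)) i"
        by (rule words; use q sub in \<open>auto simp: axis_eq_0_iff\<close>)+
      note br = weight_annihilator_bracket[OF this]
      have opp: "axis i 1 + axis i (- 1) = (0 :: int ^ 'n)" by (simp add: axis_def vec_eq_iff)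
      have "a 0 i (foldr (*) qs c) v = 0" if v: "v \<in> weight_vectors a \<mu>" for v
      proof (rule eq_neg_self_imp_zero)
        have "of_int (axis i (- 1) $ i) *\<^sub>C a 0 i (foldr (*) qs c) v
            = of_int ((axis i 1 :: int ^ 'n) $ i) *\<^sub>C a 0 i (foldr (*) qs c) v"
          using br[OF v] unfolding q(1) foldr_mult_append opp .
        then show "a 0 i (foldr (*) qs c) v = - a 0 i (foldr (*) qs c) v" by (simp add: axis_def)
      qed
      then show ?thesis by (simp add: weight_annihilator_def True)
    qed
  qed
  have "foldr (*) qs 1 \<in> annihilator" if "set qs \<subseteq> Q" "length qs = r + r" for qs
  proof (rule annihilatorI[OF v0(2)])
    fix m i c
    show "a m i (foldr (*) qs 1 * c) v0 = 0"
      using words2[OF that, of "1 * c" m i] v0(1) unfolding foldr_mult_right by (simp add: weight_annihilator_def)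
  qed
  then obtain w where w: "w \<notin> annihilator" "\<And>q. q \<in> Q \<Longrightarrow> q * w \<in> annihilator"
    using last_word_outside[of Q "r + r" "(*)" 1 annihilator] assms by blast
  define K where "K = {x. x * w \<in> annihilator}"
  note ideal = annihilator_ideal
  have K: "algebra_ideal K"
    by (rule algebra_idealI)
      (auto simp: K_def distrib_right scaleC_mult_left mult.assoc algebra_ideal_0[OF ideal]
        intro: algebra_ideal_add[OF ideal] algebra_ideal_scale[OF ideal] algebra_ideal_mult[OF ideal])
  have "Q \<subseteq> K" using w by (auto simp: K_def)
  then have "rel_dim_le d K UNIV" by (rule rel_dim_le_superset[OF d])
  then have "\<exists>u\<in>UNIV. u \<notin> K \<and> (\<forall>x\<in>UNIV. \<exists>c. x * u - c *\<^sub>C u \<in> K)"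
  proof (rule common_eigenvector)
    have "1 \<notin> K" using w(1) by (simp add: K_def)
    then show "\<not> UNIV \<subseteq> K" by blast
  qed (use K mult in \<open>auto simp: algebra_ideal_def mult.left_commute\<close>)
  then obtain u where u1: "u \<notin> K" "\<forall>x. \<exists>c. x * u - c *\<^sub>C u \<in> K" by blast
  then obtain \<eta> where u2: "\<And>x. x * u - \<eta> x *\<^sub>C u \<in> K" by metis
  note u = u1(1) u2
  define b where "b = u * w"
  have b: "b \<notin> annihilator" "\<And>x. x * b - \<eta> x *\<^sub>C b \<in> annihilator"
    using u by (simp_all add: K_def b_def left_diff_distrib scaleC_mult_left mult.assoc)
  have "algebra_hom \<eta>"
  proof (rule algebra_hom_of_codim_one_ideal[of "{x. x * b \<in> annihilator}"])
    show "algebra_ideal {x. x * b \<in> annihilator}"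
      by (rule algebra_idealI)
        (auto simp: distrib_right scaleC_mult_left mult.assoc algebra_ideal_0[OF ideal]
          intro: algebra_ideal_add[OF ideal] algebra_ideal_scale[OF ideal] algebra_ideal_mult[OF ideal])
  qed (use b in \<open>auto simp: left_diff_distrib scaleC_mult_left\<close>)
  with b show ?thesis by blast
qed

section \<open>The socle element is not nilpotent\<close>

text \<open>
  If \<open>\<eta> b = 0\<close>, then \<open>b\<^sup>2\<close> lies in the annihilator, so the operators \<open>a m i b\<close> commute with each other;
  their commutators with any \<open>a m i c\<close> stay in their span. Through nilpotency of the operators
  \<open>a 0 j b\<close> the proof finds a nonzero vector killed by all \<open>a m i b\<close>.
\<close>

lemma socle_eigenvalue_nonzero:
  assumes b: "b \<notin> annihilator" and \<eta>: "\<And>x. x * b - \<eta> x *\<^sub>C b \<in> annihilator"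
  shows "\<eta> b \<noteq> 0"
proof
  assume sq: "\<eta> b = 0"
  obtain \<gamma> :: "'n \<Rightarrow> complex" where \<gamma>: "\<And>m :: int ^ 'n. m \<noteq> 0 \<Longrightarrow> (\<Sum>j\<in>UNIV. \<gamma> j * of_int (m $ j)) \<noteq> 0"
    using generic_vector_exists by blast
  define g where "g m = (\<Sum>j\<in>UNIV. \<gamma> j * of_int (m $ j))" for m :: "int ^ 'n"
  define h where "h v = (\<Sum>j\<in>UNIV. \<gamma> j *\<^sub>C a 0 j b v)" for v
  have eta: "a m i (c * b) v = \<eta> c *\<^sub>C a m i b v" for m i c v
    using annihilator_cong[OF \<eta>[of c]] by (simp add: a_coeff_scale)
  have abelian: "a m i b (a k j b v) = a k j b (a m i b v)" for m i k j v
    using comm[of m i b k j b v] by (simp add: eta sq)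
  have linh: "clinear h"
    by (auto simp: h_def clinear_iff clinear_iff[THEN iffD1, OF lin] scaleC_add_right sum.distrib
        complex_vector.scale_sum_right mult.commute)
  have comm_h: "h (a m i c v) = a m i c (h v) + (g m * \<eta> c) *\<^sub>C a m i b v" for m i c v
  proof -
    have "h (a m i c v) = (\<Sum>j\<in>UNIV. \<gamma> j *\<^sub>C a m i c (a 0 j b v) + (\<gamma> j * of_int (m $ j) * \<eta> c) *\<^sub>C a m i b v)"
      unfolding h_def
    proof (rule sum.cong[OF refl])
      fix j
      have "a 0 j b (a m i c v) = a m i c (a 0 j b v) + (of_int (m $ j) * \<eta> c) *\<^sub>C a m i b v"
        using comm_cartan[of m i c j b v] by (simp add: eta)
      then show "\<gamma> j *\<^sub>C a 0 j b (a m i c v)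
          = \<gamma> j *\<^sub>C a m i c (a 0 j b v) + (\<gamma> j * of_int (m $ j) * \<eta> c) *\<^sub>C a m i b v"
        by (simp add: scaleC_add_right mult.assoc)
    qed
    also have "\<dots> = a m i c (h v) + (g m * \<eta> c) *\<^sub>C a m i b v"
      by (simp add: sum.distrib h_def g_def clinear_sum[OF lin] a_scale
          complex_vector.scale_sum_left sum_distrib_right)
    finally show ?thesis .
  qed
  (* Commuting with W (x) B moves h within an abelian ideal, so its generalized eigenspace is a submodule. *)
  obtain \<mu> w where w: "w \<in> weight_vectors a \<mu>" "w \<noteq> 0" using weight_exists by blast
  have h_wt: "h v \<in> weight_vectors a \<nu>" if "v \<in> weight_vectors a \<nu>" for v \<nu>
    unfolding h_def
    by (intro complex_vector.subspace_sum complex_vector.subspace_scale weight_vectors_subspace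
        weight_vectors_cartan that)
  obtain u \<kappa> where u: "u \<noteq> 0" "h u = \<kappa> *\<^sub>C u"
    using eigenvector_mod_subspace[OF linh complex_vector.subspace_single_0 rel_dim_le_weight_vectors
        h_wt weight_vectors_subspace w(1)] w(2) by auto
  define P where "P v = h v - \<kappa> *\<^sub>C v" for v
  have linP: "clinear P"
    using linh by (auto simp: P_def clinear_iff algebra_simps scaleC_add_right
          complex_vector.scale_right_diff_distrib)
  have comm_P: "P (a m i c v) = a m i c (P v) + (g m * \<eta> c) *\<^sub>C a m i b v" for m i c v
    by (simp add: P_def comm_h clinear_diff[OF lin] a_scale)
  have comm_Pb: "P (a m i b v) = a m i b (P v)" for m i v using comm_P[of m i b v] by (simp add: sq)
  have lin_scale: "clinear (\<lambda>v. c *\<^sub>C a m i b v)" for c m i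
    using lin[of m i b] by (simp add: clinear_iff scaleC_add_right mult.commute)
  have P_scale: "P (c *\<^sub>C v) = c *\<^sub>C P v" for c v using linP by (simp add: clinear_iff)
  have comm_pow: "(P ^^ Suc k) (a m i c v)
      = a m i c ((P ^^ Suc k) v) + of_nat (Suc k) *\<^sub>C (g m * \<eta> c) *\<^sub>C a m i b ((P ^^ k) v)" for k m i c v
    by (rule funpow_commutator[where P = P and Y = "a m i c" and Z = "\<lambda>v. (g m * \<eta> c) *\<^sub>C a m i b v"])
      (rule linP lin_scale comm_P | simp only: P_scale comm_Pb)+
  have loc_nil: "\<exists>k. (P ^^ k) v = 0" for v
  proof -
    have "v \<in> {v. \<exists>k. (P ^^ k) v = 0}"
    proof (rule irreducible)
      show "complex_vector.subspace {v. \<exists>k. (P ^^ k) v = 0}"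
      proof (rule complex_vector.subspaceI)
        show "0 \<in> {v. \<exists>k. (P ^^ k) v = 0}" by (intro CollectI exI[of _ 0]) simp
      next
        fix x y assume "x \<in> {v. \<exists>k. (P ^^ k) v = 0}" "y \<in> {v. \<exists>k. (P ^^ k) v = 0}"
        then obtain k l where "(P ^^ k) x = 0" "(P ^^ l) y = 0" by blast
        then have "(P ^^ (max k l)) x = 0" "(P ^^ (max k l)) y = 0"
          by (auto intro: funpow_zero_mono[OF linP])
        then have "(P ^^ (max k l)) (x + y) = 0" using clinear_funpow[OF linP, of "max k l"]
          by (simp add: clinear_iff)
        then show "x + y \<in> {v. \<exists>k. (P ^^ k) v = 0}" by blast
      next
        fix c x assume "x \<in> {v. \<exists>k. (P ^^ k) v = 0}"
        then obtain k where "(P ^^ k) x = 0" by blast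
        then have "(P ^^ k) (c *\<^sub>C x) = 0" using clinear_funpow[OF linP, of k]
          by (simp add: clinear_iff)
        then show "c *\<^sub>C x \<in> {v. \<exists>k. (P ^^ k) v = 0}" by blast
      qed
      show "a m i c x \<in> {v. \<exists>k. (P ^^ k) v = 0}" if "x \<in> {v. \<exists>k. (P ^^ k) v = 0}" for m i c x
      proof -
        from that obtain k where k: "(P ^^ k) x = 0" by blast
        then have "(P ^^ Suc k) x = 0" by (rule funpow_zero_mono[OF linP]) simp
        with k have "(P ^^ Suc k) (a m i c x) = 0" unfolding comm_pow by simp
        then show ?thesis by blast
      qed
      show "u \<in> {v. \<exists>k. (P ^^ k) v = 0}" using u(2) by (intro CollectI exI[of _ 1]) (simp add: P_def)
    qed (rule u(1))
    then show ?thesis by blast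
  qed
  have P_nil: "(P ^^ N) v = 0" for v
  proof -
    have "v \<in> {v. (P ^^ N) v = 0}"
    proof (rule weights_span)
      show "complex_vector.subspace {v. (P ^^ N) v = 0}"
        using clinear_funpow[OF linP, of N] clinear_0[OF clinear_funpow[OF linP, of N]]
        by (simp add: complex_vector.subspace_def clinear_iff)
      show "weight_vectors a \<nu> \<subseteq> {v. (P ^^ N) v = 0}" for \<nu>
      proof
        fix x assume x: "x \<in> weight_vectors a \<nu>"
        have "(P ^^ N) x = 0"
        proof (rule nilpotent_on_finite_dim[OF rel_dim_le_weight_vectors linP _ loc_nil x])
          show "P y \<in> weight_vectors a \<nu>" if "y \<in> weight_vectors a \<nu>" for y
            unfolding P_def
            by (intro complex_vector.subspace_diff complex_vector.subspace_scale weight_vectors_subspace h_wt that)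
        qed
        then show "x \<in> {v. (P ^^ N) v = 0}" by simp
      qed
    qed
    then show ?thesis by simp
  qed
  (* The first commutator turns P into a multiple of t^e d_j (x) b for the unit vector e, and the second
     one, with t^{-e} d_j, turns this into a multiple of d_j (x) b. *)
  have \<eta>1: "\<eta> 1 = 1"
  proof (rule ccontr)
    assume "\<eta> 1 \<noteq> 1"
    have "(1 - \<eta> 1) *\<^sub>C b \<in> annihilator" using \<eta>[of 1] by (simp add: complex_vector.scale_left_diff_distrib)
    then have "inverse (1 - \<eta> 1) *\<^sub>C (1 - \<eta> 1) *\<^sub>C b \<in> annihilator"
      by (rule algebra_ideal_scale[OF annihilator_ideal])
    with \<open>\<eta> 1 \<noteq> 1\<close> b show False by simp
  qed
  have D_nil: "((a 0 j b) ^^ (4 * N)) v = 0" for j v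
  proof -
    let ?e = "axis j 1 :: int ^ 'n"
    have e: "?e \<noteq> 0" "?e $ j = 1" by (simp add: axis_eq_0_iff, simp add: axis_def)
    have g0: "g ?e \<noteq> 0" unfolding g_def using \<gamma> e(1) by blast
    let ?Z = "\<lambda>v. g ?e *\<^sub>C a ?e j b v"
    have Z_nil: "(?Z ^^ (2 * N)) v = 0" for v
    proof (rule nilpotent_commutator[where P = P and Y = "a ?e j 1" and Z' = "\<lambda>_. 0"])
      show "P (a ?e j 1 v) = a ?e j 1 (P v) + ?Z v" for v using comm_P[of ?e j 1 v] by (simp add: \<eta>1)
      show "?Z (a ?e j 1 v) = a ?e j 1 (?Z v) + 0" for v
        using comm[of ?e j b ?e j 1 v] by (simp add: a_scale)
      show "P (?Z v) = ?Z (P v)" for v by (simp add: P_scale comm_Pb)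
      show "P 0 = 0" by (rule clinear_0[OF linP])
    qed (use linP lin_scale lin P_nil in \<open>auto simp: clinear_iff\<close>)
    define k2 k3 where "k2 = - 2 * g ?e" and "k3 = 2 * g ?e"
    let ?Z2 = "\<lambda>v. k2 *\<^sub>C a 0 j b v"
    have Z2_nil: "(?Z2 ^^ (2 * (2 * N))) v = 0" for v
    proof (rule nilpotent_commutator[where P = ?Z and Y = "a (- ?e) j 1" and Z' = "\<lambda>v. k3 *\<^sub>C a (- ?e) j b v"])
      show "?Z (a (- ?e) j 1 v) = a (- ?e) j 1 (?Z v) + ?Z2 v" for v
        using comm_opposite[of ?e j b 1 v] e(2)
        by (simp add: a_scale complex_vector.scale_right_diff_distrib k2_def)
      show "?Z2 (a (- ?e) j 1 v) = a (- ?e) j 1 (?Z2 v) + k3 *\<^sub>C a (- ?e) j b v" for v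
      proof -
        have "a 0 j b (a (- ?e) j 1 v) = a (- ?e) j 1 (a 0 j b v) - a (- ?e) j b v"
          using comm_cartan[of "- ?e" j 1 j b v] e(2) by simp
        then show ?thesis unfolding a_scale by (simp add: complex_vector.scale_right_diff_distrib k2_def k3_def)
      qed
    qed (use Z_nil lin_scale lin in \<open>simp_all add: a_scale abelian mult.commute\<close>)
    have "k2 ^ (2 * (2 * N)) *\<^sub>C ((a 0 j b) ^^ (2 * (2 * N))) v = 0"
      using Z2_nil[of v] unfolding funpow_scaleC[OF lin] .
    then show ?thesis using g0 by (simp add: k2_def)
  qed
  (* The commutator of t^m d_i with the first vanishing power of P shows that t^m d_i (x) b kills the
     image of the power before it. *)
  have kernel0: "\<exists>v. v \<noteq> 0 \<and> (\<forall>m i. m \<noteq> 0 \<longrightarrow> a m i b v = 0)"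
  proof -
    define k where "k = (LEAST k. \<forall>v. (P ^^ k) v = 0)"
    have k: "\<forall>v. (P ^^ k) v = 0" unfolding k_def by (rule LeastI[of _ N]) (simp add: P_nil)
    obtain v0 :: 'v where "v0 \<noteq> 0" using nonzero by blast
    then have "k \<noteq> 0" using k by (intro notI) auto
    then obtain l where l: "k = Suc l" using not0_implies_Suc by blast
    then have "l < (LEAST k. \<forall>v. (P ^^ k) v = 0)" by (simp add: k_def)
    then obtain v where v: "(P ^^ l) v \<noteq> 0" using not_less_Least by blast
    have "a m i b ((P ^^ l) v) = 0" if "m \<noteq> 0" for m i
    proof -
      have "0 = of_nat (Suc l) *\<^sub>C g m *\<^sub>C a m i b ((P ^^ l) v)"
        using comm_pow[of l m i 1 v] k unfolding l by (simp add: \<eta>1 del: funpow.simps of_nat_Suc)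
      moreover have "g m \<noteq> 0" unfolding g_def using \<gamma>[OF that] .
      ultimately show ?thesis using of_nat_neq_0[of l, where 'a = complex]
        by (metis complex_vector.scale_eq_0_iff)
    qed
    with v show ?thesis by blast
  qed
  (* The operators d_j (x) b commute with everything in W (x) b, so the last nonzero vector in their
     orbit keeps what has been achieved so far. *)
  have kernel: "\<exists>v. v \<noteq> 0 \<and> (\<forall>m i. m \<noteq> 0 \<longrightarrow> a m i b v = 0) \<and> (\<forall>j\<in>J. a 0 j b v = 0)"
    if "finite J" for J
    using that
  proof (induction J rule: finite_induct)
    case (insert j J)
    then obtain v where v: "v \<noteq> 0" "\<And>m i. m \<noteq> 0 \<Longrightarrow> a m i b v = 0" "\<And>j. j \<in> J \<Longrightarrow> a 0 j b v = 0"
      by blast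
    let ?D = "a 0 j b"
    define k where "k = (LEAST k. (?D ^^ k) v = 0)"
    have k: "(?D ^^ k) v = 0" unfolding k_def by (rule LeastI) (rule D_nil)
    have "k \<noteq> 0" using k v(1) by (intro notI) auto
    then obtain l where l: "k = Suc l" using not0_implies_Suc by blast
    then have "l < (LEAST k. (?D ^^ k) v = 0)" by (simp add: k_def)
    then have nz: "(?D ^^ l) v \<noteq> 0" using not_less_Least by blast
    have "a m i b ((?D ^^ l) v) = (?D ^^ l) (a m i b v)" for m i
      by (rule funpow_commutes[symmetric]) (rule abelian)
    then have "a m i b ((?D ^^ l) v) = 0" if "a m i b v = 0" for m i
      using that clinear_0[OF clinear_funpow[OF lin]] by simp
    moreover have "?D ((?D ^^ l) v) = 0" using k by (simp add: l)
    ultimately show ?case using nz v by blast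
  qed (use kernel0 in auto)
  then obtain v where v: "v \<noteq> 0" "\<And>m i. m \<noteq> 0 \<Longrightarrow> a m i b v = 0" "\<And>j. a 0 j b v = 0"
    using kernel[of UNIV] by auto
  have "a m i (b * c) v = 0" for m i c
    using v(2)[of m i] v(3)[of i] eta[of m i c v] by (cases "m = 0") (simp_all add: mult.commute)
  then have "b \<in> annihilator" by (rule annihilatorI[OF v(1)])
  with b show False by simp
qed

section \<open>Two points give unbounded multiplicities\<close>

text \<open>
  This makes \<open>t\<^sup>m d\<^sub>i \<otimes> e\<close> and \<open>t\<^sup>m d\<^sub>i \<otimes> f\<close> act as two commuting copies of the Witt algebra, both
  nontrivially.
\<close>

definition idempotent_pair :: "'b \<Rightarrow> 'b \<Rightarrow> bool"
  where "idempotent_pair e f \<longleftrightarrow> e * e - e \<in> annihilator \<and> f * f - f \<in> annihilator \<and>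
    e * f \<in> annihilator \<and> e \<notin> annihilator \<and> f \<notin> annihilator"

lemma idempotent_pair_swap: "idempotent_pair e f \<Longrightarrow> idempotent_pair f e"
  by (simp add: idempotent_pair_def mult.commute)

definition joint_weight_vector :: "'b \<Rightarrow> 'b \<Rightarrow> ('n \<Rightarrow> complex) \<Rightarrow> ('n \<Rightarrow> complex) \<Rightarrow> 'v \<Rightarrow> bool"
  where "joint_weight_vector e f \<alpha> \<beta> v \<longleftrightarrow> v \<noteq> 0 \<and>
    (\<forall>j. a 0 j e v = \<alpha> j *\<^sub>C v \<and> a 0 j f v = \<beta> j *\<^sub>C v)"

lemma joint_weight_vector_swap: "joint_weight_vector e f \<alpha> \<beta> v \<longleftrightarrow> joint_weight_vector f e \<beta> \<alpha> v"
  by (auto simp: joint_weight_vector_def)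

lemma idempotent_coeff:
  assumes "e * e - e \<in> annihilator"
  shows "a m i (e * (e * c)) v = a m i (e * c) v"
proof (rule annihilator_cong)
  have "c * (e * e - e) \<in> annihilator" by (rule algebra_ideal_mult[OF annihilator_ideal assms])
  then show "e * (e * c) - e * c \<in> annihilator" by (simp add: algebra_simps)
qed

lemma joint_weight_vector_move:
  assumes ef: "idempotent_pair e f" and v: "joint_weight_vector e f \<alpha> \<beta> v"
    and nz: "a m i (e * c) v \<noteq> 0"
  shows "joint_weight_vector e f (\<lambda>j. \<alpha> j + of_int (m $ j)) \<beta> (a m i (e * c) v)"
proof -
  have "a 0 j e (a m i (e * c) v) = (\<alpha> j + of_int (m $ j)) *\<^sub>C a m i (e * c) v" for j
  proof -
    have "a m i (e * c * e) v = a m i (e * c) v"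
      using idempotent_coeff[of e m i c v] ef by (simp add: idempotent_pair_def ac_simps)
    then show ?thesis using comm_cartan[of m i "e * c" j e v] v
      by (simp add: joint_weight_vector_def a_scale scaleC_add_left)
  qed
  moreover have "a 0 j f (a m i (e * c) v) = \<beta> j *\<^sub>C a m i (e * c) v" for j
  proof -
    have "c * (e * f) \<in> annihilator"
      using ef algebra_ideal_mult[OF annihilator_ideal] by (simp add: idempotent_pair_def)
    then have "a m i (e * c * f) v = 0" by (simp add: annihilator_def ac_simps)
    then show ?thesis using comm_cartan[of m i "e * c" j f v] v
      by (simp add: joint_weight_vector_def a_scale)
  qed
  ultimately show ?thesis using nz by (simp add: joint_weight_vector_def)
qed

text \<open>
  If the weight is zero, some \<open>t\<^sup>m d\<^sub>i \<otimes> ec\<close> with \<open>m \<noteq> 0\<close> moves the vector to weight \<open>m\<close>; otherwise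
  brackets of such elements show that \<open>W \<otimes> eB\<close> kills it.
\<close>

lemma joint_weight_vector_nonzero_weight:
  assumes ef: "idempotent_pair e f" and v: "joint_weight_vector e f \<alpha> \<beta> v"
  shows "\<exists>\<alpha>' p v'. \<alpha>' p \<noteq> 0 \<and> joint_weight_vector e f \<alpha>' \<beta> v'"
proof (cases "\<alpha> = (\<lambda>_. 0)")
  case False
  with v show ?thesis by (metis ext)
next
  case True
  have "\<exists>m i c. m \<noteq> 0 \<and> a m i (e * c) v \<noteq> 0"
  proof (rule ccontr)
    assume "\<not> ?thesis"
    then have z: "a m i (e * c) v = 0" if "m \<noteq> 0" for m i c using that by blast
    have "a m i (e * c) v = 0" for m i c
    proof (cases "m = 0")
      case True
      let ?x = "axis i 1 :: int ^ 'n"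
      have x: "?x \<noteq> 0" "- ?x \<noteq> 0" "?x $ i = 1" by (simp_all add: axis_eq_0_iff)
      have "(2 :: complex) *\<^sub>C a 0 i (e * 1 * (e * c)) v = 0"
        using comm_opposite[of ?x i "e * 1" "e * c" v] z[OF x(1), of i 1] z[OF x(2), of i c] x(3) by simp
      then have "a 0 i (e * (e * c)) v = 0" by simp
      then show ?thesis using idempotent_coeff[of e 0 i c v] ef True by (simp add: idempotent_pair_def)
    qed (rule z)
    then have "e \<in> annihilator" using v annihilatorI by (auto simp: joint_weight_vector_def)
    with ef show False by (simp add: idempotent_pair_def)
  qed
  then obtain m i c where m: "m \<noteq> 0" "a m i (e * c) v \<noteq> 0" by blast
  obtain p where "m $ p \<noteq> 0" using m(1) by (auto simp: vec_eq_iff)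
  with joint_weight_vector_move[OF ef v m(2)] True show ?thesis
    by (intro exI[of _ "\<lambda>j. \<alpha> j + of_int (m $ j)"] exI[of _ p] exI[of _ "a m i (e * c) v"]) simp
qed

text \<open>
  With \<open>m = (k, \<dots>, k)\<close>, the bracket of \<open>t\<^sup>m d\<^sub>p \<otimes> e\<close> and \<open>t\<^sup>-\<^sup>m d\<^sub>p \<otimes> e\<close> acts on \<open>v\<close> as \<open>-2k \<alpha>\<^sub>p \<noteq> 0\<close>, so one of
  the two does not kill \<open>v\<close>. Which one is out of control, but the length of the step is not. The fixed
  direction \<open>(1, \<dots>, 1)\<close> keeps the moves of the two factors on a common line.
\<close>

lemma joint_weight_vector_walk:
  fixes k :: nat
  assumes ef: "idempotent_pair e f" and v: "joint_weight_vector e f \<alpha> \<beta> v" and p: "\<alpha> p \<noteq> 0" and k: "k > 0"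
  shows "\<exists>z v'. \<bar>z\<bar> = int k \<and> joint_weight_vector e f (\<lambda>j. \<alpha> j + of_int z) \<beta> v'"
proof -
  let ?m = "\<lambda>z :: int. (\<chi> j. z) :: int ^ 'n"
  have neg: "- ?m (int k) = ?m (- int k)" by (simp add: vec_eq_iff)
  have "a 0 p (e * 1 * (e * 1)) v = \<alpha> p *\<^sub>C v"
    using idempotent_coeff[of e 0 p 1 v] ef v by (simp add: idempotent_pair_def joint_weight_vector_def)
  then have "a (?m (int k)) p (e * 1) v \<noteq> 0 \<or> a (?m (- int k)) p (e * 1) v \<noteq> 0"
    using comm_opposite[of "?m (int k)" p "e * 1" "e * 1" v] v p k
    by (auto simp: neg joint_weight_vector_def)
  then obtain z where "\<bar>z\<bar> = int k" "a (?m z) p (e * 1) v \<noteq> 0" by (metis abs_minus_cancel abs_of_nat)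
  with joint_weight_vector_move[OF ef v, of "?m z" p 1] show ?thesis by auto
qed

lemma cartan_commute: "a 0 i b (a 0 j c v) = a 0 j c (a 0 i b v)"
  using comm_cartan[of 0 i b j c v] by simp

text \<open>
  The set \<open>R\<close> collects the moves \<open>(z, y)\<close> along \<open>(1, \<dots>, 1)\<close> of the two factors that reach joint weight
  vectors. It has at least \<open>M\<^sup>2\<close> elements, one for each pair of step lengths. Those with the same sum
  \<open>s = z + y\<close> lie in one weight space and are separated by the eigenvalues of \<open>d\<^sub>p \<otimes> e\<close>, so there are
  at most \<open>N\<close> of them.
\<close>

lemma no_idempotent_pair:
  assumes ef: "idempotent_pair e f" and sum: "e + f = 1"
  shows False
proof -
  obtain \<mu> w where w: "w \<in> weight_vectors a \<mu>" "w \<noteq> 0" using weight_exists by blast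
  let ?T = "\<lambda>(x, j). a 0 j (if x then e else f)"
  have "\<exists>u\<in>weight_vectors a \<mu>. u \<notin> {0} \<and> (\<forall>q\<in>UNIV. \<exists>c. ?T q u - c *\<^sub>C u \<in> {0})"
  proof (rule common_eigenvector[OF rel_dim_le_weight_vectors])
    show "?T q (?T r x) = ?T r (?T q x)" for q r x
      by (simp add: split_beta cartan_commute)
    show "?T q x \<in> weight_vectors a \<mu>" if "x \<in> weight_vectors a \<mu>" for q x
      using weight_vectors_cartan[OF that] by (cases q) simp
    show "\<not> weight_vectors a \<mu> \<subseteq> {0}" using w by blast
  qed (use lin weight_vectors_subspace complex_vector.subspace_0[OF weight_vectors_subspace] in \<open>auto split: prod.splits\<close>)
  then obtain u where u: "u \<noteq> 0" "\<And>q. \<exists>c. ?T q u - c *\<^sub>C u = 0" by blast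
  have "\<exists>c. a 0 j e u = c *\<^sub>C u" "\<exists>c. a 0 j f u = c *\<^sub>C u" for j
    using u(2)[of "(True, j)"] u(2)[of "(False, j)"] by auto
  then obtain \<alpha>0 \<beta>0 where "joint_weight_vector e f \<alpha>0 \<beta>0 u"
    using u(1) unfolding joint_weight_vector_def by metis
  then obtain \<alpha> p v1 where \<alpha>: "\<alpha> p \<noteq> 0" and "joint_weight_vector e f \<alpha> \<beta>0 v1"
    using joint_weight_vector_nonzero_weight[OF ef] by blast
  then obtain \<beta> q v where \<beta>: "\<beta> q \<noteq> 0" and v: "joint_weight_vector e f \<alpha> \<beta> v"
    using joint_weight_vector_nonzero_weight[OF idempotent_pair_swap[OF ef]] joint_weight_vector_swap by metis
  (* Any M with M^2 > (4 M + 1) N will do. *)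
  define M where "M = 5 * N + 1"
  define R where "R = {(z, y). \<bar>z\<bar> \<le> int M \<and> \<bar>y\<bar> \<le> int M \<and>
    (\<exists>u. joint_weight_vector e f (\<lambda>j. \<alpha> j + of_int z) (\<lambda>j. \<beta> j + of_int y) u)}"
  have "R \<subseteq> {- int M..int M} \<times> {- int M..int M}" by (auto simp: R_def abs_le_iff)
  then have fR: "finite R" by (rule finite_subset) simp
  have "\<exists>z y. \<bar>z\<bar> = int (fst kl) \<and> \<bar>y\<bar> = int (snd kl) \<and> (z, y) \<in> R"
    if kl: "kl \<in> {1..M} \<times> {1..M}" for kl
  proof -
    obtain z v1 where z: "\<bar>z\<bar> = int (fst kl)" "joint_weight_vector e f (\<lambda>j. \<alpha> j + of_int z) \<beta> v1"
      using joint_weight_vector_walk[OF ef v \<alpha>, of "fst kl"] kl by auto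
    then obtain y v2 where "\<bar>y\<bar> = int (snd kl)"
      "joint_weight_vector f e (\<lambda>j. \<beta> j + of_int y) (\<lambda>j. \<alpha> j + of_int z) v2"
      using joint_weight_vector_walk[OF idempotent_pair_swap[OF ef], of \<beta> "\<lambda>j. \<alpha> j + of_int z" v1 q "snd kl"] kl \<beta>
        joint_weight_vector_swap by auto
    with z kl show ?thesis unfolding R_def using joint_weight_vector_swap by fastforce
  qed
  then obtain zf yf where zy: "\<And>kl. kl \<in> {1..M} \<times> {1..M} \<Longrightarrow>
      \<bar>zf kl\<bar> = int (fst kl) \<and> \<bar>yf kl\<bar> = int (snd kl) \<and> (zf kl, yf kl) \<in> R" by metis
  have "inj_on (\<lambda>kl. (zf kl, yf kl)) ({1..M} \<times> {1..M})"
  proof (rule inj_onI)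
    fix s t assume "s \<in> {1..M} \<times> {1..M}" "t \<in> {1..M} \<times> {1..M}" "(zf s, yf s) = (zf t, yf t)"
    then have "int (fst s) = int (fst t)" "int (snd s) = int (snd t)" using zy by (metis prod.inject)+
    then show "s = t" by (simp add: prod_eq_iff)
  qed
  then have "card ({1..M} \<times> {1..M}) \<le> card R"
    using zy fR by (intro card_inj_on_le[where f = "\<lambda>kl. (zf kl, yf kl)"]) auto
  then have lower: "M * M \<le> card R" by (simp add: card_cartesian_product)
  define Rs where "Rs s = {r \<in> R. fst r + snd r = s}" for s
  have fiber: "card (Rs s) \<le> N" for s
  proof -
    let ?C = "(\<lambda>r. \<alpha> p + of_int (fst r)) ` Rs s"
    have "inj_on (\<lambda>r. \<alpha> p + of_int (fst r)) (Rs s)"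
      by (rule inj_onI) (auto simp: Rs_def prod_eq_iff)
    then have "card (Rs s) = card ?C" by (simp add: card_image)
    also have "\<dots> \<le> N"
    proof (rule card_eigenvalues_le[OF rel_dim_le_weight_vectors lin[of 0 p e]])
      show "finite ?C" using fR by (simp add: Rs_def)
      fix c assume "c \<in> ?C"
      then obtain z y u where c: "c = \<alpha> p + of_int z" and s: "z + y = s"
        and u: "joint_weight_vector e f (\<lambda>j. \<alpha> j + of_int z) (\<lambda>j. \<beta> j + of_int y) u"
        by (auto simp: Rs_def R_def)
      have "a 0 j 1 u = (\<alpha> j + \<beta> j + of_int s) *\<^sub>C u" for j
        using u s by (auto simp: sum[symmetric] a_coeff_add joint_weight_vector_def scaleC_add_left)
      then have "u \<in> weight_vectors a (\<chi> j. \<alpha> j + \<beta> j + of_int s)" by (simp add: weight_vectors_def)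
      then show "\<exists>u\<in>weight_vectors a (\<chi> j. \<alpha> j + \<beta> j + of_int s). u \<noteq> 0 \<and> a 0 p e u = c *\<^sub>C u"
        using u c by (auto simp: joint_weight_vector_def)
    qed
    finally show ?thesis .
  qed
  have "R = (\<Union>s\<in>{- 2 * int M..2 * int M}. Rs s)"
    by (auto simp: Rs_def R_def abs_le_iff)
  then have "card R \<le> (\<Sum>s\<in>{- 2 * int M..2 * int M}. card (Rs s))"
    by (metis card_UN_le finite_atLeastAtMost_int)
  also have "\<dots> \<le> (4 * M + 1) * N"
    using sum_bounded_above[of "{- 2 * int M..2 * int M}" "\<lambda>s. card (Rs s)" N] fiber by (simp add: nat_add_distrib nat_mult_distrib)
  finally have "M * M \<le> (4 * M + 1) * N" using lower by simp
  moreover have "M * M = 5 * (N * M) + M" "(4 * M + 1) * N = 4 * (N * M) + N" "M = 5 * N + 1"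
    by (simp_all add: M_def algebra_simps)
  ultimately show False by linarith
qed

section \<open>Evaluation at one point\<close>

lemma evaluation_or_trivial:
  "1 \<in> annihilator \<or> (\<exists>\<eta>. algebra_hom \<eta> \<and> (\<forall>m i b v. a m i b v = \<eta> b *\<^sub>C a m i 1 v))"
proof (cases "1 \<in> annihilator")
  case False
  note ideal = annihilator_ideal
  obtain b \<eta> where b: "b \<notin> annihilator" and \<eta>: "algebra_hom \<eta>" "\<And>x. x * b - \<eta> x *\<^sub>C b \<in> annihilator"
    using annihilator_socle[OF False] by blast
  have nz: "\<eta> b \<noteq> 0" by (rule socle_eigenvalue_nonzero[OF b \<eta>(2)])
  define e where "e = inverse (\<eta> b) *\<^sub>C b"
  have e: "x * e - \<eta> x *\<^sub>C e \<in> annihilator" for x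
    using algebra_ideal_scale[OF ideal \<eta>(2)[of x], of "inverse (\<eta> b)"]
    by (simp add: e_def scaleC_mult_right complex_vector.scale_right_diff_distrib mult.commute)
  have "\<eta> e = 1" using \<eta>(1) nz by (simp add: e_def algebra_hom_def clinear_iff)
  then have ee: "e * e - e \<in> annihilator" using e[of e] by simp
  have "e \<notin> annihilator"
  proof
    assume "e \<in> annihilator"
    then have "\<eta> b *\<^sub>C e \<in> annihilator" by (rule algebra_ideal_scale[OF ideal])
    then show False using b nz by (simp add: e_def)
  qed
  define f where "f = 1 - e"
  have "- (1 :: complex) *\<^sub>C (e * e - e) \<in> annihilator" by (rule algebra_ideal_scale[OF ideal ee])
  then have ef: "e * f \<in> annihilator" by (simp add: f_def algebra_simps)
  have "f * f - f = e * e - e" by (simp add: f_def algebra_simps)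
  then have ff: "f * f - f \<in> annihilator" using ee by simp
  have f: "f \<in> annihilator"
  proof (rule ccontr)
    assume "f \<notin> annihilator"
    with ee ff ef \<open>e \<notin> annihilator\<close> have "idempotent_pair e f" by (simp add: idempotent_pair_def)
    then show False by (rule no_idempotent_pair) (simp add: f_def)
  qed
  have "a m i x v = \<eta> x *\<^sub>C a m i 1 v" for m i x v
  proof -
    have "x - \<eta> x *\<^sub>C 1 = x * f + (x * e - \<eta> x *\<^sub>C e) + (- \<eta> x) *\<^sub>C f"
      by (simp add: f_def algebra_simps complex_vector.scale_right_diff_distrib)
    also have "\<dots> \<in> annihilator"
      by (intro algebra_ideal_add[OF ideal] algebra_ideal_mult[OF ideal] algebra_ideal_scale[OF ideal] f e)
    finally show ?thesis using annihilator_cong a_coeff_scale by metis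
  qed
  with \<eta>(1) show ?thesis by blast
qed simp

end

theorem theorem3p17:
  fixes act :: "('n::finite witt, 'b::complex_comm_algebra) tensor \<Rightarrow> 'v::complex_vector \<Rightarrow> 'v"
  assumes "finitely_generated_algebra TYPE('b)"
    and "lie_module act"
    and "irreducible_module act"
    and "uniformly_bounded act"
  shows "single_point_evaluation act"
proof -
  have bil: "cbilinear act" and bracket: "\<And>x y v. act (lie_bracket x y) v = act x (act y v) - act y (act x v)"
    using assms(2) by (simp_all add: lie_module_def)
  have linv: "clinear (act x)" and lint: "clinear (\<lambda>x. act x v)" for x v
    using bil by (simp_all add: cbilinear_def)
  note bilt = cbilinear_pure_tensor[where 'a = "'n witt" and 'b = 'b]
  have linb: "clinear (\<lambda>b :: 'b. x \<otimes> b)" and linx: "clinear (\<lambda>x :: 'n witt. x \<otimes> b)" for x :: "'n witt" and b :: 'b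
    using bilt by (simp_all add: cbilinear_def)
  define a where "a m i b v = act (witt_basis m i \<otimes> b) v" for m i b v
  obtain N where wm: "weight_module act" and N: "\<And>\<mu>. weight_space act \<mu> \<noteq> {0} \<Longrightarrow>
      (\<exists>X. finite X \<and> complex_vector.independent X \<and>
        complex_vector.span X = weight_space act \<mu> \<and> card X < N)"
    using assms(4) unfolding uniformly_bounded_def by blast
  have wt: "weight_vectors a \<mu> = weight_space act \<mu>" for \<mu>
    by (simp add: weight_vectors_def weight_space_def a_def)
  interpret bounded_irreducible_current_module a N
  proof (rule bounded_irreducible_current_module.intro)
    show "clinear (a m i b)" for m i b unfolding a_def by (rule linv)
    show "clinear (\<lambda>b. a m i b v)" for m i v
      unfolding a_def by (rule clinear_compose[OF lint linb])
    show "a m i b (a k j c v) = a k j c (a m i b v)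
      + (of_int (k $ i) *\<^sub>C a (m + k) j (b * c) v - of_int (m $ j) *\<^sub>C a (m + k) i (b * c) v)" for m i b k j c v
    proof -
      have "act (lie_bracket (witt_basis m i \<otimes> b) (witt_basis k j \<otimes> c)) v
          = of_int (k $ i) *\<^sub>C a (m + k) j (b * c) v - of_int (m $ j) *\<^sub>C a (m + k) i (b * c) v"
        unfolding lie_bracket_pure_tensor lie_bracket_witt_basis a_def
          clinear_diff[OF linx] clinear_diff[OF lint]
        using linx lint by (simp add: clinear_iff)
      then show ?thesis using bracket[of "witt_basis m i \<otimes> b" "witt_basis k j \<otimes> c" v]
        by (simp add: a_def algebra_simps)
    qed
    show "v \<in> U" if U: "complex_vector.subspace U" and inv: "\<And>m i b u. u \<in> U \<Longrightarrow> a m i b u \<in> U"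
      and u: "u \<in> U" "u \<noteq> 0" for U u v
    proof -
      have "act t x \<in> U" if x: "x \<in> U" for t x
      proof -
        have "t \<in> {t. act t x \<in> U}"
        proof (rule witt_tensor_in_subspace)
          show "complex_vector.subspace {t. act t x \<in> U}"
            using U lint[of x] clinear_0[OF lint[of x]]
            by (auto simp: complex_vector.subspace_def clinear_iff)
        qed (use inv x in \<open>simp add: a_def\<close>)
        then show ?thesis by simp
      qed
      then have "submodule act U" using U by (simp add: submodule_def)
      then show ?thesis using assms(3) u by (auto simp: irreducible_module_def)
    qed
    show "\<exists>v :: 'v. v \<noteq> 0" using assms(3) by (auto simp: irreducible_module_def)
    show "v \<in> U" if U: "complex_vector.subspace U" and sub: "\<And>\<mu>. weight_vectors a \<mu> \<subseteq> U" for U v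
    proof -
      obtain f where f: "\<And>\<mu>. Poly_Mapping.lookup f \<mu> \<in> weight_space act \<mu>"
        "v = (\<Sum>\<mu>\<in>Poly_Mapping.keys f. Poly_Mapping.lookup f \<mu>)"
        using wm unfolding weight_module_def by blast
      show ?thesis unfolding f(2)
        by (rule complex_vector.subspace_sum[OF U]) (use f(1) sub wt in blast)
    qed
    show "\<exists>X. finite X \<and> complex_vector.independent X \<and>
      complex_vector.span X = weight_vectors a \<mu> \<and> card X \<le> N" for \<mu>
    proof (cases "weight_space act \<mu> = {0}")
      case True
      then show ?thesis unfolding wt
        by (intro exI[of _ "{}"]) (simp add: complex_vector.independent_empty)
    next
      case False
      with N[of \<mu>] show ?thesis unfolding wt by (auto intro: less_imp_le)
    qed
  qed
  have extend: "act (x \<otimes> b) v = \<eta> b *\<^sub>C act (x \<otimes> 1) v"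
    if "\<And>m i b v. a m i b v = \<eta> b *\<^sub>C a m i 1 v" for \<eta> x b v
    using witt_in_span_basis[of x]
  proof (induction rule: complex_vector.span_induct_alt)
    case base
    show ?case by (simp add: clinear_0[OF linx] clinear_0[OF lint])
  next
    case (step c y z)
    then obtain m i where y: "y = witt_basis m i" by auto
    have "act ((c *\<^sub>C y + z) \<otimes> d) v = c *\<^sub>C act (y \<otimes> d) v + act (z \<otimes> d) v" for d
      using linx[of d] lint[of v] by (simp add: clinear_iff)
    then show ?case using step.IH that[of m i b v]
      by (simp add: y a_def scaleC_add_right mult.commute)
  qed
  from evaluation_or_trivial show ?thesis
  proof
    assume "1 \<in> annihilator"
    then have "b \<in> annihilator" for b using algebra_ideal_mult[OF annihilator_ideal, of 1 b] by simp
    then have zero: "a m i b v = 0" for m i b v by (simp add: annihilator_def)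
    obtain \<eta> :: "'b \<Rightarrow> complex" where hom: "algebra_hom \<eta>"
      using finitely_generated_algebra_has_point[OF assms(1)] by blast
    have "act (x \<otimes> b) v = \<eta> b *\<^sub>C act (x \<otimes> 1) v" for x b v
      by (rule extend) (simp add: zero)
    with hom show ?thesis unfolding single_point_evaluation_def by blast
  next
    assume "\<exists>\<eta>. algebra_hom \<eta> \<and> (\<forall>m i b v. a m i b v = \<eta> b *\<^sub>C a m i 1 v)"
    then obtain \<eta> where hom: "algebra_hom \<eta>" and eval: "\<And>m i b v. a m i b v = \<eta> b *\<^sub>C a m i 1 v" by blast
    have "act (x \<otimes> b) v = \<eta> b *\<^sub>C act (x \<otimes> 1) v" for x b v
      by (rule extend) (rule eval)
    with hom show ?thesis unfolding single_point_evaluation_def by blast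
  qed
qed

end
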